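(* There exists a countable two-dimensional subshift of finite type $X$ such that for every $k \in \mathbb{N}$, the set $\{P \mid P \sqsubset X^{(k)}\}$ of finite patterns occurring in the $k$-th Cantor–Bendixson derivative of $X$ is $\Pi^0_{2k+1}$-complete (under many-one reductions).
   Context: A two-dimensional SFT over a finite alphabet $S$ is the set of configurations in $S^{\mathbb{Z}^2}$ avoiding a finite set of forbidden finite patterns. A pattern $(D,s)$, $D \subset \mathbb{Z}^2$ finite, occurs in $Y$ ($P \sqsubset Y$) if it appears (up to translation) in some point of $Y$. $X^{(0)} = X$ and $X^{(k+1)}$ is the set of non-isolated points of $X^{(k)}$. Patterns are identified with natural numbers via a natural computable bijection. A set $A$ is many-one reducible to $B$ if there is a computable $f$ with $x \in A \iff f(x) \in B$; $A$ is $\Pi^0_n$-complete if $A$ is $\Pi^0_n$ and every $\Pi^0_n$ set reduces to it. *)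

theory Defs
  imports Main "HOL-Library.Nat_Bijection" "HOL-Library.Countable_Set"
begin

inductive total_rec :: "nat \<Rightarrow> (nat list \<Rightarrow> nat) \<Rightarrow> bool" where
  zero: "total_rec n (\<lambda>_. 0)"
| succ: "total_rec 1 (\<lambda>xs. Suc (xs ! 0))"
| proj: "i < n \<Longrightarrow> total_rec n (\<lambda>xs. xs ! i)"
| comp: "total_rec m g \<Longrightarrow> (\<forall>i<m. total_rec n (fs i)) \<Longrightarrow>
         total_rec n (\<lambda>xs. g (map (\<lambda>i. fs i xs) [0..<m]))"
| prim: "total_rec n g \<Longrightarrow> total_rec (Suc (Suc n)) h \<Longrightarrow>
         total_rec (Suc n) (\<lambda>xs. rec_nat (g (tl xs)) (\<lambda>y r. h (y # r # tl xs)) (hd xs))"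
| mu: "total_rec (Suc n) g \<Longrightarrow> (\<forall>xs. length xs = n \<longrightarrow> (\<exists>y. g (y # xs) = 0)) \<Longrightarrow>
       total_rec n (\<lambda>xs. LEAST y. g (y # xs) = 0)"

definition computable :: "(nat \<Rightarrow> nat) \<Rightarrow> bool" where
  "computable f \<longleftrightarrow> (\<exists>g. total_rec 1 g \<and> (\<forall>x. g [x] = f x))"

definition recursive_set :: "nat set \<Rightarrow> bool" where
  "recursive_set A \<longleftrightarrow> computable (\<lambda>x. if x \<in> A then 1 else 0)"

text \<open>arith_class True n = Sigma^0_n, arith_class False n = Pi^0_n (sets of naturals),
  using the computable Cantor pairing prod_encode to contract quantifier blocks.\<close>
fun arith_class :: "bool \<Rightarrow> nat \<Rightarrow> nat set set" where
  "arith_class b 0 = {A. recursive_set A}"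
| "arith_class True (Suc n) =
     {A. \<exists>B \<in> arith_class False n. A = {x. \<exists>y. prod_encode (x, y) \<in> B}}"
| "arith_class False (Suc n) =
     {A. \<exists>B \<in> arith_class True n. A = {x. \<forall>y. prod_encode (x, y) \<in> B}}"

abbreviation Pi0 :: "nat \<Rightarrow> nat set set" where
  "Pi0 n \<equiv> arith_class False n"

definition many_one_reducible :: "nat set \<Rightarrow> nat set \<Rightarrow> bool" where
  "many_one_reducible A B \<longleftrightarrow> (\<exists>f. computable f \<and> (\<forall>x. x \<in> A \<longleftrightarrow> f x \<in> B))"

definition Pi0_complete :: "nat \<Rightarrow> nat set \<Rightarrow> bool" where
  "Pi0_complete n A \<longleftrightarrow> A \<in> Pi0 n \<and> (\<forall>B \<in> Pi0 n. many_one_reducible B A)"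

type_synonym config = "int \<times> int \<Rightarrow> nat"
type_synonym pattern = "int \<times> int \<rightharpoonup> nat"

definition occurs_in :: "pattern \<Rightarrow> config \<Rightarrow> bool" where
  "occurs_in P x \<longleftrightarrow> (\<exists>u v::int. \<forall>i j a. P (i, j) = Some a \<longrightarrow> x (i + u, j + v) = a)"

definition occurs :: "pattern \<Rightarrow> config set \<Rightarrow> bool" where
  "occurs P Y \<longleftrightarrow> (\<exists>x\<in>Y. occurs_in P x)"

definition is_SFT :: "nat \<Rightarrow> config set \<Rightarrow> bool" where
  "is_SFT m X \<longleftrightarrow> (\<exists>F::pattern set. finite F \<and> (\<forall>P\<in>F. finite (dom P)) \<and>
      X = {x. range x \<subseteq> {..<m} \<and> (\<forall>P\<in>F. \<not> occurs_in P x)})"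

text \<open>Isolated points w.r.t. the product topology: basic neighbourhoods are cylinders,
  i.e. sets of configurations agreeing with x on a finite set D.\<close>
definition isolated_in :: "config \<Rightarrow> config set \<Rightarrow> bool" where
  "isolated_in x Y \<longleftrightarrow> x \<in> Y \<and>
     (\<exists>D. finite D \<and> (\<forall>y\<in>Y. (\<forall>p\<in>D. y p = x p) \<longrightarrow> y = x))"

fun cb_deriv :: "config set \<Rightarrow> nat \<Rightarrow> config set" where
  "cb_deriv Y 0 = Y"
| "cb_deriv Y (Suc k) = {x \<in> cb_deriv Y k. \<not> isolated_in x (cb_deriv Y k)}"

text \<open>Computable coding of patterns by natural numbers: n decodes to a list of codes,
  each code c decodes to ((i,j),a) via Cantor pairing and the standard int/nat bijection;
  the pattern is the finite map given by the list (first entry wins). Every finite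
  pattern over a subset of nat has a code.\<close>
definition decode_entry :: "nat \<Rightarrow> (int \<times> int) \<times> nat" where
  "decode_entry c = (let (pc, a) = prod_decode c; (i, j) = prod_decode pc
                     in ((int_decode i, int_decode j), a))"

definition decode_pattern :: "nat \<Rightarrow> pattern" where
  "decode_pattern n = map_of (map decode_entry (list_decode n))"

end

theory Submission
  imports Defs "HOL-Library.Infinite_Set" "HOL-Computational_Algebra.Primes"
begin

text \<open>
  Membership in \<open>\<Pi>\<^sup>0\<^bsub>2k+1\<^esub>\<close> holds for every subshift of finite type. By compactness, a pattern occurs in
  the next derivative iff for every \<open>N\<close> there are two points that contain it, agree on the first \<open>N\<close>
  cells and differ. This adds two quantifiers per derivative.

  For hardness, every \<open>\<Pi>\<^sup>0\<^bsub>2k+1\<^esub>\<close> set is brought into the form: there are infinitely many \<open>n\<^sub>1\<close>, for which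
  there are infinitely many \<open>n\<^sub>2\<close>, \<dots>, for which there are infinitely many \<open>n\<^sub>k\<close>, such that a \<open>\<Pi>\<^sup>0\<^sub>1\<close>
  statement holds. The subshift draws the runs of one fixed nondeterministic program, which reads \<open>k\<close>
  from its input, guesses \<open>n\<^sub>1, \<dots>, n\<^sub>k\<close> one after the other by loops that may be left at any time,
  and then searches for a counterexample to the \<open>\<Pi>\<^sup>0\<^sub>1\<close> statement, halting (which the subshift forbids)
  if it finds one. The run that never leaves a loop is the limit of the runs that leave it after
  \<open>n\<close> steps, so each guess contributes one derivative, and the seed of the computation occurs in
  the \<open>k\<close>-th derivative iff the statement is true.

  Countability needs a drawing in which limits show only finitely many events. The whole memory is one
  number, transformed in phases by a linear map with a congruence condition; a phase ends only when a
  marker reaches a wall, so a point without visible wall contains at most one change of phase. Since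
  the number grows in every phase, a point with infinitely many phases has a seed, and the number of
  guesses after the seed is bounded.
\<close>

section \<open>Cantor-Bendixson derivatives and spaces of runs\<close>

text \<open>A tape would break countability: a point that shows no seed could carry any tape
  content. Here a row is given by three cuts of the integers and one label from a finite set, so
  there are only countably many rows. The price is arithmetic: a step of a program becomes a
  division with remainder and a multiplication, carried out in one phase by two markers of constant
  speed. One subshift has to serve every \<open>k\<close> and every set at once; therefore the
  program is universal, and its code, \<open>k\<close> and the input are prime exponents of the
  number \<open>n\<close> that the width of the seed displays. Runs are compared with points through
  a homeomorphism between the runs from a given start and the points with the corresponding seed;
  this is why the rule of each phase must be recoverable from two successive states. One guess
  absorbs two quantifier alternations. The universal quantifier that remains says that a search
  never halts, and this holds iff a run exists; hence the odd levels.\<close>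

definition agree :: "'p set \<Rightarrow> ('p \<Rightarrow> 'a) \<Rightarrow> ('p \<Rightarrow> 'a) \<Rightarrow> bool" where
  "agree D x y \<longleftrightarrow> (\<forall>p\<in>D. x p = y p)"

definition isolated :: "('p \<Rightarrow> 'a) \<Rightarrow> ('p \<Rightarrow> 'a) set \<Rightarrow> bool" where
  "isolated x Y \<longleftrightarrow> (\<exists>D. finite D \<and> (\<forall>y\<in>Y. agree D x y \<longrightarrow> y = x))"

fun derived :: "('p \<Rightarrow> 'a) set \<Rightarrow> nat \<Rightarrow> ('p \<Rightarrow> 'a) set" where
  "derived Y 0 = Y"
| "derived Y (Suc k) = {x \<in> derived Y k. \<not> isolated x (derived Y k)}"

lemma cb_deriv_derived: "cb_deriv Y k = derived Y k"
proof (induction k)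
  case (Suc k)
  have "isolated_in x Z \<longleftrightarrow> x \<in> Z \<and> isolated x Z" for x and Z :: "config set"
    unfolding isolated_in_def isolated_def agree_def by (simp add: eq_commute[of "x _"])
  then show ?case using Suc by auto
qed simp

lemma derived_Suc_subset: "derived Y (Suc k) \<subseteq> derived Y k" by auto

lemma derived_antimono: "j \<le> k \<Longrightarrow> derived Y k \<subseteq> derived Y j"
  by (induction k rule: dec_induct) auto

lemma derived_subset: "derived Y k \<subseteq> Y" using derived_antimono[of 0 k Y] by simp

text \<open>Cylinders are open, so a finite set that isolates a point inside one, joined with
  \<open>D\<close>, isolates it in \<open>Y\<close>. Derivatives can thus be computed locally, which
  is how seeds and exits from loops are handled.\<close>

lemma derived_cylinder:
  assumes "finite D"
  shows "derived {y \<in> Y. agree D x y} k = {y \<in> derived Y k. agree D x y}"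
proof (induction k)
  case (Suc k)
  have "isolated z {y \<in> derived Y k. agree D x y} \<longleftrightarrow> isolated z (derived Y k)" if "z \<in> derived Y k" "agree D x z" for z
  proof
    assume "isolated z {y \<in> derived Y k. agree D x y}"
    then obtain D' where D': "finite D'" "\<forall>y\<in>derived Y k. agree D x y \<longrightarrow> agree D' z y \<longrightarrow> y = z"
      unfolding isolated_def by auto
    have "\<forall>y\<in>derived Y k. agree (D \<union> D') z y \<longrightarrow> y = z"
      using D' that by (auto simp: agree_def)
    then show "isolated z (derived Y k)" unfolding isolated_def using D'(1) assms by (metis finite_UnI)
  qed (auto simp: isolated_def)
  then show ?case using Suc by auto
qed simp

text \<open>\<open>icont\<close> for singletons makes \<open>f\<close> injective, and the two
  continuity conditions then carry isolating sets from either side to the other.\<close>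

lemma derived_homeo:
  assumes img: "f ` Y = Z"
    and cont: "\<And>y D'. y \<in> Y \<Longrightarrow> finite D' \<Longrightarrow>
      \<exists>D. finite D \<and> (\<forall>y'\<in>Y. agree D y y' \<longrightarrow> agree D' (f y) (f y'))"
    and icont: "\<And>y D. y \<in> Y \<Longrightarrow> finite D \<Longrightarrow>
      \<exists>D'. finite D' \<and> (\<forall>y'\<in>Y. agree D' (f y) (f y') \<longrightarrow> agree D y y')"
  shows "f ` derived Y k = derived Z k"
proof (induction k)
  case (Suc k)
  have inj: "y = y'" if "y \<in> Y" "y' \<in> Y" "f y = f y'" for y y'
  proof
    fix p
    from icont[OF that(1), of "{p}"] that show "y p = y' p"
      by (auto simp: agree_def)
  qed
  have sub: "\<And>y. y \<in> derived Y k \<Longrightarrow> y \<in> Y" using derived_subset by blast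
  have "isolated (f y) (derived Z k) \<longleftrightarrow> isolated y (derived Y k)" if y: "y \<in> derived Y k" for y
  proof
    assume "isolated (f y) (derived Z k)"
    then obtain D' where D': "finite D'" "\<forall>z\<in>derived Z k. agree D' (f y) z \<longrightarrow> z = f y"
      unfolding isolated_def by auto
    obtain D where D: "finite D" "\<forall>y'\<in>Y. agree D y y' \<longrightarrow> agree D' (f y) (f y')"
      using cont[OF sub[OF y] D'(1)] by auto
    have "\<forall>y'\<in>derived Y k. agree D y y' \<longrightarrow> y' = y"
      using D D' Suc inj sub y by (metis imageI)
    then show "isolated y (derived Y k)" using D(1) unfolding isolated_def by blast
  next
    assume "isolated y (derived Y k)"
    then obtain D where D: "finite D" "\<forall>y'\<in>derived Y k. agree D y y' \<longrightarrow> y' = y"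
      unfolding isolated_def by auto
    obtain D' where D': "finite D'" "\<forall>y'\<in>Y. agree D' (f y) (f y') \<longrightarrow> agree D y y'"
      using icont[OF sub[OF y] D(1)] by auto
    have "\<forall>z\<in>derived Z k. agree D' (f y) z \<longrightarrow> z = f y"
      using D D' Suc sub y by (metis imageE)
    then show "isolated (f y) (derived Z k)" using D'(1) unfolding isolated_def by blast
  qed
  then show ?case unfolding derived.simps Suc[symmetric] by auto
qed (simp add: img)

lemma derived_shift:
  fixes Y :: "(int \<times> int \<Rightarrow> 'a) set"
  assumes "\<And>y u v. y \<in> Y \<Longrightarrow> (\<lambda>(i, t). y (i + u, t + v)) \<in> Y" "y \<in> derived Y k"
  shows "(\<lambda>(i, t). y (i + u, t + v)) \<in> derived Y k"
proof -
  let ?f = "\<lambda>y (i, t). y (i + u, t + v)"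
  have "?f ` derived Y k = derived Y k"
  proof (rule derived_homeo)
    show "?f ` Y = Y"
    proof safe
      fix y assume y: "y \<in> Y"
      then show "?f y \<in> Y" by (rule assms(1))
      have "y = ?f (\<lambda>(i, t). y (i + (-u), t + (-v)))" by auto
      then show "y \<in> ?f ` Y" using assms(1)[OF y, of "-u" "-v"] by blast
    qed
    fix y :: "int \<times> int \<Rightarrow> 'a" and D :: "(int \<times> int) set" assume D: "finite D"
    show "\<exists>D'. finite D' \<and> (\<forall>y'\<in>Y. agree D' y y' \<longrightarrow> agree D (?f y) (?f y'))"
      by (rule exI[of _ "(\<lambda>(i, t). (i + u, t + v)) ` D"]) (use D in \<open>auto simp: agree_def\<close>)
    show "\<exists>D'. finite D' \<and> (\<forall>y'\<in>Y. agree D' (?f y) (?f y') \<longrightarrow> agree D y y')"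
      by (rule exI[of _ "(\<lambda>(i, t). (i - u, t - v)) ` D"]) (use D in \<open>auto simp: agree_def\<close>)
  qed
  then show ?thesis using assms(2) by blast
qed

text \<open>An isolated point is determined by its restriction to an isolating finite set, and there
  are only countably many finite partial functions.\<close>

lemma countable_isolated:
  fixes Y :: "('p::countable \<Rightarrow> 'a::countable) set"
  shows "countable {x \<in> Y. isolated x Y}"
proof -
  have "\<exists>D. finite D \<and> (\<forall>y\<in>Y. agree D x y \<longrightarrow> y = x)" if "x \<in> {x \<in> Y. isolated x Y}" for x
    using that unfolding isolated_def by auto
  then obtain D where D: "\<And>x. x \<in> {x \<in> Y. isolated x Y} \<Longrightarrow>
      finite (D x) \<and> (\<forall>y\<in>Y. agree (D x) x y \<longrightarrow> y = x)"
    by metis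
  let ?g = "\<lambda>x. (\<lambda>p. (p, x p)) ` D x"
  have "inj_on ?g {x \<in> Y. isolated x Y}"
  proof (rule inj_onI)
    fix x y assume x: "x \<in> {x \<in> Y. isolated x Y}" and y: "y \<in> {x \<in> Y. isolated x Y}" and e: "?g x = ?g y"
    have "agree (D x) x y"
      unfolding agree_def using e by (auto simp: image_iff set_eq_iff)
    then show "x = y" using D[OF x] y by auto
  qed
  moreover have "?g ` {x \<in> Y. isolated x Y} \<subseteq> Collect finite" using D by auto
  moreover have "countable (Collect finite :: ('p \<times> 'a) set set)" by (rule countable_Collect_finite)
  ultimately show ?thesis by (meson countable_image_inj_on countable_subset)
qed

lemma countable_if_derived_empty:
  fixes Y :: "('p::countable \<Rightarrow> 'a::countable) set"
  shows "derived Y k = {} \<Longrightarrow> countable Y"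
proof -
  have "countable (Y - derived Y k)"
  proof (induction k)
    case (Suc k)
    have "Y - derived Y (Suc k) \<subseteq> (Y - derived Y k) \<union> {x \<in> derived Y k. isolated x (derived Y k)}" by auto
    then show ?case using Suc countable_isolated[of "derived Y k"] countable_Un countable_subset by meson
  qed simp
  then show "derived Y k = {} \<Longrightarrow> countable Y" by simp
qed

text \<open>Only infinite runs count: a start from which every computation halts has an empty space
  of runs. This is what turns a universal statement into non-emptiness.\<close>

definition runs :: "('a \<Rightarrow> 'a \<Rightarrow> bool) \<Rightarrow> 'a \<Rightarrow> (nat \<Rightarrow> 'a) set" where
  "runs step s = {w. w 0 = s \<and> (\<forall>j. step (w j) (w (Suc j)))}"

lemma derived_runs_prefix:
  assumes path: "\<And>j. j < i \<Longrightarrow> step (h j) (h (Suc j))"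
  shows "derived {w \<in> runs step (h 0). agree {..i} h w} k
    = (\<lambda>w j. if j \<le> i then h j else w (j - i)) ` derived (runs step (h i)) k"
    (is "derived ?Z k = ?f ` _")
proof (rule derived_homeo[symmetric])
  show "?f ` runs step (h i) = ?Z"
  proof safe
    fix w assume w: "w \<in> runs step (h i)"
    show "?f w \<in> runs step (h 0)"
      unfolding runs_def
    proof (safe)
      fix j
      have "j < i \<or> j = i \<or> j > i" by auto
      then show "step (?f w j) (?f w (Suc j))"
        using w path by (auto simp: runs_def Suc_diff_le) (metis diff_self_eq_0 diff_Suc_1 w Suc_diff_le order_refl)
    qed auto
    show "agree {..i} h (?f w)" by (auto simp: agree_def)
  next
    fix w assume w: "w \<in> runs step (h 0)" "agree {..i} h w"
    have "w = ?f (\<lambda>j. w (j + i))" using w by (auto simp: agree_def)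
    moreover have "(\<lambda>j. w (j + i)) \<in> runs step (h i)"
      using w by (auto simp: runs_def agree_def)
    ultimately show "w \<in> ?f ` runs step (h i)" by (rule image_eqI)
  qed
  fix y :: "nat \<Rightarrow> 'a" and D :: "nat set" assume D: "finite D"
  show "\<exists>D'. finite D' \<and> (\<forall>y'\<in>runs step (h i). agree D' y y' \<longrightarrow> agree D (?f y) (?f y'))"
    by (rule exI[of _ "(\<lambda>j. j - i) ` D"]) (auto simp: D agree_def)
  show "\<exists>D'. finite D' \<and> (\<forall>y'\<in>runs step (h i). agree D' (?f y) (?f y') \<longrightarrow> agree D y y')"
    if "y \<in> runs step (h i)"
  proof (rule exI[of _ "(\<lambda>j. j + i) ` D"], safe)
    fix y' assume y': "y' \<in> runs step (h i)" "agree ((\<lambda>j. j + i) ` D) (?f y) (?f y')"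
    show "agree D y y'" unfolding agree_def
    proof
      fix p assume "p \<in> D"
      then have "?f y (p + i) = ?f y' (p + i)" using y'(2) by (auto simp: agree_def)
      then show "y p = y' p" using y'(1) that by (cases p) (auto simp: runs_def)
    qed
  qed (use D in auto)
qed

definition forced :: "('a \<Rightarrow> 'a \<Rightarrow> bool) \<Rightarrow> 'a \<Rightarrow> 'a \<Rightarrow> bool" where
  "forced step s s' \<longleftrightarrow> (\<forall>u. step s u \<longleftrightarrow> u = s')"

lemma derived_runs_det:
  assumes "forced step s s'"
  shows "derived (runs step s) k = {} \<longleftrightarrow> derived (runs step s') k = {}"
proof -
  define h where "h = (\<lambda>j::nat. if j = 0 then s else s')"
  have "{w \<in> runs step (h 0). agree {..1} h w} = runs step s"
    using assms by (auto simp: runs_def agree_def h_def forced_def le_Suc_eq)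
  moreover have "derived {w \<in> runs step (h 0). agree {..1} h w} k
    = (\<lambda>w j. if j \<le> 1 then h j else w (j - 1)) ` derived (runs step (h 1)) k"
    by (rule derived_runs_prefix) (use assms in \<open>auto simp: h_def forced_def\<close>)
  ultimately show ?thesis by (simp add: h_def)
qed

lemma derived_runs_leads:
  assumes "(forced step)\<^sup>*\<^sup>* s s'"
  shows "derived (runs step s) k = {} \<longleftrightarrow> derived (runs step s') k = {}"
  using assms by (induction) (auto simp: derived_runs_det)

text \<open>The case to watch is that \<open>u\<close> already is \<open>s c\<close>: the strict
  progress towards \<open>s (Suc c)\<close> still supplies a next state.\<close>

lemma progress_step:
  assumes prog: "\<And>c::nat. (forced step)\<^sup>+\<^sup>+ (s c) (s (Suc c))" and u: "\<exists>c. (forced step)\<^sup>*\<^sup>* u (s c)"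
  shows "\<exists>v. forced step u v \<and> (\<exists>c. (forced step)\<^sup>*\<^sup>* v (s c))"
proof -
  obtain c where "(forced step)\<^sup>*\<^sup>* u (s c)" using u by blast
  then have "(forced step)\<^sup>+\<^sup>+ u (s (Suc c))" using prog[of c] by simp
  then show ?thesis by (meson tranclpD)
qed

lemma runs_nonempty_if_progress:
  assumes prog: "\<And>c::nat. (forced step)\<^sup>+\<^sup>+ (s c) (s (Suc c))"
  shows "runs step (s 0) \<noteq> {}"
proof -
  define Z where "Z = {u. \<exists>c. (forced step)\<^sup>*\<^sup>* u (s c)}"
  define nx where "nx u = (SOME v. v \<in> Z \<and> step u v)" for u
  have nx: "u \<in> Z \<Longrightarrow> nx u \<in> Z \<and> step u (nx u)" for u
    unfolding nx_def by (rule someI_ex) (use progress_step[of step s u, OF prog] in \<open>auto simp: Z_def forced_def\<close>)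
  have s0: "s 0 \<in> Z" by (auto simp: Z_def)
  have Z: "(nx ^^ j) (s 0) \<in> Z" for j by (induction j) (use nx s0 in auto)
  have "(\<lambda>j. (nx ^^ j) (s 0)) \<in> runs step (s 0)" using nx Z by (auto simp: runs_def)
  then show ?thesis by blast
qed

text \<open>All states of a run are forced by the start, so there is at most one run, and a single
  point is isolated.\<close>

lemma derived_runs_progress:
  assumes prog: "\<And>c::nat. (forced step)\<^sup>+\<^sup>+ (s c) (s (Suc c))"
  shows "derived (runs step (s 0)) (Suc 0) = {}"
proof -
  define Z where "Z = {u. \<exists>c. (forced step)\<^sup>*\<^sup>* u (s c)}"
  have ex: "\<exists>v\<in>Z. forced step u v" if "u \<in> Z" for u
    using progress_step[of step s u, OF prog] that by (auto simp: Z_def)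
  have "w = w'" if w: "w \<in> runs step (s 0)" "w' \<in> runs step (s 0)" for w w'
  proof
    fix j
    have "w j = w' j \<and> w j \<in> Z"
    proof (induction j)
      case 0
      have "s 0 \<in> Z" by (auto simp: Z_def)
      then show ?case using w by (simp add: runs_def)
    next
      case (Suc j)
      then obtain v where v: "v \<in> Z" "forced step (w j) v" using ex by blast
      have "step (w j) (w (Suc j))" "step (w' j) (w' (Suc j))" using w by (auto simp: runs_def)
      then have "step (w j) (w (Suc j))" "step (w j) (w' (Suc j))" using Suc by auto
      then have "w (Suc j) = v" "w' (Suc j) = v" using v(2) unfolding forced_def by blast+
      then show ?case using v(1) by simp
    qed
    then show "w j = w' j" by blast
  qed
  then have "isolated w (runs step (s 0))" if "w \<in> runs step (s 0)" for w
    unfolding isolated_def using that by (intro exI[of _ "{}"]) blast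
  then show ?thesis by auto
qed

text \<open>\<open>s\<close> is the spine that never leaves the loop, \<open>v i\<close> the state
  entered on leaving after \<open>i\<close> rounds. The runs that leave at \<open>i\<close> form a
  cylinder, homeomorphic to the runs from \<open>v i\<close>, and these cylinders cover everything
  except the spine. By \<open>rank\<close> they are exhausted after \<open>Suc k\<close>
  derivatives, so only the spine can survive, and it does so iff cylinders with points left at stage
  \<open>k\<close> accumulate at it.\<close>

lemma derived_runs_branch:
  assumes step: "\<And>i u. step (s i) u \<longleftrightarrow> u = s (Suc i) \<or> u = v i"
    and ne: "\<And>i. v i \<noteq> s (Suc i)"
    and rank: "\<And>i. derived (runs step (v i)) (Suc k) = {}"
  shows "derived (runs step (s 0)) (Suc k) \<noteq> {} \<longleftrightarrow> (\<exists>\<^sub>\<infinity>i. derived (runs step (v i)) k \<noteq> {})" (is ?A)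
    and "derived (runs step (s 0)) (Suc (Suc k)) = {}" (is ?B)
proof -
  let ?Y = "runs step (s 0)"
  define h where "h i = (\<lambda>j. if j \<le> i then s j else v i)" for i :: nat
  have cyl: "(\<exists>w\<in>derived ?Y l. agree {..Suc i} (h i) w) \<longleftrightarrow> derived (runs step (v i)) l \<noteq> {}" for i l
  proof -
    have derived_img: "derived {w \<in> runs step (h i 0). agree {..Suc i} (h i) w} l
      = (\<lambda>w j. if j \<le> Suc i then h i j else w (j - Suc i)) ` derived (runs step (h i (Suc i))) l"
      by (rule derived_runs_prefix) (auto simp: h_def step less_Suc_eq)
    have "{w \<in> derived ?Y l. agree {..Suc i} (h i) w} = {} \<longleftrightarrow> derived (runs step (v i)) l = {}"
    proof -
      have h: "h i 0 = s 0" "h i (Suc i) = v i" by (auto simp: h_def)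
      show ?thesis
        unfolding derived_cylinder[of "{..Suc i}" ?Y "h i" l, OF finite_atMost, symmetric]
          derived_img[unfolded h] image_is_empty ..
    qed
    then show ?thesis by blast
  qed
  have sY: "s \<in> ?Y" by (auto simp: runs_def step)
  have split: "\<exists>i. agree {..Suc i} (h i) w" if w: "w \<in> ?Y" "w \<noteq> s" for w
  proof -
    have "\<exists>j. w j \<noteq> s j" using w by auto
    then obtain j where j: "w j \<noteq> s j" "\<And>l. l < j \<Longrightarrow> w l = s l"
      using exists_least_iff[of "\<lambda>j. w j \<noteq> s j"] by auto
    then obtain i where i: "j = Suc i" using w by (cases j) (auto simp: runs_def)
    have "step (s i) (w j)" using w(1) j(2)[of i] i by (auto simp: runs_def) metis
    then have "w j = v i" using step j(1) i by auto
    then show ?thesis using j i by (intro exI[of _ i]) (auto simp: agree_def h_def le_Suc_eq)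
  qed
  have hs: "\<not> agree {..Suc i} (h i) s" for i
    using ne[of i] by (auto simp: agree_def h_def intro!: bexI[of _ "Suc i"])
  have top: "derived ?Y (Suc k) \<subseteq> {s}"
  proof
    fix w assume w: "w \<in> derived ?Y (Suc k)"
    show "w \<in> {s}"
    proof (rule ccontr)
      assume "w \<notin> {s}"
      then obtain i where "agree {..Suc i} (h i) w" using split w derived_subset by blast
      then show False using cyl[of "Suc k" i] w rank[of i] by blast
    qed
  qed
  have "isolated s {s}" by (auto simp: isolated_def)
  then show ?B using top
    by (metis (no_types, lifting) derived.simps(2) mem_Collect_eq subset_singletonD ex_in_conv singletonD)
  show ?A
  proof
    assume "derived ?Y (Suc k) \<noteq> {}"
    then have s: "s \<in> derived ?Y (Suc k)" using top by auto
    show "\<exists>\<^sub>\<infinity>i. derived (runs step (v i)) k \<noteq> {}"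
      unfolding INFM_nat
    proof
      fix m
      have "\<not> isolated s (derived ?Y k)" using s by simp
      then obtain w where w: "w \<in> derived ?Y k" "agree {..Suc m} s w" "w \<noteq> s"
        unfolding isolated_def by (metis finite_atMost)
      then obtain i where i: "agree {..Suc i} (h i) w" using split derived_subset by blast
      have "m < i"
      proof (rule ccontr)
        assume "\<not> m < i"
        then have "s (Suc i) = w (Suc i)" using w(2) by (auto simp: agree_def)
        moreover have "h i (Suc i) = w (Suc i)" using i unfolding agree_def by blast
        ultimately show False using ne[of i] by (simp add: h_def)
      qed
      then show "\<exists>n>m. derived (runs step (v n)) k \<noteq> {}" using cyl i w(1) by blast
    qed
  next
    assume inf: "\<exists>\<^sub>\<infinity>i. derived (runs step (v i)) k \<noteq> {}"
    \<comment> \<open>The spine has to be carried through all lower derivatives as well; a branch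
      that is non-empty at stage \<open>k\<close> is so at every stage
      \<open>j \<le> k\<close>.\<close>
    have "s \<in> derived ?Y j" if "j \<le> Suc k" for j
      using that
    proof (induction j)
      case (Suc j)
      have "\<not> isolated s (derived ?Y j)"
        unfolding isolated_def
      proof safe
        fix D assume D: "finite D" "\<forall>y\<in>derived ?Y j. agree D s y \<longrightarrow> y = s"
        obtain m where m: "\<forall>p\<in>D. p < m" using D(1) finite_nat_set_iff_bounded by blast
        obtain i where i: "i > m" "derived (runs step (v i)) k \<noteq> {}" using inf unfolding INFM_nat by blast
        then obtain w where w: "w \<in> derived ?Y k" "agree {..Suc i} (h i) w" using cyl by blast
        then have "w \<in> derived ?Y j" using derived_antimono[of j k] Suc by auto
        moreover have "agree D s w"
          unfolding agree_def
        proof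
          fix p assume "p \<in> D"
          then have "p \<le> i" using m i(1) by fastforce
          then show "s p = w p" using w(2) unfolding agree_def h_def by (metis atMost_iff le_SucI)
        qed
        ultimately show False using D(2) w(2) hs by blast
      qed
      then show ?case using Suc by auto
    qed (simp add: sY)
    then show "derived ?Y (Suc k) \<noteq> {}" by blast
  qed
qed

section \<open>The subshift of a growing machine\<close>

text \<open>A rule \<open>Rule s d r c f s'\<close> acts on pairs of a control state and a natural number: it sends
  \<open>(s, d q + r)\<close> to \<open>(s', c q + f)\<close> for \<open>q \<ge> 1\<close>. One application is drawn as a phase of \<open>q\<close> rows.
  In each row \<open>L\<close> fills the half-line left of a wall and \<open>R\<close> the unused half-line on the right;
  between them stand cells \<open>C r p a b\<close> that carry the current rule, and \<open>a\<close>, \<open>b\<close> tell whether the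
  cell lies to the left of a marker \<open>A\<close> and of a marker \<open>B\<close>. From row to row \<open>A\<close> moves \<open>d\<close> cells to
  the left and \<open>B\<close> moves \<open>c\<close> cells to the right. When \<open>A\<close> is at distance \<open>d + r\<close> from the wall, the
  next phase begins with \<open>A\<close> at \<open>B + c + f\<close> and \<open>B\<close> at the wall. \<open>First r\<close> marks the first row of a
  phase that follows a phase of rule \<open>r\<close>, and \<open>Init\<close> the first row of all.\<close>

datatype 's rule = Rule (src: 's) (dv: nat) (rm: nat) (ml: nat) (ad: nat) (tgt: 's)
datatype 's phase = Init | Cont | First "'s rule"
datatype 's sym = L | R | C "'s rule" "'s phase" bool bool

fun left_A :: "'s sym \<Rightarrow> bool" where
  "left_A L = True" | "left_A R = False" | "left_A (C _ _ a _) = a"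

fun left_B :: "'s sym \<Rightarrow> bool" where
  "left_B L = True" | "left_B R = False" | "left_B (C _ _ _ b) = b"

lemma int_downward:
  fixes i j :: int
  assumes "\<And>i. P i \<Longrightarrow> P (i - 1)" "P i" "j \<le> i"
  shows "P j"
  using assms(3,2)
  by (induction j rule: int_le_induct) (use assms(1) in auto)

lemma int_upward:
  fixes i j :: int
  assumes "\<And>i. P i \<Longrightarrow> P (i + 1)" "P i" "i \<le> j"
  shows "P j"
  using assms(3,2)
  by (induction j rule: int_ge_induct) (use assms(1) in auto)

lemma int_cut_cases:
  fixes S :: "int set"
  assumes down: "\<And>i. i \<in> S \<Longrightarrow> i - 1 \<in> S"
  obtains "S = {}" | "S = UNIV" | w where "S = {..<w}"
proof -
  have dn: "j \<in> S" if "i \<in> S" "j \<le> i" for i j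
    using int_downward[of "\<lambda>i. i \<in> S", OF down that] .
  show ?thesis
  proof (cases "S = {} \<or> S = UNIV")
    case False
    then obtain i j where ij: "i \<in> S" "j \<notin> S" by auto
    then have "j > i" using dn[OF ij(1), of j] by force
    then have "\<exists>n::nat. i + int n \<notin> S" using ij by (intro exI[of _ "nat (j - i)"]) auto
    define n where "n = (LEAST n::nat. i + int n \<notin> S)"
    have n: "i + int n \<notin> S" unfolding n_def by (rule LeastI_ex) fact
    have less: "i + int k \<in> S" if "k < n" for k using not_less_Least that n_def by blast
    have n0: "n \<noteq> 0" using n ij by (metis add_0_right of_nat_0)
    have "S = {..<i + int n}"
    proof safe
      fix x assume "x \<in> S"
      then show "x < i + int n" using dn n by (meson not_le)
    next
      fix x assume "x < i + int n"
      then have "x \<le> i + int (n - 1)" using n0 by linarith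
      then show "x \<in> S" using dn[OF less[of "n - 1"]] n0 by auto
    qed
    then show ?thesis using that by blast
  qed (use that in auto)
qed

text \<open>The assumptions \<open>grow\<close> and \<open>grow'\<close> make the number increase strictly with every phase, so
  that a configuration in which infinitely many phases are visible has a first one.\<close>

locale growing_machine =
  fixes Rules :: "'s rule set" and r0 :: "'s rule"
  assumes fin: "finite Rules"
    and dv_pos: "\<And>r. r \<in> Rules \<Longrightarrow> 0 < dv r"
    and grow: "\<And>r. r \<in> Rules \<Longrightarrow> dv r < ml r"
    and grow': "\<And>r. r \<in> Rules \<Longrightarrow> rm r \<le> ad r"
    and r0: "r0 \<in> Rules"
    and start: "\<And>r. r \<in> Rules \<Longrightarrow> src r = src r0 \<Longrightarrow> r = r0"
    and uniq: "\<And>r r' q q'. r \<in> Rules \<Longrightarrow> r' \<in> Rules \<Longrightarrow> src r = src r' \<Longrightarrow> tgt r = tgt r' \<Longrightarrow>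
       1 \<le> q \<Longrightarrow> 1 \<le> q' \<Longrightarrow> dv r * q + rm r = dv r' * q' + rm r' \<Longrightarrow>
       ml r * q + ad r = ml r' * q' + ad r' \<Longrightarrow> r = r'"
begin

definition mstep :: "'s \<times> nat \<Rightarrow> 's \<times> nat \<Rightarrow> bool" where
  "mstep c c' \<longleftrightarrow> (\<exists>r\<in>Rules. \<exists>q\<ge>1. src r = fst c \<and> tgt r = fst c' \<and>
     snd c = dv r * q + rm r \<and> snd c' = ml r * q + ad r)"

text \<open>The condition for \<open>p \<noteq> Cont\<close> expresses that in the first row of a
  phase \<open>B\<close> stands at the wall, so that the cells of the strip are left of
  \<open>A\<close> only. \<open>First r'\<close> can only be handed to a rule that starts in the
  target state of \<open>r'\<close>.\<close>

fun valid :: "'s sym \<Rightarrow> bool" where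
  "valid L = True"
| "valid R = True"
| "valid (C r p a b) = (r \<in> Rules \<and> (a \<or> b) \<and> (p \<noteq> Cont \<longrightarrow> a \<and> \<not> b) \<and> (p = Init \<longrightarrow> r = r0) \<and>
     (\<forall>r'. p = First r' \<longrightarrow> r' \<in> Rules \<and> tgt r' = src r))"

text \<open>The last clause keeps \<open>A\<close> at distance at least \<open>dv r + rm r\<close>
  from a visible wall. If the remainder of the number does not fit the rule, \<open>A\<close> jumps
  over this threshold, and the point is excluded.\<close>

definition hor_ok :: "(int \<Rightarrow> 's sym) \<Rightarrow> int \<Rightarrow> bool" where
  "hor_ok x i \<longleftrightarrow> valid (x i) \<and> (x i = L \<longrightarrow> x (i - 1) = L) \<and> (x i = R \<longrightarrow> x (i + 1) = R) \<and>
     (\<forall>r p a b r' p' a' b'. x i = C r p a b \<longrightarrow> x (i + 1) = C r' p' a' b' \<longrightarrow>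
        r' = r \<and> p' = p \<and> (a' \<longrightarrow> a) \<and> (b' \<longrightarrow> b)) \<and>
     (\<forall>r p a b. x i = C r p a b \<longrightarrow> x (i - 1) = L \<longrightarrow> left_A (x (i + int (dv r) + int (rm r) - 1)))"

definition ver_ok :: "(int \<Rightarrow> 's sym) \<Rightarrow> (int \<Rightarrow> 's sym) \<Rightarrow> int \<Rightarrow> bool" where
  "ver_ok x x' i \<longleftrightarrow> (x i = L \<longleftrightarrow> x' i = L) \<and>
     (\<forall>r p a b. x i = C r p a b \<longrightarrow>
        (a \<and> x (i - int (dv r) - int (rm r)) \<noteq> L \<longrightarrow> (\<exists>b'. x' (i - int (dv r)) = C r Cont True b')) \<and>
        (x (i - 1) = L \<and> \<not> left_A (x (i + int (dv r) + int (rm r))) \<longrightarrow>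
           (\<exists>r'. x' i = C r' (First r) True False)) \<and>
        (x' i = R \<and> \<not> b \<or> (\<exists>a' b'. x' i = C r Cont a' b') \<or> (\<exists>r'. x' i = C r' (First r) True False))) \<and>
     (\<forall>r a b. x' i = C r Cont a b \<longrightarrow> (\<forall>k\<in>{i, i + 1}. left_A (x' k) = left_A (x (k + int (dv r))) \<and>
        left_B (x' k) = left_B (x (k - int (ml r))))) \<and>
     (\<forall>r r' a b. x' i = C r (First r') a b \<longrightarrow>
        (\<forall>k\<in>{i, i + 1}. left_A (x' k) = left_B (x (k - int (ml r') - int (ad r'))))) \<and>
     (x i = R \<and> x (i - 1) = L \<longrightarrow> x' i = R \<or> x' i = C r0 Init True False) \<and>
     (\<forall>r a b. x' i = C r Init a b \<longrightarrow> x i = R)"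

definition row :: "(int \<times> int \<Rightarrow> 's sym) \<Rightarrow> int \<Rightarrow> int \<Rightarrow> 's sym" where
  "row y t = (\<lambda>i. y (i, t))"

definition Y :: "(int \<times> int \<Rightarrow> 's sym) set" where
  "Y = {y. \<forall>i t. hor_ok (row y t) i \<and> ver_ok (row y t) (row y (t + 1)) i}"

text \<open>The sets of cells left of the wall and left of the two markers. These cuts may be empty or all
  of the integers, in limit configurations where the wall or a marker is not visible.\<close>

definition wall where "wall y = {i. row y 0 i = L}"
definition As where "As y t = {i. left_A (row y t i)}"
definition Bs where "Bs y t = {i. left_B (row y t i)}"
definition row_label where "row_label y t r p \<longleftrightarrow> (\<exists>i a b. row y t i = C r p a b)"

section \<open>Geometry of a single configuration\<close>

context
  fixes y assumes y: "y \<in> Y"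
begin

lemma hor_ok: "hor_ok (row y t) i" and ver_ok: "ver_ok (row y t) (row y (t + 1)) i"
  using y by (auto simp: Y_def)

lemma row_L: "row y t i = L \<longleftrightarrow> i \<in> wall y"
proof -
  have e: "row y t i = L \<longleftrightarrow> row y (t + 1) i = L" for t using ver_ok[of t i] by (simp add: ver_ok_def)
  have "0 \<le> t \<Longrightarrow> row y t i = L \<longleftrightarrow> i \<in> wall y" for t
    by (induction t rule: int_ge_induct) (use e in \<open>auto simp: wall_def\<close>)
  moreover have "t \<le> 0 \<Longrightarrow> row y t i = L \<longleftrightarrow> i \<in> wall y"
    by (induction t rule: int_le_induct) (use e[of "_ - 1"] in \<open>auto simp: wall_def\<close>)
  ultimately show ?thesis by (cases "0 \<le> t") auto
qed

lemma Wd_down: "i \<in> wall y \<Longrightarrow> j \<le> i \<Longrightarrow> j \<in> wall y"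
  using int_downward[of "\<lambda>i. i \<in> wall y" i j] hor_ok[of 0] by (auto simp: wall_def hor_ok_def)

lemma As_down: "i \<in> As y t \<Longrightarrow> j \<le> i \<Longrightarrow> j \<in> As y t"
proof (rule int_downward[of "\<lambda>i. i \<in> As y t"])
  fix i assume "i \<in> As y t"
  then show "i - 1 \<in> As y t" using hor_ok[of t "i - 1"] hor_ok[of t i]
    by (cases "row y t i"; cases "row y t (i - 1)") (auto simp: As_def hor_ok_def)
qed

lemma Bs_down: "i \<in> Bs y t \<Longrightarrow> j \<le> i \<Longrightarrow> j \<in> Bs y t"
proof (rule int_downward[of "\<lambda>i. i \<in> Bs y t"])
  fix i assume "i \<in> Bs y t"
  then show "i - 1 \<in> Bs y t" using hor_ok[of t "i - 1"] hor_ok[of t i]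
    by (cases "row y t i"; cases "row y t (i - 1)") (auto simp: Bs_def hor_ok_def)
qed

lemma R_up: "row y t i = R \<Longrightarrow> i \<le> j \<Longrightarrow> row y t j = R"
  by (rule int_upward[of "\<lambda>i. row y t i = R"]) (use hor_ok in \<open>auto simp: hor_ok_def\<close>)

lemma Wd_sub: "wall y \<subseteq> As y t" "wall y \<subseteq> Bs y t"
  by (auto simp: As_def Bs_def row_L[symmetric, of _ t])

lemma C_right:
  assumes "row y t i = C r p a b" "i \<le> k"
  shows "row y t k = R \<or> (\<exists>a b. row y t k = C r p a b)"
  using assms(2)
proof (induction k rule: int_ge_induct)
  case (step k)
  then show ?case using hor_ok[of t k] hor_ok[of t "k + 1"]
    by (cases "row y t (k + 1)") (auto simp: hor_ok_def)
qed (use assms in auto)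

lemma lab_unique:
  assumes "row_label y t r p" "row_label y t r' p'"
  shows "r' = r \<and> p' = p"
proof -
  obtain i a b j a' b' where *: "row y t i = C r p a b" "row y t j = C r' p' a' b'"
    using assms row_label_def by metis
  show ?thesis using C_right[OF *(1), of j] C_right[OF *(2), of i] * by (cases "i \<le> j") auto
qed

lemma lab_valid:
  assumes "row_label y t r p"
  shows "r \<in> Rules" "p = Init \<Longrightarrow> r = r0" "p = First r' \<Longrightarrow> r' \<in> Rules \<and> tgt r' = src r"
proof -
  obtain i a b where "row y t i = C r p a b" using assms row_label_def by metis
  then have "valid (C r p a b)" using hor_ok[of t i] unfolding hor_ok_def by metis
  then show "r \<in> Rules" "p = Init \<Longrightarrow> r = r0" "p = First r' \<Longrightarrow> r' \<in> Rules \<and> tgt r' = src r" by auto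
qed

text \<open>The description by which rows are later counted, compared and moved in time: one label
  and three cuts carry the whole row.\<close>

lemma row_active:
  assumes "row_label y t r p"
  shows "row y t i = (if i \<in> wall y then L else if i \<in> As y t \<or> i \<in> Bs y t
     then C r p (i \<in> As y t) (i \<in> Bs y t) else R)"
proof (cases "row y t i")
  case (C r' p' a b)
  then have "r' = r" "p' = p" using lab_unique[OF assms, of r' p'] row_label_def by metis+
  moreover have "valid (C r' p' a b)" using hor_ok[of t i] C unfolding hor_ok_def by metis
  ultimately show ?thesis using C row_L[of t i] by (auto simp: As_def Bs_def)
qed (use row_L[of t i] in \<open>auto simp: As_def Bs_def\<close>)

lemma row_inactive:
  assumes "\<And>r p. \<not> row_label y t r p"
  shows "row y t i = (if i \<in> wall y then L else R)"
  using assms row_L[of t i] by (cases "row y t i") (auto simp: row_label_def)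

lemma event_Bs:
  assumes "row_label y t r p" "p \<noteq> Cont"
  shows "Bs y t = wall y"
proof
  show "Bs y t \<subseteq> wall y"
  proof
    fix i assume i: "i \<in> Bs y t"
    have "valid (row y t i)" using hor_ok[of t i] unfolding hor_ok_def by metis
    then show "i \<in> wall y" using row_active[OF assms(1), of i] assms i by (auto split: if_splits)
  qed
qed (rule Wd_sub)

text \<open>The wall cannot fill an active row, and the cell next to a visible wall belongs to the
  strip, since an \<open>R\<close> there would spread over everything to its right.\<close>

lemma Wd_cases:
  assumes "row_label y t r p"
  obtains "wall y = {}" | w where "wall y = {..<w}" "row y t w = C r p (w \<in> As y t) (w \<in> Bs y t)"
proof -
  obtain i a b where i: "row y t i = C r p a b" using assms row_label_def by metis
  then have iW: "i \<notin> wall y" using row_L[of t i] by auto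
  have dn: "i - 1 \<in> wall y" if "i \<in> wall y" for i using Wd_down that by force
  show ?thesis
  proof (rule int_cut_cases[OF dn])
    fix w assume w: "wall y = {..<w}"
    then have "w \<le> i" "w \<notin> wall y" using iW by auto
    moreover have "row y t w \<noteq> R" using R_up[of t w i] i \<open>w \<le> i\<close> by auto
    ultimately have "row y t w = C r p (w \<in> As y t) (w \<in> Bs y t)"
      using row_active[OF assms, of w] by (auto split: if_splits)
    then show ?thesis using that w by blast
  qed (use that iW in auto)
qed

lemma As_wall:
  assumes "row_label y t r p" "wall y = {..<w}"
  shows "w + int (dv r) + int (rm r) - 1 \<in> As y t"
proof -
  obtain w' where "wall y = {..<w'}" and w': "row y t w' = C r p (w' \<in> As y t) (w' \<in> Bs y t)"
    using Wd_cases[OF assms(1)] assms(2) by (metis lessThan_iff empty_iff lt_ex)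
  then have "w' = w" using assms(2) by (metis lessThan_eq_iff)
  moreover have "row y t (w - 1) = L" using row_L[of t "w - 1"] assms(2) by auto
  ultimately show ?thesis using w' hor_ok[of t w] unfolding hor_ok_def As_def by blast
qed

lemma lab_Cont_if:
  assumes "row y t i = C r p True b" "i - int (dv r) - int (rm r) \<notin> wall y"
  shows "row_label y (t + 1) r Cont"
  using ver_ok[of t i] assms row_L[of t] unfolding ver_ok_def row_label_def by metis

lemma lab_First_if:
  assumes "row_label y t r p" "wall y = {..<w}" "w + int (dv r) + int (rm r) \<notin> As y t"
  shows "\<exists>r'. row_label y (t + 1) r' (First r)"
proof -
  obtain w' where "wall y = {..<w'}" and w': "row y t w' = C r p (w' \<in> As y t) (w' \<in> Bs y t)"
    using Wd_cases[OF assms(1)] assms(2) by (metis lessThan_iff empty_iff lt_ex)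
  then have "w' = w" using assms(2) by (metis lessThan_eq_iff)
  moreover have "row y t (w - 1) = L" using row_L[of t "w - 1"] assms(2) by auto
  ultimately show ?thesis using w' ver_ok[of t w] assms(3) unfolding ver_ok_def As_def row_label_def
    by (metis mem_Collect_eq)
qed

text \<open>With a visible wall the position of \<open>A\<close> decides. Without one, a cell left
  of \<open>A\<close> is infinitely far from the wall and forces a continuation, and a cell left of
  \<open>B\<close> may not turn into \<open>R\<close>.\<close>

lemma next_row:
  assumes l: "row_label y t r p"
  shows "row_label y (t + 1) r Cont \<or> (\<exists>r'. row_label y (t + 1) r' (First r))"
proof (rule Wd_cases[OF l])
  fix w assume w: "wall y = {..<w}"
  show ?thesis
  proof (cases "w + int (dv r) + int (rm r) \<in> As y t")
    case True
    have "row y t (w + int (dv r) + int (rm r)) = C r p True (w + int (dv r) + int (rm r) \<in> Bs y t)"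
      using row_active[OF l, of "w + int (dv r) + int (rm r)"] w True by auto
    then show ?thesis using lab_Cont_if w by force
  next
    case False
    then show ?thesis using lab_First_if[OF l w] by blast
  qed
next
  assume W: "wall y = {}"
  obtain i a b where i: "row y t i = C r p a b" using l row_label_def by metis
  have "valid (C r p a b)" using hor_ok[of t i] i unfolding hor_ok_def by metis
  then have "a \<or> b" by simp
  then show ?thesis
  proof
    assume a then show ?thesis using lab_Cont_if[of t i r p b] i W by auto
  next
    assume b
    then show ?thesis using ver_ok[of t i] i unfolding ver_ok_def row_label_def by metis
  qed
qed

text \<open>In a point without wall an inactive row consists of \<open>R\<close> only, so the cuts
  transported from it would leave no cell to carry a label. Beside a visible wall an
  \<open>R\<close> can only be followed by \<open>R\<close> or \<open>Init\<close>.\<close>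

lemma prev_active:
  assumes "row_label y (t + 1) r p" "p \<noteq> Init"
  obtains r' p' where "row_label y t r' p'"
proof (rule ccontr)
  assume "\<not> thesis"
  then have e: "row y t i = (if i \<in> wall y then L else R)" for i
    using that row_inactive by blast
  show False
  proof (rule Wd_cases[OF assms(1)])
    fix w assume w: "wall y = {..<w}" "row y (t+1) w = C r p (w \<in> As y (t + 1)) (w \<in> Bs y (t + 1))"
    have "row y t w = R" "row y t (w - 1) = L" using e w by auto
    then show False using ver_ok[of t w] w(2) assms(2) unfolding ver_ok_def by force
  next
    assume W: "wall y = {}"
    then have n: "\<not> left_A (row y t i)" "\<not> left_B (row y t i)" for i using e by auto
    obtain i a b where i: "row y (t + 1) i = C r p a b" using assms row_label_def by metis
    have v: "valid (C r p a b)" using hor_ok[of "t + 1" i] i unfolding hor_ok_def by metis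
    show False
    proof (cases p)
      case Init then show ?thesis using assms by simp
    next
      case Cont
      then have "\<not> left_A (row y (t + 1) i)" "\<not> left_B (row y (t + 1) i)"
        using ver_ok[of t i] i n unfolding ver_ok_def by (metis insertI1)+
      then show ?thesis using i v by auto
    next
      case (First r')
      then have "\<not> left_A (row y (t + 1) i)"
        using ver_ok[of t i] i n unfolding ver_ok_def by (metis insertI1)
      then show ?thesis using i v First by auto
    qed
  qed
qed

lemma Cont_prev:
  assumes "row_label y (t + 1) r Cont"
  obtains p where "row_label y t r p"
proof -
  obtain r' p where "row_label y t r' p" using prev_active[OF assms] by auto
  then show ?thesis using next_row[of t r' p] lab_unique[OF assms] that by blast
qed

lemma First_prev:
  assumes "row_label y (t + 1) r (First r')"
  obtains p where "row_label y t r' p"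
proof -
  obtain r'' p where "row_label y t r'' p" using prev_active[OF assms] by auto
  then show ?thesis using next_row[of t r'' p] lab_unique[OF assms] that by blast
qed

lemma Init_prev:
  assumes "row_label y (t + 1) r Init"
  shows "\<not> row_label y t r' p"
  using next_row[of t r' p] lab_unique[OF assms] by blast

text \<open>The local rules say something only near cells of the strip. To the right the equality
  spreads because \<open>f\<close> is false on \<open>R\<close> and \<open>g\<close> can only drop;
  to the left of a strip cell there are only strip and wall cells.\<close>

lemma row_spread:
  assumes l: "row_label y (t + 1) r p"
    and loc: "\<And>i a b k. row y (t + 1) i = C r p a b \<Longrightarrow> k \<in> {i, i + 1} \<Longrightarrow> f (row y (t + 1) k) = g k"
    and wall: "\<And>k. k \<in> wall y \<Longrightarrow> f L = g k"
    and f: "\<not> f R" and g: "\<And>k. g (k + 1) \<Longrightarrow> g k"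
  shows "f (row y (t + 1) k) = g k"
proof -
  obtain j a b where j: "row y (t + 1) j = C r p a b" using l row_label_def by metis
  show ?thesis
  proof (cases "j \<le> k")
    case True
    then show ?thesis
    proof (induction k rule: int_ge_induct)
      case base then show ?case using loc[OF j] by auto
    next
      case (step k)
      from C_right[OF j step(1)] show ?case
      proof
        assume R: "row y (t + 1) k = R"
        then have "row y (t + 1) (k + 1) = R" using R_up by force
        then show ?thesis using step R f g[of k] by auto
      qed (use loc in blast)
    qed
  next
    case False
    show ?thesis
    proof (cases "row y (t + 1) k")
      case L then show ?thesis using wall[of k] row_L[of "t + 1" k] by simp
    next
      case R then show ?thesis using R_up[of "t + 1" k j] False j by auto
    next
      case (C r' p' a' b')
      then have "row_label y (t + 1) r' p'" unfolding row_label_def by blast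
      then have "r' = r" "p' = p" using lab_unique[OF l] by blast+
      then have "row y (t + 1) k = C r p a' b'" using C by simp
      from loc[OF this, of k] show ?thesis by simp
    qed
  qed
qed

lemma Cont_cuts:
  assumes l: "row_label y (t + 1) r Cont"
  shows "k \<in> As y (t + 1) \<longleftrightarrow> k + int (dv r) \<in> As y t"
    and "k \<in> Bs y (t + 1) \<longleftrightarrow> k - int (ml r) \<in> Bs y t"
proof -
  obtain p where p: "row_label y t r p" using Cont_prev[OF l] .
  have "left_A (row y (t + 1) k) = (k + int (dv r) \<in> As y t)"
  proof (rule row_spread[where f = left_A and g = "\<lambda>k. k + int (dv r) \<in> As y t", OF l])
    fix i a b k assume "row y (t + 1) i = C r Cont a b" "k \<in> {i, i + 1}"
    then show "left_A (row y (t + 1) k) = (k + int (dv r) \<in> As y t)"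
      using ver_ok[of t i] unfolding ver_ok_def As_def by blast
  next
    \<comment> \<open>The left edge matters here: \<open>As_wall\<close> keeps \<open>A\<close> far
      enough to the right that the shift by \<open>dv r\<close> does not uncover wall cells.\<close>
    fix k assume k: "k \<in> wall y"
    then obtain w where w: "wall y = {..<w}" using Wd_cases[OF l] by blast
    have "k + int (dv r) \<in> As y t" using As_down[OF As_wall[OF p w]] k w by auto
    then show "left_A L = (k + int (dv r) \<in> As y t)" by simp
  next
    fix k assume "k + 1 + int (dv r) \<in> As y t"
    then show "k + int (dv r) \<in> As y t" using As_down by force
  qed auto
  then show "k \<in> As y (t + 1) \<longleftrightarrow> k + int (dv r) \<in> As y t" by (simp add: As_def)
  have "left_B (row y (t + 1) k) = (k - int (ml r) \<in> Bs y t)"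
  proof (rule row_spread[where f = left_B and g = "\<lambda>k. k - int (ml r) \<in> Bs y t", OF l])
    fix i a b k assume "row y (t + 1) i = C r Cont a b" "k \<in> {i, i + 1}"
    then show "left_B (row y (t + 1) k) = (k - int (ml r) \<in> Bs y t)"
      using ver_ok[of t i] unfolding ver_ok_def Bs_def by blast
  next
    fix k assume "k \<in> wall y"
    then show "left_B L = (k - int (ml r) \<in> Bs y t)" using Wd_sub(2)[of t] Wd_down by auto
  next
    fix k assume "k + 1 - int (ml r) \<in> Bs y t"
    then show "k - int (ml r) \<in> Bs y t" using Bs_down by force
  qed auto
  then show "k \<in> Bs y (t + 1) \<longleftrightarrow> k - int (ml r) \<in> Bs y t" by (simp add: Bs_def)
qed

text \<open>Had \<open>A\<close> stood further right, the cell just left of it would have forced the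
  phase to continue, and \<open>As_wall\<close> excludes a position further left. If the wall is at
  minus infinity, so is \<open>A\<close> in the last row of the phase.\<close>

lemma First_cuts:
  assumes l: "row_label y (t + 1) r (First r')"
  shows "k \<in> As y (t + 1) \<longleftrightarrow> k - int (ml r') - int (ad r') \<in> Bs y t"
    and "k \<in> As y t \<longleftrightarrow> k - int (dv r') - int (rm r') \<in> wall y"
proof -
  obtain p where p: "row_label y t r' p" using First_prev[OF l] .
  have "left_A (row y (t + 1) k) = (k - int (ml r') - int (ad r') \<in> Bs y t)"
  proof (rule row_spread[where f = left_A and g = "\<lambda>k. k - int (ml r') - int (ad r') \<in> Bs y t", OF l])
    fix i a b k assume "row y (t + 1) i = C r (First r') a b" "k \<in> {i, i + 1}"
    then show "left_A (row y (t + 1) k) = (k - int (ml r') - int (ad r') \<in> Bs y t)"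
      using ver_ok[of t i] unfolding ver_ok_def Bs_def by blast
  next
    fix k assume "k \<in> wall y"
    then show "left_A L = (k - int (ml r') - int (ad r') \<in> Bs y t)" using Wd_sub(2)[of t] Wd_down by auto
  next
    fix k assume "k + 1 - int (ml r') - int (ad r') \<in> Bs y t"
    then show "k - int (ml r') - int (ad r') \<in> Bs y t" using Bs_down by force
  qed auto
  then show "k \<in> As y (t + 1) \<longleftrightarrow> k - int (ml r') - int (ad r') \<in> Bs y t" by (simp add: As_def)
  show "k \<in> As y t \<longleftrightarrow> k - int (dv r') - int (rm r') \<in> wall y"
  proof
    assume k: "k \<in> As y t"
    show "k - int (dv r') - int (rm r') \<in> wall y"
    proof (rule ccontr)
      assume n: "k - int (dv r') - int (rm r') \<notin> wall y"
      then have "k \<notin> wall y" using Wd_down by force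
      then have "row y t k = C r' p True (k \<in> Bs y t)" using row_active[OF p, of k] k by auto
      then have "row_label y (t + 1) r' Cont" using lab_Cont_if n by blast
      then show False using lab_unique[OF l] by blast
    qed
  next
    assume k: "k - int (dv r') - int (rm r') \<in> wall y"
    then obtain w where w: "wall y = {..<w}" using Wd_cases[OF l] by blast
    show "k \<in> As y t" using As_down[OF As_wall[OF p w]] k w by auto
  qed
qed

lemma step_cases:
  assumes l: "row_label y t r p" and W: "wall y = {..<w}" and A: "As y t = {..<A}" and B: "Bs y t = {..<B}"
  shows "(A = w + int (dv r) + int (rm r) \<and> (\<exists>r'. row_label y (t + 1) r' (First r)) \<and>
       As y (t + 1) = {..<B + int (ml r) + int (ad r)} \<and> Bs y (t + 1) = {..<w}) \<or>
     (w + int (dv r) + int (rm r) < A \<and> row_label y (t + 1) r Cont \<and>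
       As y (t + 1) = {..<A - int (dv r)} \<and> Bs y (t + 1) = {..<B + int (ml r)})"
  using next_row[OF l]
proof
  assume c: "row_label y (t + 1) r Cont"
  have "w + int (dv r) + int (rm r) < A"
  proof (rule ccontr)
    assume "\<not> w + int (dv r) + int (rm r) < A"
    then show False using lab_First_if[OF l W] A lab_unique[OF c] by force
  qed
  then show ?thesis using c Cont_cuts[OF c] A B by auto
next
  assume "\<exists>r'. row_label y (t + 1) r' (First r)"
  then obtain r' where c: "row_label y (t + 1) r' (First r)" by blast
  have "A = w + int (dv r) + int (rm r)"
    using First_cuts(2)[OF c, of A] First_cuts(2)[OF c, of "A - 1"] unfolding A W by simp
  moreover have "Bs y (t + 1) = {..<w}" using event_Bs[OF c] W by auto
  ultimately show ?thesis using c First_cuts(1)[OF c] B by auto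
qed

text \<open>Induction on the distance \<open>a\<close> of \<open>A\<close> from the wall, which
  drops by \<open>dv r\<close> per row. For \<open>b = 0\<close> one phase computes
  \<open>dv r * q + rm r \<mapsto> ml r * q + ad r\<close> in \<open>q\<close> rows; the general
  \<open>b\<close> is for the induction, which starts anew in the middle of a phase.\<close>

lemma phase:
  assumes l: "row_label y t r p" and W: "wall y = {..<w}" and A: "As y t = {..<w + int a}" and B: "Bs y t = {..<w + int b}"
  shows "\<exists>q\<ge>1. a = dv r * q + rm r \<and>
     (\<forall>k<q. As y (t + int k) = {..<w + int a - int (dv r) * int k} \<and> Bs y (t + int k) = {..<w + int b + int (ml r) * int k} \<and>
        (0 < k \<longrightarrow> row_label y (t + int k) r Cont)) \<and>
     (\<exists>r'. row_label y (t + int q) r' (First r)) \<and>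
     As y (t + int q) = {..<w + int b + int (ml r) * int q + int (ad r)} \<and> Bs y (t + int q) = {..<w}"
  using l A B
proof (induction a arbitrary: t p b rule: less_induct)
  case (less a)
  have dp: "0 < dv r" using dv_pos lab_valid(1)[OF less.prems(1)] .
  from step_cases[OF less.prems(1) W less.prems(2,3)] show ?case
  proof (elim disjE conjE)
    assume h: "w + int a = w + int (dv r) + int (rm r)" "\<exists>r'. row_label y (t + 1) r' (First r)"
      "As y (t + 1) = {..<w + int b + int (ml r) + int (ad r)}" "Bs y (t + 1) = {..<w}"
    show ?thesis by (rule exI[of _ 1]) (use h less.prems in auto)
  next
    assume h: "w + int (dv r) + int (rm r) < w + int a" "row_label y (t + 1) r Cont"
      "As y (t + 1) = {..<w + int a - int (dv r)}" "Bs y (t + 1) = {..<w + int b + int (ml r)}"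
    have "\<exists>q\<ge>1. a - dv r = dv r * q + rm r \<and>
     (\<forall>k<q. As y (t + 1 + int k) = {..<w + int (a - dv r) - int (dv r) * int k} \<and>
        Bs y (t + 1 + int k) = {..<w + int (b + ml r) + int (ml r) * int k} \<and>
        (0 < k \<longrightarrow> row_label y (t + 1 + int k) r Cont)) \<and>
     (\<exists>r'. row_label y (t + 1 + int q) r' (First r)) \<and>
     As y (t + 1 + int q) = {..<w + int (b + ml r) + int (ml r) * int q + int (ad r)} \<and> Bs y (t + 1 + int q) = {..<w}"
      by (rule less.IH) (use h dp in \<open>auto simp: of_nat_diff\<close>)
    then obtain q where q: "q \<ge> 1" "a - dv r = dv r * q + rm r"
     "\<forall>k<q. As y (t + 1 + int k) = {..<w + int (a - dv r) - int (dv r) * int k} \<and>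
        Bs y (t + 1 + int k) = {..<w + int (b + ml r) + int (ml r) * int k} \<and>
        (0 < k \<longrightarrow> row_label y (t + 1 + int k) r Cont)"
     "\<exists>r'. row_label y (t + 1 + int q) r' (First r)"
     "As y (t + 1 + int q) = {..<w + int (b + ml r) + int (ml r) * int q + int (ad r)}"
     "Bs y (t + 1 + int q) = {..<w}" by blast
    have le: "dv r \<le> a" using h(1) by linarith
    have "\<forall>k<Suc q. As y (t + int k) = {..<w + int a - int (dv r) * int k} \<and>
        Bs y (t + int k) = {..<w + int b + int (ml r) * int k} \<and> (0 < k \<longrightarrow> row_label y (t + int k) r Cont)"
    proof (intro allI impI)
      fix k assume k: "k < Suc q"
      show "As y (t + int k) = {..<w + int a - int (dv r) * int k} \<and>
        Bs y (t + int k) = {..<w + int b + int (ml r) * int k} \<and> (0 < k \<longrightarrow> row_label y (t + int k) r Cont)"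
      proof (cases k)
        case 0 then show ?thesis using less.prems by simp
      next
        case (Suc k')
        then have "k' < q" using k by simp
        moreover have "t + int k = t + 1 + int k'" using Suc by simp
        ultimately show ?thesis using q(3) Suc h(2) le
          by (cases "k' = 0") (auto simp: algebra_simps of_nat_diff)
      qed
    qed
    moreover have "t + int (Suc q) = t + 1 + int q" by simp
    moreover have "a = dv r * Suc q + rm r" using q(2) le by simp
    ultimately show ?thesis using q by (intro exI[of _ "Suc q"]) (auto simp: algebra_simps)
  qed
qed

end

end

section \<open>Countability\<close>

context growing_machine
begin

definition events where "events y = {t. \<exists>r p. row_label y t r p \<and> p \<noteq> Cont}"

context
  fixes y assumes y: "y \<in> Y"
begin

lemma active_up:
  assumes "row_label y t r p" "t \<le> t'" shows "\<exists>r p. row_label y t' r p"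
  by (rule int_upward[of "\<lambda>t. \<exists>r p. row_label y t r p", OF _ _ assms(2)])
    (use assms(1) next_row[OF y] in blast)+

lemma Cont_chain:
  assumes l: "row_label y t r p" and c: "\<And>j. 0 < j \<Longrightarrow> j \<le> k \<Longrightarrow> t + int j \<notin> events y"
  shows "(0 < k \<longrightarrow> row_label y (t + int k) r Cont) \<and>
    (\<forall>i. i \<in> As y (t + int k) \<longleftrightarrow> i + int (dv r) * int k \<in> As y t) \<and>
    (\<forall>i. i \<in> Bs y (t + int k) \<longleftrightarrow> i - int (ml r) * int k \<in> Bs y t)"
  using c
proof (induction k)
  case (Suc k)
  have IH: "(0 < k \<longrightarrow> row_label y (t + int k) r Cont)"
    "\<And>i. i \<in> As y (t + int k) \<longleftrightarrow> i + int (dv r) * int k \<in> As y t"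
    "\<And>i. i \<in> Bs y (t + int k) \<longleftrightarrow> i - int (ml r) * int k \<in> Bs y t"
    using Suc by auto
  obtain p' where p': "row_label y (t + int k) r p'" using IH(1) l by (cases k) auto
  have e: "t + int (Suc k) = t + int k + 1" by simp
  have "row_label y (t + int k + 1) r Cont"
    using next_row[OF y p'] Suc.prems[of "Suc k"] unfolding e events_def by blast
  then show ?case using Cont_cuts[OF y, of "t + int k" r] IH(2,3) unfolding e
    by (auto simp: algebra_simps)
qed (use l in auto)

text \<open>The next change of phase ties \<open>A\<close> to the wall, and pulling this back
  through finitely many \<open>Cont\<close> rows ties them together in row \<open>t\<close>. Were
  the wall invisible, \<open>As y t\<close> would be empty along with \<open>Bs y t\<close>, and the
  row would have no strip.\<close>

lemma event_not_last:
  assumes t: "row_label y t r p" "p \<noteq> Cont" and t': "t' \<in> events y" "t < t'"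
  obtains w n where "wall y = {..<w}" "As y t = {..<w + int n}"
proof -
  have ex: "\<exists>m::nat. 0 < m \<and> t + int m \<in> events y"
    using t' by (intro exI[of _ "nat (t' - t)"]) auto
  define m where "m = (LEAST m::nat. 0 < m \<and> t + int m \<in> events y)"
  have m: "0 < m" "t + int m \<in> events y" using LeastI_ex[OF ex] m_def by auto
  have least: "t + int j \<notin> events y" if "0 < j" "j < m" for j
    using not_less_Least[of j] that m_def by blast
  have ch: "(0 < m - 1 \<longrightarrow> row_label y (t + int (m - 1)) r Cont) \<and>
    (\<forall>i. i \<in> As y (t + int (m - 1)) \<longleftrightarrow> i + int (dv r) * int (m - 1) \<in> As y t) \<and>
    (\<forall>i. i \<in> Bs y (t + int (m - 1)) \<longleftrightarrow> i - int (ml r) * int (m - 1) \<in> Bs y t)"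
    by (rule Cont_chain[OF t(1)]) (use least m in auto)
  have e: "t + int m = t + int (m - 1) + 1" using m by linarith
  obtain p' where p': "row_label y (t + int (m - 1)) r p'" using ch t(1) by (cases "0 < m - 1") auto
  have "\<not> row_label y (t + int (m - 1) + 1) r Cont" using m(2) lab_unique[OF y] unfolding events_def e by blast
  then obtain r' where "row_label y (t + int (m - 1) + 1) r' (First r)" using next_row[OF y p'] by blast
  note F = First_cuts(2)[OF y this]
  define s where "s = int (dv r) * int (m - 1) + int (dv r) + int (rm r)"
  have A: "i \<in> As y t \<longleftrightarrow> i - s \<in> wall y" for i
    using ch F[of "i - int (dv r) * int (m - 1)"] by (auto simp: s_def algebra_simps)
  show thesis
  proof (rule Wd_cases[OF y t(1)])
    assume W: "wall y = {}"
    obtain i a b where i: "row y t i = C r p a b" using t row_label_def by metis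
    then have "i \<in> As y t \<or> i \<in> Bs y t" using row_active[OF y t(1), of i] by (auto split: if_splits)
    then show thesis using W A event_Bs[OF y t] by auto
  next
    fix w assume w: "wall y = {..<w}"
    have "s \<ge> 0" by (simp add: s_def)
    then have "As y t = {..<w + int (nat s)}" using A w by (auto simp: algebra_simps)
    then show thesis using that w by blast
  qed
qed

text \<open>A phase replaces \<open>dv r * q + rm r\<close> by \<open>ml r * q + ad r\<close>, which
  is larger by \<open>grow\<close> and \<open>grow'\<close>. No event lies strictly inside a phase,
  so the induction on \<open>t' - t\<close> can pass from the start of one phase to the start of the
  next.\<close>

lemma event_increasing:
  assumes "row_label y t r p" "p \<noteq> Cont" "wall y = {..<w}" "As y t = {..<w + int n}" "t' \<in> events y" "t < t'"
  shows "\<exists>n'. n < n' \<and> As y t' = {..<w + int n'}"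
  using assms
proof (induction "nat (t' - t)" arbitrary: t r p n rule: less_induct)
  case less
  have "Bs y t = {..<w + int 0}" using event_Bs[OF y less.prems(1,2)] less.prems(3) by simp
  from phase[OF y less.prems(1,3,4) this] obtain q r' where q: "1 \<le> q" "n = dv r * q + rm r"
    "\<forall>k<q. 0 < k \<longrightarrow> row_label y (t + int k) r Cont"
    and r': "row_label y (t + int q) r' (First r)" and A: "As y (t + int q) = {..<w + int (ml r * q + ad r)}"
    by (auto simp: algebra_simps)
  have r: "r \<in> Rules" using lab_valid(1)[OF y less.prems(1)] .
  have gr: "n < ml r * q + ad r"
    using grow[OF r] grow'[OF r] q by (auto intro!: add_less_le_mono)
  have le: "t + int q \<le> t'"
  proof (rule ccontr)
    assume "\<not> t + int q \<le> t'"
    then have "nat (t' - t) < q" "0 < nat (t' - t)" "t + int (nat (t' - t)) = t'" using less.prems(6) by auto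
    then have "row_label y t' r Cont" using q(3) by metis
    then show False using less.prems(5) lab_unique[OF y] unfolding events_def by blast
  qed
  show ?case
  proof (cases "t + int q = t'")
    case True then show ?thesis using gr A by auto
  next
    case False
    then have "\<exists>n'. ml r * q + ad r < n' \<and> As y t' = {..<w + int n'}"
      using le q(1) by (intro less.hyps[OF _ r' _ less.prems(3) A less.prems(5)]) auto
    then show ?thesis using gr by (meson less_trans)
  qed
qed

text \<open>A phase between two visible changes of phase has finite length, and the numbers
  increase, hence only finitely many phases precede a given one.\<close>

lemma infinite_events_seed:
  assumes inf: "infinite (events y)"
  obtains w e n where "wall y = {..<w}" "row_label y e r0 Init" "As y e = {..<w + int n}" "0 < n"
proof -
  \<comment> \<open>Two events are taken, so that every event up to \<open>t0\<close> has a later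
    one and therefore displays a finite number.\<close>
  obtain t0 t1 where t: "t0 \<in> events y" "t1 \<in> events y" "t0 < t1"
  proof -
    obtain a where "a \<in> events y" using inf by (metis finite.emptyI ex_in_conv)
    moreover obtain b where "b \<in> events y - {a}" using inf by (metis finite.emptyI ex_in_conv infinite_remove)
    ultimately show ?thesis using that by (cases "a < b") force+
  qed
  obtain r p where "row_label y t0 r p" "p \<noteq> Cont" using t events_def by auto
  then obtain w where w: "wall y = {..<w}" using event_not_last t by metis
  have fin: "\<exists>n. As y t = {..<w + int n}" if tt: "t \<in> events y" "t \<le> t0" for t
  proof -
    obtain r p where rp: "row_label y t r p" "p \<noteq> Cont" using tt events_def by auto
    obtain w' n where "wall y = {..<w'}" "As y t = {..<w' + int n}"
      using event_not_last[OF rp t(2)] tt t by (metis le_less_trans)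
    then show ?thesis using w by (metis lessThan_eq_iff)
  qed
  define N where "N t = (SOME n. As y t = {..<w + int n})" for t
  have N: "As y t = {..<w + int (N t)}" if "t \<in> events y" "t \<le> t0" for t
    unfolding N_def using fin[OF that] by (rule someI_ex)
  have mono: "N s < N t" if tt: "s \<in> events y" "t \<in> events y" "s < t" "t \<le> t0" for s t
  proof -
    obtain r p where rp: "row_label y s r p" "p \<noteq> Cont" using tt events_def by auto
    have "\<exists>n'. N s < n' \<and> As y t = {..<w + int n'}"
      by (rule event_increasing[OF rp w _ tt(2,3)]) (use N tt in auto)
    then show ?thesis using N[OF tt(2,4)] by auto
  qed
  have "inj_on N (events y \<inter> {..t0})"
    by (rule inj_onI) (metis IntD1 IntD2 atMost_iff less_irrefl linorder_neqE mono)
  moreover have "N ` (events y \<inter> {..t0}) \<subseteq> {..N t0}"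
    using mono t(1) by (fastforce simp: order_le_less)
  ultimately have F: "finite (events y \<inter> {..t0})" by (meson finite_atMost inj_on_finite)
  define e where "e = Min (events y \<inter> {..t0})"
  have e: "e \<in> events y" "e \<le> t0" using Min_in[OF F] t(1) unfolding e_def by blast+
  have min: "s \<notin> events y" if "s < e" for s
    using Min_le[OF F, of s] that e unfolding e_def[symmetric] by force
  obtain r p where rp: "row_label y e r p" "p \<noteq> Cont" using e events_def by auto
  \<comment> \<open>Otherwise the phase before \<open>e\<close> has no first row: all rows below
    \<open>e\<close> continue the phase of \<open>r'\<close>, and \<open>B\<close> recedes by
    \<open>ml r' \<ge> 1\<close> with each row downwards. \<open>N e\<close> rows below row
    \<open>e - 1\<close> it would have passed the wall, against \<open>Wd_sub\<close>.\<close>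
  have "p = Init"
  proof (cases p)
    case (First r')
    have le: "row_label y (e - 1 + 1) r (First r')" using rp First by simp
    obtain p' where p': "row_label y (e - 1) r' p'" using First_prev[OF y le] .
    have r': "r' \<in> Rules" using lab_valid(1)[OF y p'] .
    have B: "k \<in> Bs y (e - 1) \<longleftrightarrow> k < w + int (N e) - int (ml r') - int (ad r')" for k
    proof -
      have "k + int (ml r') + int (ad r') \<in> As y e \<longleftrightarrow> k \<in> Bs y (e - 1)"
        using First_cuts(1)[OF y le, of "k + int (ml r') + int (ad r')"] by simp
      then show ?thesis unfolding N[OF e] lessThan_iff by linarith
    qed
    have chain: "\<exists>p. row_label y (e - 1 - int k) r' p \<and>
      (\<forall>i. i \<in> Bs y (e - 1 - int k) \<longleftrightarrow> i < w + int (N e) - int (ml r') - int (ad r') - int (ml r') * int k)" for k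
    proof (induction k)
      case 0
      have "row_label y (e - 1 - int 0) r' p'" using p' by simp
      then show ?case using B by (intro exI[of _ p']) simp
    next
      case (Suc k)
      have ee: "e - 1 - int k = e - 1 - int (Suc k) + 1" by simp
      obtain p where p: "row_label y (e - 1 - int (Suc k) + 1) r' p" using Suc ee by metis
      have "p = Cont" using min[of "e - 1 - int k"] p unfolding events_def ee by auto
      then have c: "row_label y (e - 1 - int (Suc k) + 1) r' Cont" using p by simp
      obtain p'' where "row_label y (e - 1 - int (Suc k)) r' p''" using Cont_prev[OF y c] .
      moreover have "i \<in> Bs y (e - 1 - int (Suc k)) \<longleftrightarrow>
         i < w + int (N e) - int (ml r') - int (ad r') - int (ml r') * int (Suc k)" for i
      proof -
        have "i \<in> Bs y (e - 1 - int (Suc k)) \<longleftrightarrow> i + int (ml r') \<in> Bs y (e - 1 - int k)"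
          unfolding ee Cont_cuts(2)[OF y c] by (simp only: add_diff_cancel_right')
        then show ?thesis using Suc by (auto simp: algebra_simps)
      qed
      ultimately show ?case by blast
    qed
    have "w - 1 \<in> Bs y (e - 1 - int (N e))" using Wd_sub(2)[OF y, of "e - 1 - int (N e)"] w by auto
    then have "w - 1 < w + int (N e) - int (ml r') - int (ad r') - int (ml r') * int (N e)"
      using chain[of "N e"] by blast
    moreover have "1 \<le> ml r'" using grow[OF r'] by simp
    then have "int (N e) \<le> int (ml r') * int (N e)" by (metis mult_1 mult_le_mono1 of_nat_le_iff of_nat_mult)
    ultimately show ?thesis using \<open>1 \<le> ml r'\<close> by linarith
  qed (use rp in auto)
  then have "row_label y e r0 Init" using rp lab_valid(2)[OF y rp(1)] by auto
  moreover have "0 < N e"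
    using As_wall[OF y \<open>row_label y e r0 Init\<close> w] N[OF e] dv_pos[OF r0] by auto
  ultimately show thesis using that w N[OF e] by blast
qed

end

section \<open>Determinism between events, and the count of configurations\<close>

lemma row_eqI:
  assumes "y \<in> Y" "y' \<in> Y" "wall y = wall y'" "As y t = As y' t" "Bs y t = Bs y' t"
    "\<And>r p. row_label y t r p \<longleftrightarrow> row_label y' t r p"
  shows "row y t = row y' t"
proof
  fix i
  show "row y t i = row y' t i"
  proof (cases "\<exists>r p. row_label y t r p")
    case True
    then obtain r p where l: "row_label y t r p" "row_label y' t r p" using assms by blast
    show ?thesis using row_active[OF assms(1) l(1), of i] row_active[OF assms(2) l(2), of i] assms by simp
  next
    case False
    then show ?thesis using row_inactive[OF assms(1), of t i] row_inactive[OF assms(2), of t i] assms by auto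
  qed
qed

lemma row_eqD:
  assumes "y \<in> Y" "y' \<in> Y" "row y t = row y' t"
  shows "wall y = wall y'" "As y t = As y' t" "Bs y t = Bs y' t" "row_label y t r p \<longleftrightarrow> row_label y' t r p"
  using assms row_L[OF assms(1), of t] row_L[OF assms(2), of t]
  by (auto simp: As_def Bs_def row_label_def)

lemma row_eq_up:
  assumes y: "y \<in> Y" "y' \<in> Y" and e: "row y t = row y' t" and n: "t + 1 \<notin> events y" "t + 1 \<notin> events y'"
  shows "row y (t + 1) = row y' (t + 1)"
proof (cases "\<exists>r p. row_label y t r p")
  case True
  then obtain r p where "row_label y t r p" by blast
  then have l: "row_label y t r p" "row_label y' t r p" using row_eqD(4)[OF y e, of r p] by simp_all
  have c: "row_label y (t + 1) r Cont" "row_label y' (t + 1) r Cont"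
    using next_row[OF y(1) l(1)] next_row[OF y(2) l(2)] n unfolding events_def by blast+
  show ?thesis
  proof (rule row_eqI[OF y])
    show "wall y = wall y'" using row_eqD[OF y e] by simp
    show "As y (t + 1) = As y' (t + 1)"
      by (rule set_eqI) (simp only: Cont_cuts[OF y(1) c(1)] Cont_cuts[OF y(2) c(2)] row_eqD[OF y e])
    show "Bs y (t + 1) = Bs y' (t + 1)"
      by (rule set_eqI) (simp only: Cont_cuts[OF y(1) c(1)] Cont_cuts[OF y(2) c(2)] row_eqD[OF y e])
    show "row_label y (t + 1) r p \<longleftrightarrow> row_label y' (t + 1) r p" for r p
      using lab_unique[OF y(1) c(1)] lab_unique[OF y(2) c(2)] c by blast
  qed
next
  case False
  have "\<not> row_label y (t + 1) r p" for r p
    using Cont_prev[OF y(1), of t r] False n unfolding events_def by blast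
  moreover have "\<not> row_label y' (t + 1) r p" for r p
  proof
    assume l: "row_label y' (t + 1) r p"
    then have "p = Cont" using n(2) unfolding events_def by blast
    then obtain p' where "row_label y' t r p'" using l Cont_prev[OF y(2)] by blast
    then show False using False row_eqD(4)[OF y e, of r p'] by simp
  qed
  ultimately show ?thesis
    using row_inactive[OF y(1), of "t + 1"] row_inactive[OF y(2), of "t + 1"] row_eqD[OF y e] by auto
qed

text \<open>Within a phase both markers move at constant speed, so rows can also be reconstructed
  downwards. The absence of an event at \<open>t\<close> settles the label, which could otherwise be
  \<open>Init\<close> or some \<open>First\<close>.\<close>

lemma row_eq_down:
  assumes y: "y \<in> Y" "y' \<in> Y" and e: "row y (t + 1) = row y' (t + 1)" and n: "t + 1 \<notin> events y" "t \<notin> events y" "t \<notin> events y'"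
  shows "row y t = row y' t"
proof (cases "\<exists>r p. row_label y (t + 1) r p")
  case True
  then obtain r where c: "row_label y (t + 1) r Cont" using n unfolding events_def by blast
  then have c': "row_label y' (t + 1) r Cont" using row_eqD(4)[OF y e, of r Cont] by simp
  obtain p p' where l: "row_label y t r p" "row_label y' t r p'" using Cont_prev[OF y(1) c] Cont_prev[OF y(2) c'] by metis
  have A: "As y t = As y' t"
  proof (rule set_eqI)
    fix k show "k \<in> As y t \<longleftrightarrow> k \<in> As y' t"
      using Cont_cuts(1)[OF y(1) c, of "k - int (dv r)"] Cont_cuts(1)[OF y(2) c', of "k - int (dv r)"]
        row_eqD[OF y e] by simp
  qed
  have B: "Bs y t = Bs y' t"
  proof (rule set_eqI)
    fix k show "k \<in> Bs y t \<longleftrightarrow> k \<in> Bs y' t"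
      using Cont_cuts(2)[OF y(1) c, of "k + int (ml r)"] Cont_cuts(2)[OF y(2) c', of "k + int (ml r)"]
        row_eqD[OF y e] by simp
  qed
  have l': "row_label y t r Cont" "row_label y' t r Cont" using l n unfolding events_def by blast+
  show ?thesis
  proof (rule row_eqI[OF y _ A B])
    show "wall y = wall y'" using row_eqD[OF y e] by simp
    show "row_label y t r p \<longleftrightarrow> row_label y' t r p" for r p
      using lab_unique[OF y(1) l'(1)] lab_unique[OF y(2) l'(2)] l' by blast
  qed
next
  case False
  have "\<not> row_label y t r p" for r p using next_row[OF y(1), of t r p] False by blast
  moreover have "\<not> row_label y' t r p" for r p
  proof
    assume "row_label y' t r p"
    then obtain r' p' where "row_label y' (t + 1) r' p'" using next_row[OF y(2), of t r p] by blast
    then show False using False row_eqD(4)[OF y e, of r' p'] by simp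
  qed
  ultimately show ?thesis
    using row_inactive[OF y(1), of t] row_inactive[OF y(2), of t] row_eqD[OF y e] by auto
qed


definition cutset :: "int set set" where
  "cutset = insert {} (insert UNIV (range lessThan))"

lemma cut_in_cutset:
  assumes "\<And>i j. i \<in> S \<Longrightarrow> j \<le> i \<Longrightarrow> j \<in> S" shows "S \<in> cutset"
proof -
  have "\<And>i. i \<in> S \<Longrightarrow> i - 1 \<in> S" using assms by simp
  then show ?thesis by (rule int_cut_cases[of S]) (auto simp: cutset_def)
qed

definition mkrow :: "int set \<times> int set \<times> int set \<times> ('s rule \<times> 's phase) option \<Rightarrow> int \<Rightarrow> 's sym" where
  "mkrow = (\<lambda>(W, A, B, l) i. if i \<in> W then L else case l of None \<Rightarrow> R
     | Some (r, p) \<Rightarrow> if i \<in> A \<or> i \<in> B then C r p (i \<in> A) (i \<in> B) else R)"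

lemma countable_rows: "countable {row y t |y t. y \<in> Y}"
proof -
  let ?l = "insert None (Some ` (Rules \<times> (insert Init (insert Cont (First ` Rules)))))"
  have "{row y t |y t. y \<in> Y} \<subseteq> mkrow ` (cutset \<times> cutset \<times> cutset \<times> ?l)"
  proof safe
    fix y t assume y: "y \<in> Y"
    have cuts: "wall y \<in> cutset" "As y t \<in> cutset" "Bs y t \<in> cutset"
      using Wd_down[OF y] As_down[OF y] Bs_down[OF y] by (auto intro!: cut_in_cutset)
    show "row y t \<in> mkrow ` (cutset \<times> cutset \<times> cutset \<times> ?l)"
    proof (cases "\<exists>r p. row_label y t r p")
      case True
      then obtain r p where l: "row_label y t r p" by blast
      have "row y t = mkrow (wall y, As y t, Bs y t, Some (r, p))"
        using row_active[OF y l] by (auto simp: mkrow_def)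
      moreover have "Some (r, p) \<in> ?l" using lab_valid[OF y l] by (cases p) auto
      ultimately show ?thesis using cuts by blast
    next
      case False
      then have "row y t = mkrow (wall y, As y t, Bs y t, None)"
        using row_inactive[OF y, of t] by (auto simp: mkrow_def)
      then show ?thesis using cuts by blast
    qed
  qed
  moreover have "countable (cutset \<times> cutset \<times> cutset \<times> ?l)"
    unfolding cutset_def using fin by (intro countable_SIGMA) (auto intro: countable_finite)
  ultimately show ?thesis by (meson countable_image countable_subset)
qed

text \<open>A point is determined by its events, row 0, and the rows at and just below the events;
  determinism upwards and downwards fills the gaps. The rows just below are stored because
  \<open>row_eq_down\<close> does not reach across an event.\<close>

lemma countable_finite_events: "countable {y \<in> Y. finite (events y)}"
proof -
  let ?T = "\<lambda>y. insert 0 (events y \<union> (\<lambda>t. t - 1) ` events y)"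
  let ?g = "\<lambda>y. (events y, (\<lambda>t. (t, row y t)) ` ?T y)"
  have "inj_on ?g {y \<in> Y. finite (events y)}"
  proof (rule inj_onI)
    fix y y' assume y: "y \<in> {y \<in> Y. finite (events y)}" and y': "y' \<in> {y \<in> Y. finite (events y)}" and g: "?g y = ?g y'"
    have Y: "y \<in> Y" "y' \<in> Y" using y y' by auto
    have E: "events y' = events y" using g by simp
    have T: "row y t = row y' t" if "t \<in> ?T y" for t
    proof -
      have "(t, row y t) \<in> (\<lambda>t. (t, row y' t)) ` ?T y'" using g that by blast
      then show ?thesis by auto
    qed
    have up: "0 \<le> t \<Longrightarrow> row y t = row y' t" for t
    proof (induction t rule: int_ge_induct)
      case (step t)
      then show ?case using T[of "t + 1"] row_eq_up[OF Y step(2)] E by (cases "t + 1 \<in> events y") auto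
    qed (use T in auto)
    have dn: "t \<le> 0 \<Longrightarrow> row y t = row y' t" for t
    proof (induction t rule: int_le_induct)
      case (step t)
      have e: "row y (t - 1 + 1) = row y' (t - 1 + 1)" using step by simp
      show ?case
      proof (cases "t \<in> events y \<or> t - 1 \<in> events y")
        case True then show ?thesis by (intro T) auto
      next
        case False then show ?thesis using E by (intro row_eq_down[OF Y e]) auto
      qed
    qed (use T in auto)
    have "row y t = row y' t" for t using up[of t] dn[of t] by linarith
    then show "y = y'" by (auto simp: row_def fun_eq_iff)
  qed
  moreover have "?g ` {y \<in> Y. finite (events y)} \<subseteq>
      Collect finite \<times> {A. finite A \<and> A \<subseteq> UNIV \<times> {row y t |y t. y \<in> Y}}" by auto
  moreover have "countable (Collect finite \<times> {A. finite A \<and> A \<subseteq> (UNIV :: int set) \<times> {row y t |y t. y \<in> Y}} :: (int set \<times> _) set)"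
    by (intro countable_SIGMA countable_Collect_finite countable_Collect_finite_subset countable_rows) auto
  ultimately show ?thesis by (meson countable_image_inj_on countable_subset)
qed

text \<open>Four cells fix the first row: between two equal \<open>Init\<close> cells the cuts leave
  no choice. So the seed for \<open>n\<close> is a pattern of four cells, whose code is easily
  computed from \<open>n\<close>.\<close>

definition Y0 :: "nat \<Rightarrow> (int \<times> int \<Rightarrow> 's sym) set" where
  "Y0 n = {y \<in> Y. y (-1, 0) = L \<and> y (0, 0) = C r0 Init True False \<and>
     y (int n - 1, 0) = C r0 Init True False \<and> y (int n, 0) = R}"

lemma Y0_iff:
  assumes y: "y \<in> Y" and n: "0 < n"
  shows "y \<in> Y0 n \<longleftrightarrow> wall y = {..<0} \<and> row_label y 0 r0 Init \<and> As y 0 = {..<int n}"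
proof
  assume "y \<in> Y0 n"
  then have h: "row y 0 (-1) = L" "row y 0 0 = C r0 Init True False"
     "row y 0 (int n - 1) = C r0 Init True False" "row y 0 (int n) = R" by (auto simp: Y0_def row_def)
  have "i \<in> wall y \<longleftrightarrow> i < 0" for i
    using Wd_down[OF y, of "-1" i] Wd_down[OF y, of i 0] h by (auto simp: wall_def not_le[symmetric])
  moreover have "row_label y 0 r0 Init" unfolding row_label_def using h(2) by blast
  moreover have "i \<in> As y 0 \<longleftrightarrow> i < int n" for i
  proof
    assume "i \<in> As y 0"
    then show "i < int n" using As_down[OF y, of i 0 "int n"] h(4) by (auto simp: As_def not_le[symmetric])
  next
    assume "i < int n"
    then show "i \<in> As y 0" using As_down[OF y, of "int n - 1" 0 i] h(3) by (auto simp: As_def)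
  qed
  ultimately show "wall y = {..<0} \<and> row_label y 0 r0 Init \<and> As y 0 = {..<int n}" by auto
next
  assume h: "wall y = {..<0} \<and> row_label y 0 r0 Init \<and> As y 0 = {..<int n}"
  have "Bs y 0 = {..<0}" using event_Bs[OF y, of 0 r0 Init] h by auto
  then show "y \<in> Y0 n"
    using row_active[OF y, of 0 r0 Init] h n y by (auto simp: Y0_def row_def)
qed

lemma hor_shift: "hor_ok (\<lambda>i. x (i + u)) i = hor_ok x (i + u)"
  unfolding hor_ok_def by (simp add: algebra_simps)

lemma ver_shift: "ver_ok (\<lambda>i. x (i + u)) (\<lambda>i. x' (i + u)) i = ver_ok x x' (i + u)"
  unfolding ver_ok_def by (simp add: algebra_simps)

lemma Y_shift: "y \<in> Y \<Longrightarrow> (\<lambda>(i, t). y (i + u, t + v)) \<in> Y"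
proof -
  assume y: "y \<in> Y"
  let ?z = "\<lambda>(i, t). y (i + u, t + v)"
  have r: "row ?z t = (\<lambda>i. row y (t + v) (i + u))" for t by (auto simp: row_def)
  have "row y (t + 1 + v) = row y (t + v + 1)" for t by (simp add: ac_simps)
  then show ?thesis using y unfolding Y_def mem_Collect_eq r hor_shift ver_shift by metis
qed

lemma countable_Y:
  assumes "\<And>n. 0 < n \<Longrightarrow> countable (Y0 n)"
  shows "countable Y"
proof -
  let ?sh = "\<lambda>(u, v) y (i, t). y (i + u, t + v)"
  have "y \<in> {y \<in> Y. finite (events y)} \<union> (\<Union>n\<in>{0<..}. \<Union>p. ?sh p ` Y0 n)" if y: "y \<in> Y" for y
  proof (cases "finite (events y)")
    case False
    obtain w e n where h: "wall y = {..<w}" "row_label y e r0 Init" "As y e = {..<w + int n}" "0 < n"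
      using infinite_events_seed[OF y False] .
    let ?z = "\<lambda>(i, t). y (i + w, t + e)"
    have z: "?z \<in> Y" by (rule Y_shift[OF y])
    have r: "row ?z t = (\<lambda>i. row y (t + e) (i + w))" for t by (auto simp: row_def)
    have "wall ?z = {..<0}" unfolding wall_def r using row_L[OF y, of e] h(1) by auto
    moreover have "row_label ?z 0 r0 Init" using h(2) unfolding row_label_def r by (metis add_0 diff_add_cancel)
    moreover have "As ?z 0 = {..<int n}"
    proof -
      have "left_A (row y e (i + w)) \<longleftrightarrow> i < int n" for i
        using h(3) unfolding As_def by (auto simp: set_eq_iff)
      then show ?thesis unfolding As_def r by auto
    qed
    ultimately have "?z \<in> Y0 n" using Y0_iff[OF z h(4)] by blast
    moreover have "y = ?sh (-w, -e) ?z" by auto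
    ultimately have "y \<in> (\<Union>p. ?sh p ` Y0 n)" by blast
    then show ?thesis using h(4) by blast
  qed (use y in auto)
  then have "Y \<subseteq> {y \<in> Y. finite (events y)} \<union> (\<Union>n\<in>{0<..}. \<Union>p. ?sh p ` Y0 n)" by blast
  moreover have "countable ({y \<in> Y. finite (events y)} \<union> (\<Union>n\<in>{0<..}. \<Union>p. ?sh p ` Y0 n))"
    using assms countable_finite_events by (intro countable_Un countable_UN countable_image) auto
  ultimately show ?thesis by (rule countable_subset)
qed

section \<open>Rows with the wall at the origin\<close>

definition cell :: "int \<Rightarrow> int \<Rightarrow> 's rule \<Rightarrow> 's phase \<Rightarrow> int \<Rightarrow> 's sym" where
  "cell A B r p i = (if i < 0 then L else if i < A \<or> i < B then C r p (i < A) (i < B) else R)"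

definition empty_row :: "int \<Rightarrow> 's sym" where
  "empty_row i = (if i < 0 then L else R)"

lemma hor_cell:
  assumes "r \<in> Rules" "int (dv r) + int (rm r) \<le> A" "0 \<le> B" "p \<noteq> Cont \<Longrightarrow> B = 0" "p = Init \<Longrightarrow> r = r0"
    "\<And>r'. p = First r' \<Longrightarrow> r' \<in> Rules \<and> tgt r' = src r"
  shows "hor_ok (cell A B r p) i"
  unfolding hor_ok_def cell_def using assms by auto

lemma hor_empty: "hor_ok empty_row i"
  unfolding hor_ok_def empty_row_def by auto

lemma ver_Cont:
  assumes "r \<in> Rules" "2 * int (dv r) + int (rm r) \<le> A" "0 \<le> B"
  shows "ver_ok (cell A B r p) (cell (A - int (dv r)) (B + int (ml r)) r Cont) i"
  unfolding ver_ok_def cell_def using assms dv_pos[OF assms(1)] by auto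

lemma ver_First:
  assumes "r \<in> Rules" "A = int (dv r) + int (rm r)" "0 \<le> B"
  shows "ver_ok (cell A B r p) (cell (B + int (ml r) + int (ad r)) 0 r' (First r)) i"
  unfolding ver_ok_def cell_def using assms dv_pos[OF assms(1)] grow[OF assms(1)] grow'[OF assms(1)] by auto

lemma ver_empty: "ver_ok empty_row empty_row i"
  unfolding ver_ok_def empty_row_def by auto

lemma ver_Init: "0 < n \<Longrightarrow> ver_ok empty_row (cell n 0 r0 Init) i"
  unfolding ver_ok_def empty_row_def cell_def by auto

end

section \<open>Runs as configurations\<close>

context growing_machine
begin

definition rule_at :: "(nat \<Rightarrow> 's \<times> nat) \<Rightarrow> nat \<Rightarrow> 's rule" where
  "rule_at w j = (SOME r. r \<in> Rules \<and> (\<exists>q\<ge>1. src r = fst (w j) \<and> tgt r = fst (w (Suc j)) \<and>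
     snd (w j) = dv r * q + rm r \<and> snd (w (Suc j)) = ml r * q + ad r))"

definition length_at :: "(nat \<Rightarrow> 's \<times> nat) \<Rightarrow> nat \<Rightarrow> nat" where
  "length_at w j = (snd (w j) - rm (rule_at w j)) div dv (rule_at w j)"

lemma run_rule:
  assumes "w \<in> runs mstep s"
  shows "rule_at w j \<in> Rules" "src (rule_at w j) = fst (w j)" "tgt (rule_at w j) = fst (w (Suc j))"
    "1 \<le> length_at w j" "snd (w j) = dv (rule_at w j) * length_at w j + rm (rule_at w j)"
    "snd (w (Suc j)) = ml (rule_at w j) * length_at w j + ad (rule_at w j)"
proof -
  have "mstep (w j) (w (Suc j))" using assms by (auto simp: runs_def)
  then have "\<exists>r. r \<in> Rules \<and> (\<exists>q\<ge>1. src r = fst (w j) \<and> tgt r = fst (w (Suc j)) \<and>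
     snd (w j) = dv r * q + rm r \<and> snd (w (Suc j)) = ml r * q + ad r)"
    unfolding mstep_def by blast
  from someI_ex[OF this] obtain q where r: "rule_at w j \<in> Rules" and q: "1 \<le> q"
     "src (rule_at w j) = fst (w j)" "tgt (rule_at w j) = fst (w (Suc j))"
     "snd (w j) = dv (rule_at w j) * q + rm (rule_at w j)" "snd (w (Suc j)) = ml (rule_at w j) * q + ad (rule_at w j)"
    unfolding rule_at_def[symmetric] by blast
  have "length_at w j = q" using q(4) dv_pos[OF r] by (simp add: length_at_def)
  then show "rule_at w j \<in> Rules" "src (rule_at w j) = fst (w j)" "tgt (rule_at w j) = fst (w (Suc j))"
    "1 \<le> length_at w j" "snd (w j) = dv (rule_at w j) * length_at w j + rm (rule_at w j)"
    "snd (w (Suc j)) = ml (rule_at w j) * length_at w j + ad (rule_at w j)" using r q by auto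
qed

text \<open>The use of \<open>uniq\<close>: a drawing shows the rules, a run only the states, and
  the rules must be recoverable for the two to correspond one to one.\<close>

lemma rl_eq:
  assumes w: "w \<in> runs mstep s" and r: "r \<in> Rules" "1 \<le> q" "src r = fst (w j)" "tgt r = fst (w (Suc j))"
     "snd (w j) = dv r * q + rm r" "snd (w (Suc j)) = ml r * q + ad r"
  shows "rule_at w j = r"
  by (rule uniq[of _ _ "length_at w j" q]) (use run_rule[OF w, of j] r in auto)

lemma rl_0: "w \<in> runs mstep (src r0, n) \<Longrightarrow> rule_at w 0 = r0"
  using run_rule(1,2)[of w "(src r0, n)" 0] start by (auto simp: runs_def)

text \<open>Row \<open>t\<close> is row \<open>k\<close> of phase \<open>j\<close>, where \<open>(j, k)\<close> is \<open>pos w t\<close>; phase \<open>j\<close> starts in row \<open>start_row w j\<close>.\<close>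

primrec pos :: "(nat \<Rightarrow> 's \<times> nat) \<Rightarrow> nat \<Rightarrow> nat \<times> nat" where
  "pos w 0 = (0, 0)"
| "pos w (Suc t) = (case pos w t of (j, k) \<Rightarrow> if Suc k < length_at w j then (j, Suc k) else (Suc j, 0))"

definition phase_at :: "(nat \<Rightarrow> 's \<times> nat) \<Rightarrow> nat \<times> nat \<Rightarrow> 's phase" where
  "phase_at w = (\<lambda>(j, k). if 0 < k then Cont else if j = 0 then Init else First (rule_at w (j - 1)))"

definition drow :: "(nat \<Rightarrow> 's \<times> nat) \<Rightarrow> nat \<times> nat \<Rightarrow> int \<Rightarrow> 's sym" where
  "drow w = (\<lambda>(j, k). cell (int (snd (w j)) - int (dv (rule_at w j)) * int k) (int (ml (rule_at w j)) * int k)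
      (rule_at w j) (phase_at w (j, k)))"

definition draw :: "(nat \<Rightarrow> 's \<times> nat) \<Rightarrow> int \<times> int \<Rightarrow> 's sym" where
  "draw w = (\<lambda>(i, t). if t < 0 then empty_row i else drow w (pos w (nat t)) i)"

definition start_row :: "(nat \<Rightarrow> 's \<times> nat) \<Rightarrow> nat \<Rightarrow> nat" where
  "start_row w j = (\<Sum>i<j. length_at w i)"

lemma pos_ep:
  assumes w: "w \<in> runs mstep s"
  shows "k < length_at w j \<Longrightarrow> pos w (start_row w j + k) = (j, k)"
proof (induction "start_row w j + k" arbitrary: j k)
  case 0
  then have "k = 0" "start_row w j = 0" by auto
  moreover have "j = 0"
  proof (rule ccontr)
    assume "j \<noteq> 0"
    then have "length_at w 0 \<le> start_row w j" unfolding start_row_def by (intro member_le_sum) auto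
    then show False using run_rule(4)[OF w, of 0] 0 by simp
  qed
  ultimately show ?case by (simp add: start_row_def)
next
  case (Suc t)
  show ?case
  proof (cases k)
    case (Suc k')
    then have "t = start_row w j + k'" using Suc.hyps(2) by simp
    then have "pos w t = (j, k')" using Suc.hyps(1)[of j k'] Suc Suc.prems by simp
    then show ?thesis using Suc Suc.prems Suc.hyps(2)[symmetric] by simp
  next
    case 0
    then obtain j' where j': "j = Suc j'" using Suc.hyps(2) by (cases j) (auto simp: start_row_def)
    then have e: "start_row w j = start_row w j' + length_at w j'" by (simp add: start_row_def)
    let ?k = "length_at w j' - 1"
    have k: "?k < length_at w j'" using run_rule(4)[OF w, of j'] by simp
    then have "t = start_row w j' + ?k" using Suc.hyps(2) 0 e by simp
    then have "pos w t = (j', ?k)" using Suc.hyps(1)[of j' ?k] k by simp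
    then show ?thesis using 0 j' Suc.hyps(2)[symmetric] by simp
  qed
qed

lemma pos_inv:
  assumes w: "w \<in> runs mstep s"
  obtains j k where "pos w t = (j, k)" "k < length_at w j" "t = start_row w j + k"
proof -
  have "\<exists>j k. k < length_at w j \<and> t = start_row w j + k"
  proof (induction t)
    case 0
    show ?case using run_rule(4)[OF w, of 0] by (intro exI[of _ 0]) (auto simp: start_row_def)
  next
    case (Suc t)
    then obtain j k where k: "k < length_at w j" "t = start_row w j + k" by blast
    show ?case
    proof (cases "Suc k < length_at w j")
      case True then show ?thesis using k by (intro exI[of _ j] exI[of _ "Suc k"]) simp
    next
      case False
      then show ?thesis using k run_rule(4)[OF w, of "Suc j"]
        by (intro exI[of _ "Suc j"] exI[of _ 0]) (auto simp: start_row_def)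
    qed
  qed
  then obtain j k where "k < length_at w j" "t = start_row w j + k" by blast
  then show thesis using that pos_ep[OF w] by blast
qed

lemma draw_row: "row (draw w) t = (if t < 0 then empty_row else drow w (pos w (nat t)))"
  by (auto simp: row_def draw_def fun_eq_iff)

lemma draw_in_Y:
  assumes w: "w \<in> runs mstep (src r0, n)" and n: "0 < n"
  shows "draw w \<in> Y"
  unfolding Y_def mem_Collect_eq
proof (intro allI conjI)
  fix i t
  \<comment> \<open>The distance of \<open>A\<close> from the wall in terms of the
    \<open>length_at w j - k\<close> rows left in the phase; for the last row this is exactly the
    threshold \<open>dv + rm\<close>.\<close>
  have A: "int (snd (w j)) - int (dv (rule_at w j)) * int k
      = int (dv (rule_at w j)) * int (length_at w j - k) + int (rm (rule_at w j))" if "k < length_at w j" for j k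
    using run_rule(5)[OF w, of j] that by (simp add: of_nat_diff algebra_simps)
  have A': "int (dv (rule_at w j)) + int (rm (rule_at w j)) \<le> int (snd (w j)) - int (dv (rule_at w j)) * int k"
    if "k < length_at w j" for j k
  proof -
    have "int (dv (rule_at w j)) * 1 \<le> int (dv (rule_at w j)) * int (length_at w j - k)"
      by (rule mult_left_mono) (use that in auto)
    then show ?thesis using A[OF that] by simp
  qed
  show "hor_ok (row (draw w) t) i"
  proof (cases "t < 0")
    case False
    obtain j k where jk: "pos w (nat t) = (j, k)" "k < length_at w j" using pos_inv[OF w] by metis
    have "hor_ok (drow w (j, k)) i"
      unfolding drow_def prod.case
      by (rule hor_cell)
        (use run_rule[OF w, of j] run_rule[OF w, of "j - 1"] A'[OF jk(2)] rl_0[OF w] in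
          \<open>auto simp: phase_at_def split: if_splits\<close>)
    then show ?thesis using False jk by (simp add: draw_row)
  qed (simp add: draw_row hor_empty)
  show "ver_ok (row (draw w) t) (row (draw w) (t + 1)) i"
  proof -
    consider "t < -1" | "t = -1" | "0 \<le> t" by linarith
    then show ?thesis
    proof cases
      case 1 then show ?thesis by (simp add: draw_row ver_empty)
    next
      case 2
      have "drow w (pos w 0) = cell (int n) 0 r0 Init"
        using w rl_0[OF w] by (auto simp: drow_def phase_at_def runs_def)
      then show ?thesis using 2 n ver_Init[of "int n" i] by (simp add: draw_row)
    next
      case 3
      obtain j k where jk: "pos w (nat t) = (j, k)" "k < length_at w j" using pos_inv[OF w] by metis
      have e: "nat (t + 1) = Suc (nat t)" using 3 by simp
      have r: "rule_at w j \<in> Rules" using run_rule[OF w] by blast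
      have "ver_ok (drow w (j, k)) (drow w (pos w (Suc (nat t)))) i"
      proof (cases "Suc k < length_at w j")
        case True
        have p: "drow w (pos w (Suc (nat t))) = cell (int (snd (w j)) - int (dv (rule_at w j)) * int k - int (dv (rule_at w j)))
            (int (ml (rule_at w j)) * int k + int (ml (rule_at w j))) (rule_at w j) Cont"
          using True jk by (simp add: drow_def phase_at_def algebra_simps)
        show ?thesis unfolding p unfolding drow_def prod.case
          by (rule ver_Cont[OF r]) (use A'[OF True] in \<open>auto simp: algebra_simps\<close>)
      next
        case False
        then have q: "length_at w j = Suc k" using jk by simp
        have p: "drow w (pos w (Suc (nat t))) = cell (int (ml (rule_at w j)) * int k + int (ml (rule_at w j)) + int (ad (rule_at w j)))
            0 (rule_at w (Suc j)) (First (rule_at w j))"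
          using False jk run_rule(6)[OF w, of j] q by (simp add: drow_def phase_at_def algebra_simps)
        show ?thesis unfolding p unfolding drow_def prod.case
          by (rule ver_First[OF r]) (use A[OF jk(2)] q in \<open>auto simp: algebra_simps\<close>)
      qed
      then show ?thesis using 3 jk e by (simp add: draw_row)
    qed
  qed
qed

lemma draw_in_Y0:
  assumes w: "w \<in> runs mstep (src r0, n)" and n: "0 < n"
  shows "draw w \<in> Y0 n"
proof -
  have "drow w (pos w 0) = cell (int n) 0 r0 Init"
    using w rl_0[OF w] by (auto simp: drow_def phase_at_def runs_def)
  then show ?thesis using draw_in_Y[OF w n] n by (auto simp: Y0_def draw_def cell_def)
qed

text \<open>Reading a configuration with \<open>phase\<close> yields, by dependent choice, the start
  rows, rules and numbers of a run. Nothing is hidden below the seed: activity persists upwards, and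
  the row below an \<open>Init\<close> row is inactive.\<close>

lemma draw_surj:
  assumes y0: "y \<in> Y0 n" and n: "0 < n"
  shows "\<exists>w\<in>runs mstep (src r0, n). draw w = y"
proof -
  have y: "y \<in> Y" using y0 by (simp add: Y0_def)
  have h: "wall y = {..<0}" "row_label y 0 r0 Init" "As y 0 = {..<int n}" using Y0_iff[OF y n] y0 by auto
  define P where "P j x = (case x of (t, r, m) \<Rightarrow> (j = 0 \<longrightarrow> t = 0 \<and> r = r0 \<and> m = n) \<and>
      (\<exists>p. row_label y (int t) r p \<and> p \<noteq> Cont) \<and> As y (int t) = {..<int m})"
    for j :: nat and x :: "nat \<times> 's rule \<times> nat"
  define Q where "Q j x x' = (case x of (t, r, m) \<Rightarrow> case x' of (t', r', m') \<Rightarrow> \<exists>q\<ge>1. m = dv r * q + rm r \<and>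
      t' = t + q \<and> m' = ml r * q + ad r \<and> row_label y (int t') r' (First r) \<and>
      (\<forall>k<q. As y (int t + int k) = {..<int m - int (dv r) * int k} \<and>
         Bs y (int t + int k) = {..<int (ml r) * int k} \<and> (0 < k \<longrightarrow> row_label y (int t + int k) r Cont)))"
    for j :: nat and x x' :: "nat \<times> 's rule \<times> nat"
  have "\<exists>f. \<forall>j. P j (f j) \<and> Q j (f j) (f (Suc j))"
  proof (rule dependent_nat_choice)
    show "\<exists>x. P 0 x" using h by (intro exI[of _ "(0, r0, n)"]) (auto simp: P_def)
    fix x j assume Px: "P j x"
    obtain t r m where x: "x = (t, r, m)" by (cases x)
    obtain p where p: "row_label y (int t) r p" "p \<noteq> Cont" and A: "As y (int t) = {..<0 + int m}"
      using Px x by (auto simp: P_def)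
    have B: "Bs y (int t) = {..<0 + int 0}" using event_Bs[OF y p] h(1) by simp
    from phase[OF y p(1) h(1) A B] obtain q r' where q: "1 \<le> q" "m = dv r * q + rm r"
      "\<forall>k<q. As y (int t + int k) = {..<0 + int m - int (dv r) * int k} \<and>
         Bs y (int t + int k) = {..<0 + int 0 + int (ml r) * int k} \<and> (0 < k \<longrightarrow> row_label y (int t + int k) r Cont)"
      "row_label y (int t + int q) r' (First r)"
      "As y (int t + int q) = {..<0 + int 0 + int (ml r) * int q + int (ad r)}" by blast
    show "\<exists>x'. P (Suc j) x' \<and> Q j x x'"
    proof (intro exI conjI)
      show "P (Suc j) (t + q, r', ml r * q + ad r)" using q by (auto simp: P_def)
      show "Q j x (t + q, r', ml r * q + ad r)"
        using q by (auto simp: Q_def x)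
    qed
  qed
  then obtain f where P: "\<And>j. P j (f j)" and Q: "\<And>j. Q j (f j) (f (Suc j))" by blast
  define T where "T j = fst (f j)" for j
  define r where "r j = fst (snd (f j))" for j
  define m where "m j = snd (snd (f j))" for j
  have f: "f j = (T j, r j, m j)" for j by (simp add: T_def r_def m_def)
  have z: "T 0 = 0" "r 0 = r0" "m 0 = n" using P[of 0] unfolding f P_def by auto
  have ev: "\<exists>p. row_label y (int (T j)) (r j) p \<and> p \<noteq> Cont" for j using P[of j] unfolding f P_def by auto
  have "\<exists>q\<ge>1. m j = dv (r j) * q + rm (r j) \<and>
      T (Suc j) = T j + q \<and> m (Suc j) = ml (r j) * q + ad (r j) \<and> row_label y (int (T (Suc j))) (r (Suc j)) (First (r j)) \<and>
      (\<forall>k<q. As y (int (T j) + int k) = {..<int (m j) - int (dv (r j)) * int k} \<and>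
         Bs y (int (T j) + int k) = {..<int (ml (r j)) * int k} \<and> (0 < k \<longrightarrow> row_label y (int (T j) + int k) (r j) Cont))" for j
    using Q[of j] unfolding f Q_def by simp
  then obtain q where q: "\<And>j. 1 \<le> q j" "\<And>j. m j = dv (r j) * q j + rm (r j)" "\<And>j. T (Suc j) = T j + q j"
    "\<And>j. m (Suc j) = ml (r j) * q j + ad (r j)" "\<And>j. row_label y (int (T (Suc j))) (r (Suc j)) (First (r j))"
    "\<And>j k. k < q j \<Longrightarrow> As y (int (T j) + int k) = {..<int (m j) - int (dv (r j)) * int k}"
    "\<And>j k. k < q j \<Longrightarrow> Bs y (int (T j) + int k) = {..<int (ml (r j)) * int k}"
    "\<And>j k. k < q j \<Longrightarrow> 0 < k \<Longrightarrow> row_label y (int (T j) + int k) (r j) Cont" by metis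
  define w where "w j = (src (r j), m j)" for j
  have rR: "r j \<in> Rules" for j using ev lab_valid(1)[OF y] by blast
  have tg: "tgt (r j) = src (r (Suc j))" for j using q(5) lab_valid(3)[OF y] by blast
  have w: "w \<in> runs mstep (src r0, n)"
    unfolding runs_def mstep_def using z q(1,2,4) rR tg by (force simp: w_def)
  have rule_at: "rule_at w j = r j" for j
    by (rule rl_eq[OF w rR q(1)]) (use tg q(2,4) in \<open>auto simp: w_def\<close>)
  have qe: "length_at w j = q j" for j
    using dv_pos[OF rR] by (simp add: length_at_def rule_at w_def q(2))
  have Te: "T j = start_row w j" for j by (induction j) (auto simp: z q(3) start_row_def qe)
  have row: "row y (int t) = drow w (pos w t)" for t
  proof -
    obtain j k where jk: "pos w t = (j, k)" "k < length_at w j" "t = start_row w j + k" using pos_inv[OF w] .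
    have t: "int t = int (T j) + int k" using jk Te by simp
    have l: "row_label y (int t) (r j) (phase_at w (j, k))"
    proof (cases k)
      case 0
      then show ?thesis using h(2) z q(5)[of "j - 1"] t by (cases j) (auto simp: phase_at_def rule_at)
    next
      case (Suc k')
      then have "row_label y (int t) (r j) Cont" unfolding t using q(8)[of k j] jk(2) qe by simp
      then show ?thesis using Suc by (simp add: phase_at_def)
    qed
    have k: "k < q j" using jk qe by simp
    show ?thesis
      unfolding jk(1) drow_def prod.case
      by (rule ext, subst row_active[OF y l])
        (auto simp: cell_def h(1) t q(6)[OF k] q(7)[OF k] rule_at w_def)
  qed
  have neg: "row y t = empty_row" if tneg: "t < 0" for t
  proof -
    have "\<not> row_label y t r p" for r p
    proof
      assume "row_label y t r p"
      then obtain r' p' where "row_label y (-1) r' p'" using active_up[OF y, of t r p "-1"] tneg by auto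
      then show False using Init_prev[OF y, of "-1"] h(2) by simp
    qed
    then show ?thesis using row_inactive[OF y, of t] h(1) by (auto simp: empty_row_def)
  qed
  have "row (draw w) t = row y t" for t
    using row[of "nat t"] neg[of t] by (auto simp: draw_row)
  then have "draw w = y" by (auto simp: row_def fun_eq_iff)
  then show ?thesis using w by blast
qed

text \<open>Row \<open>t\<close> lies in a phase of index at most \<open>t\<close>, and the rule of
  phase \<open>j\<close> depends on the states \<open>j\<close> and \<open>Suc j\<close>; hence the
  bound \<open>Suc T\<close>.\<close>

lemma draw_cont:
  assumes "\<And>j. j \<le> Suc T \<Longrightarrow> w j = w' j" "t \<le> T"
  shows "pos w t = pos w' t \<and> fst (pos w t) \<le> t \<and> drow w (pos w t) = drow w' (pos w t)"
proof -
  have rule_at: "rule_at w j = rule_at w' j" if "j \<le> T" for j using assms(1)[of j] assms(1)[of "Suc j"] that by (simp add: rule_at_def)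
  have length_at: "length_at w j = length_at w' j" if "j \<le> T" for j using rule_at[OF that] assms(1)[of j] that by (simp add: length_at_def)
  have p: "pos w t = pos w' t \<and> fst (pos w t) \<le> t" using assms(2)
  proof (induction t)
    case (Suc t)
    then have "pos w t = pos w' t" "fst (pos w t) \<le> t" by auto
    then show ?case using length_at[of "fst (pos w t)"] Suc.prems by (auto split: prod.splits)
  qed simp
  obtain j k where jk: "pos w t = (j, k)" by fastforce
  then have "j \<le> T" using p assms(2) by (metis fst_conv le_trans)
  then have "drow w (j, k) = drow w' (j, k)"
    using rule_at[of j] rule_at[of "j - 1"] assms(1)[of j] by (simp add: drow_def phase_at_def)
  then show ?thesis using p jk by metis
qed

text \<open>The cell next to the wall in the first row of a phase shows its rule, and from the
  common start the rules determine the numbers and the lengths of the phases. The cells to be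
  inspected depend on \<open>w\<close> alone, which gives continuity of the inverse.\<close>

lemma draw_inj:
  assumes w: "w \<in> runs mstep (src r0, n)" "w' \<in> runs mstep (src r0, n)" and n: "0 < n"
    and a: "\<And>j. j \<le> J \<Longrightarrow> draw w (0, int (start_row w j)) = draw w' (0, int (start_row w j))"
  shows "j \<le> J \<Longrightarrow> w j = w' j"
proof -
  have row_label: "draw v (0, int (start_row v j)) = C (rule_at v j) (phase_at v (j, 0)) True False" if v: "v \<in> runs mstep (src r0, n)" for v j
  proof -
    have "pos v (start_row v j) = (j, 0)" using pos_ep[OF v, of 0 j] run_rule(4)[OF v, of j] by simp
    moreover have "0 < snd (v j)" using run_rule(1,4,5)[OF v, of j] dv_pos by (metis add_gr_0 mult_pos_pos less_le_trans zero_less_one)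
    ultimately show ?thesis by (simp add: draw_def drow_def cell_def)
  qed
  have "j \<le> J \<Longrightarrow> start_row w j = start_row w' j \<and> snd (w j) = snd (w' j) \<and> rule_at w j = rule_at w' j" for j
  proof (induction j)
    case 0 then show ?case using rl_0 w by (auto simp: start_row_def runs_def)
  next
    case (Suc j)
    then have IH: "start_row w j = start_row w' j" "snd (w j) = snd (w' j)" "rule_at w j = rule_at w' j" by auto
    then have qe: "length_at w j = length_at w' j" by (simp add: length_at_def)
    have e: "start_row w (Suc j) = start_row w' (Suc j)" using IH qe by (simp add: start_row_def)
    then have "rule_at w (Suc j) = rule_at w' (Suc j)"
      using a[OF Suc.prems] row_label[OF w(1), of "Suc j"] row_label[OF w(2), of "Suc j"] by simp
    then show ?case using e run_rule(6)[OF w(1), of j] run_rule(6)[OF w(2), of j] IH qe by simp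
  qed
  then show "j \<le> J \<Longrightarrow> w j = w' j"
    using run_rule(2)[OF w(1), of j] run_rule(2)[OF w(2), of j] by (metis prod.collapse)
qed

lemma derived_Y0:
  assumes n: "0 < n"
  shows "draw ` derived (runs mstep (src r0, n)) k = derived (Y0 n) k"
proof (rule derived_homeo)
  show "draw ` runs mstep (src r0, n) = Y0 n"
    using draw_in_Y0[OF _ n] draw_surj[OF _ n] by blast
  fix w D' assume w: "w \<in> runs mstep (src r0, n)" and D': "finite (D' :: (int \<times> int) set)"
  obtain T where T: "\<forall>p\<in>D'. nat (snd p) \<le> T"
    using finite_nat_set_iff_bounded_le[of "(nat \<circ> snd) ` D'"] D' by auto
  show "\<exists>D. finite D \<and> (\<forall>w'\<in>runs mstep (src r0, n). agree D w w' \<longrightarrow> agree D' (draw w) (draw w'))"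
  proof (intro exI[of _ "{..Suc T}"] conjI ballI impI)
    fix w' assume "agree {..Suc T} w w'"
    then have c: "\<And>t. t \<le> T \<Longrightarrow> pos w t = pos w' t \<and> fst (pos w t) \<le> t \<and> drow w (pos w t) = drow w' (pos w t)"
      by (intro draw_cont) (auto simp: agree_def)
    show "agree D' (draw w) (draw w')"
      unfolding agree_def
    proof
      fix p assume p: "p \<in> D'"
      obtain i t where it: "p = (i, t)" by fastforce
      have "nat t \<le> T" using T p it by force
      then have "drow w (pos w (nat t)) = drow w' (pos w' (nat t))" using c[of "nat t"] by metis
      then show "draw w p = draw w' p" using it by (simp add: draw_def)
    qed
  qed simp
next
  fix w D assume w: "w \<in> runs mstep (src r0, n)" and D: "finite (D :: nat set)"
  obtain J where J: "\<forall>j\<in>D. j \<le> J" using finite_nat_set_iff_bounded_le D by auto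
  show "\<exists>D'. finite D' \<and> (\<forall>w'\<in>runs mstep (src r0, n). agree D' (draw w) (draw w') \<longrightarrow> agree D w w')"
  proof (intro exI[of _ "(\<lambda>j. (0, int (start_row w j))) ` {..J}"] conjI ballI impI)
    fix w' assume w': "w' \<in> runs mstep (src r0, n)" "agree ((\<lambda>j. (0, int (start_row w j))) ` {..J}) (draw w) (draw w')"
    have "w j = w' j" if "j \<le> J" for j
      by (rule draw_inj[OF w w'(1) n _ that]) (use w'(2) in \<open>auto simp: agree_def\<close>)
    then show "agree D w w'" using J by (auto simp: agree_def)
  qed simp
qed

end

section \<open>Finite type\<close>

text \<open>The forbidden patterns are the fillings of the window \<open>D\<close> that come from
  configurations violating \<open>Q\<close>; by \<open>dep\<close> the window decides.\<close>

lemma is_SFT_local: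
  assumes D: "finite D"
    and dep: "\<And>x x'. range x \<subseteq> {..<m} \<Longrightarrow> range x' \<subseteq> {..<m} \<Longrightarrow> (\<forall>p\<in>D. x p = x' p) \<Longrightarrow> Q x \<Longrightarrow> Q x'"
  shows "is_SFT m {x. range x \<subseteq> {..<m} \<and> (\<forall>u v. Q (\<lambda>(i, j). x (i + u, j + v)))}"
proof -
  define F :: "pattern set" where "F = {P. dom P = D \<and> ran P \<subseteq> {..<m} \<and>
    (\<exists>x. range x \<subseteq> {..<m} \<and> \<not> Q x \<and> (\<forall>p\<in>D. P p = Some (x p)))}"
  have "F \<subseteq> {P. dom P = D \<and> ran P \<subseteq> {..<m}}" by (auto simp: F_def)
  then have "finite F" using finite_set_of_finite_maps[OF D, of "{..<m}"] finite_subset by blast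
  moreover have "\<forall>P\<in>F. finite (dom P)" using D by (auto simp: F_def)
  moreover have "(\<forall>P\<in>F. \<not> occurs_in P x) \<longleftrightarrow> (\<forall>u v. Q (\<lambda>(i, j). x (i + u, j + v)))"
    if x: "range x \<subseteq> {..<m}" for x :: config
  proof
    assume *: "\<forall>P\<in>F. \<not> occurs_in P x"
    show "\<forall>u v. Q (\<lambda>(i, j). x (i + u, j + v))"
    proof (intro allI, rule ccontr)
      fix u v
      let ?z = "\<lambda>(i, j). x (i + u, j + v)"
      assume nQ: "\<not> Q ?z"
      define P :: pattern where "P = (\<lambda>p. if p \<in> D then Some (?z p) else None)"
      have z: "range ?z \<subseteq> {..<m}" using x by auto
      have "dom P = D" by (auto simp: P_def dom_def)
      moreover have "ran P \<subseteq> {..<m}" using x by (auto simp: P_def ran_def split: if_splits)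
      moreover have "\<forall>p\<in>D. P p = Some (?z p)" by (simp add: P_def)
      ultimately have "P \<in> F" unfolding F_def using z nQ by blast
      moreover have "occurs_in P x" unfolding occurs_in_def
        by (intro exI[of _ u] exI[of _ v]) (auto simp: P_def split: if_splits)
      ultimately show False using * by blast
    qed
  next
    assume *: "\<forall>u v. Q (\<lambda>(i, j). x (i + u, j + v))"
    show "\<forall>P\<in>F. \<not> occurs_in P x"
    proof (intro ballI notI)
      fix P assume "P \<in> F" "occurs_in P x"
      then obtain z u v where z: "range z \<subseteq> {..<m}" "\<not> Q z" "\<forall>p\<in>D. P p = Some (z p)"
        and o: "\<And>i j a. P (i, j) = Some a \<Longrightarrow> x (i + u, j + v) = a"
        unfolding F_def occurs_in_def by blast
      have "Q z"
        by (rule dep[of "\<lambda>(i, j). x (i + u, j + v)"]) (use x z o * in auto)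
      then show False using z by blast
    qed
  qed
  ultimately show ?thesis unfolding is_SFT_def by (intro exI[of _ F]) auto
qed

definition seed :: "nat \<Rightarrow> nat \<Rightarrow> nat \<Rightarrow> nat \<Rightarrow> pattern" where
  "seed cL cC cR n = map_of [((-1, 0), cL), ((0, 0), cC), ((int n - 1, 0), cC), ((int n, 0), cR)]"

lemma seed_match:
  assumes "0 < n"
  shows "(\<forall>i j a. seed cL cC cR n (i, j) = Some a \<longrightarrow> x (i + u, j + v) = a) \<longleftrightarrow>
    x (-1 + u, v) = cL \<and> x (u, v) = cC \<and> x (int n - 1 + u, v) = cC \<and> x (int n + u, v) = (cR::nat)"
  (is "?l \<longleftrightarrow> ?r")
proof
  assume ?l
  then have a: "seed cL cC cR n (i, j) = Some a \<Longrightarrow> x (i + u, j + v) = a" for i j a by blast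
  show ?r
    using a[of "-1" 0 cL] a[of 0 0 cC] a[of "int n - 1" 0 cC] a[of "int n" 0 cR] assms
    by (auto simp: seed_def)
next
  assume ?r then show ?l by (auto simp: seed_def split: if_splits)
qed

context growing_machine
begin

definition phases :: "'s phase set" where "phases = insert Init (insert Cont (First ` Rules))"

definition V :: "'s sym set" where
  "V = {L, R} \<union> {C r p a b |r p a b. r \<in> Rules \<and> p \<in> phases}"

definition reach :: nat where "reach = (\<Sum>r\<in>Rules. dv r + rm r + ml r + ad r)"

text \<open>A radius that covers every cell inspected by \<open>hor_ok\<close> and
  \<open>ver_ok\<close>: the sum bounds the offsets of all rules at once, and 2 leaves room for the
  neighbours.\<close>

definition M :: int where "M = 2 + int reach"

lemma finite_V: "finite V"
proof -
  have "V = {L, R} \<union> (\<Union>r\<in>Rules. \<Union>p\<in>phases. \<Union>a. \<Union>b. {C r p a b})"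
    unfolding V_def by blast
  moreover have "finite phases" using fin by (simp add: phases_def)
  ultimately show ?thesis using fin by simp
qed

lemma V_C: "C r p a b \<in> V \<longleftrightarrow> r \<in> Rules \<and> p \<in> phases" by (auto simp: V_def)

lemma Y_in_V: "y \<in> Y \<Longrightarrow> y p \<in> V"
proof -
  assume y: "y \<in> Y"
  obtain i t where p: "p = (i, t)" by fastforce
  have "valid (y (i, t))" using y unfolding Y_def hor_ok_def row_def by blast
  then show ?thesis
  proof (cases "y (i, t)")
    case (C r q a b)
    then show ?thesis using \<open>valid (y (i, t))\<close> p by (cases q) (auto simp: V_C phases_def)
  qed (auto simp: p V_def)
qed

lemma window:
  assumes "r \<in> Rules" shows "2 + int (dv r) + int (rm r) + int (ml r) + int (ad r) \<le> M"
  using member_le_sum[OF assms, of "\<lambda>r. dv r + rm r + ml r + ad r"] fin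
  unfolding M_def reach_def[symmetric] by simp

lemma hor_local:
  assumes e: "\<And>i. \<bar>i\<bar> \<le> M \<Longrightarrow> x i = z i" and V: "x 0 \<in> V"
  shows "hor_ok x 0 = hor_ok z 0"
proof -
  have M: "2 \<le> M" by (simp add: M_def)
  have e0: "x 0 = z 0" "x (-1) = z (-1)" "x 1 = z 1" using e M by auto
  show ?thesis
  proof (cases "x 0")
    case (C r p a b)
    then have r: "r \<in> Rules" using V V_C by auto
    have "x (int (dv r) + int (rm r) - 1) = z (int (dv r) + int (rm r) - 1)"
      using e window[OF r] dv_pos[OF r] by auto
    then show ?thesis using C e0 unfolding hor_ok_def by auto
  qed (use e0 in \<open>auto simp: hor_ok_def\<close>)
qed

text \<open>Which offsets occur depends on the rules shown in \<open>x 0\<close> and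
  \<open>x' 0\<close>, so both cells are split before the agreement is used.\<close>

lemma ver_local:
  assumes e: "\<And>i. \<bar>i\<bar> \<le> M \<Longrightarrow> x i = z i" and e': "\<And>i. \<bar>i\<bar> \<le> M \<Longrightarrow> x' i = z' i"
    and V: "x 0 \<in> V" "x' 0 \<in> V"
  shows "ver_ok x x' 0 = ver_ok z z' 0"
proof -
  have M: "2 \<le> M" by (simp add: M_def)
  have e0: "x 0 = z 0" "x (-1) = z (-1)" "x 1 = z 1" "x' 0 = z' 0" "x' (-1) = z' (-1)" "x' 1 = z' 1"
    using e e' M by auto
  have er: "x (- int (dv r) - int (rm r)) = z (- int (dv r) - int (rm r))"
    "x' (- int (dv r)) = z' (- int (dv r))"
    "x (int (dv r) + int (rm r)) = z (int (dv r) + int (rm r))"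
    "x (int (dv r)) = z (int (dv r))" "x (1 + int (dv r)) = z (1 + int (dv r))"
    "x (- int (ml r)) = z (- int (ml r))" "x (1 - int (ml r)) = z (1 - int (ml r))"
    "x (- int (ml r) - int (ad r)) = z (- int (ml r) - int (ad r))"
    "x (1 - int (ml r) - int (ad r)) = z (1 - int (ml r) - int (ad r))" if r: "r \<in> Rules" for r
    using window[OF r] by (auto intro!: e e')
  note e1 = e0(2,3,5,6)
  have Rr: "s \<in> Rules" if "x 0 = C s p a b" for s p a b using V V_C that by auto
  have R1: "s \<in> Rules" "q \<in> phases" if "x' 0 = C s q a b" for s q a b using V V_C that by auto
  have z: "z 0 = x 0" "z' 0 = x' 0" using e0 by auto
  show ?thesis
  proof (cases "x 0")
    case L
    show ?thesis
    proof (cases "x' 0")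
      case (C r p a b)
      note r = R1[OF C]
      show ?thesis
      proof (cases p)
        case (First q)
        then have "q \<in> Rules" using r by (auto simp: phases_def)
        then show ?thesis by (simp add: ver_ok_def L C z First e1 er)
      qed (simp_all add: ver_ok_def L C z e1 er r)
    qed (simp_all add: ver_ok_def L z e1)
  next
    case R
    show ?thesis
    proof (cases "x' 0")
      case (C r p a b)
      note r = R1[OF C]
      show ?thesis
      proof (cases p)
        case (First q)
        then have "q \<in> Rules" using r by (auto simp: phases_def)
        then show ?thesis by (simp add: ver_ok_def R C z First e1 er)
      qed (simp_all add: ver_ok_def R C z e1 er r)
    qed (simp_all add: ver_ok_def R z e1)
  next
    case (C r0 p0 a0 b0)
    note C0 = C and r0 = Rr[OF C]
    show ?thesis
    proof (cases "x' 0")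
      case (C r p a b)
      note r = R1[OF C]
      show ?thesis
      proof (cases p)
        case (First q)
        then have "q \<in> Rules" using r by (auto simp: phases_def)
        then show ?thesis by (simp add: ver_ok_def C0 C z First e1 er r0)
      qed (simp_all add: ver_ok_def C0 C z e1 er r r0)
    qed (simp_all add: ver_ok_def C0 z e1 er r0)
  qed
qed

text \<open>The type of symbols may be infinite, but only the finitely many in \<open>V\<close>
  occur, and a numbering of them turns \<open>Y\<close> into a subshift over numbers. An occurrence
  of the seed in a derivative is shifted to the origin; there it cuts out the cylinder
  \<open>Y0 n\<close>, which is homeomorphic to the runs from \<open>n\<close>.\<close>

theorem machine_SFT:
  assumes cnt: "\<And>n. 0 < n \<Longrightarrow> countable (runs mstep (src r0, n))"
  obtains m X cL cC cR where "is_SFT m X" "countable X"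
    "\<And>n k. 0 < n \<Longrightarrow> occurs (seed cL cC cR n) (cb_deriv X k) \<longleftrightarrow> derived (runs mstep (src r0, n)) k \<noteq> {}"
proof -
  obtain enc :: "'s sym \<Rightarrow> nat" where enc: "bij_betw enc V {0..<card V}"
    using ex_bij_betw_finite_nat[OF finite_V] by blast
  define m where "m = card V"
  define dec where "dec = inv_into V enc"
  have ed: "dec (enc s) = s" if "s \<in> V" for s
    unfolding dec_def using that enc by (meson bij_betw_inv_into_left)
  have de: "enc (dec a) = a" "dec a \<in> V" if "a < m" for a
    unfolding dec_def using that enc m_def
    by (auto simp: bij_betw_inv_into_right) (metis atLeastLessThan_iff bij_betw_def inv_into_into le0)
  have em: "enc s < m" if "s \<in> V" for s using enc that m_def by (auto simp: bij_betw_def)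
  define X where "X = (\<lambda>y. enc \<circ> y) ` Y"
  define Q where "Q x = (hor_ok (row (dec \<circ> x) 0) 0 \<and> ver_ok (row (dec \<circ> x) 0) (row (dec \<circ> x) 1) 0)" for x :: config
  have sft: "is_SFT m {x. range x \<subseteq> {..<m} \<and> (\<forall>u v. Q (\<lambda>(i, j). x (i + u, j + v)))}"
  proof (rule is_SFT_local[of "{-M..M} \<times> {0, 1}"])
    fix x x' :: config
    assume x: "range x \<subseteq> {..<m}" "range x' \<subseteq> {..<m}" and e: "\<forall>p\<in>{- M..M} \<times> {0, 1}. x p = x' p" and q: "Q x"
    have r: "row (dec \<circ> x) t i = row (dec \<circ> x') t i" if "\<bar>i\<bar> \<le> M" "t \<in> {0, 1}" for i t
    proof -
      have "(i, t) \<in> {- M..M} \<times> {0, 1}" using that by auto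
      then show ?thesis using e by (simp only: row_def comp_apply)
    qed
    have v: "row (dec \<circ> x) t i \<in> V" for i t using de(2) x by (auto simp: row_def)
    have "hor_ok (row (dec \<circ> x) 0) 0 = hor_ok (row (dec \<circ> x') 0) 0"
      by (rule hor_local) (use r v in auto)
    moreover have "ver_ok (row (dec \<circ> x) 0) (row (dec \<circ> x) 1) 0 = ver_ok (row (dec \<circ> x') 0) (row (dec \<circ> x') 1) 0"
      by (rule ver_local) (use r v in auto)
    ultimately show "Q x'" using q by (simp add: Q_def)
  qed auto
  have X_eq: "X = {x. range x \<subseteq> {..<m} \<and> (\<forall>u v. Q (\<lambda>(i, j). x (i + u, j + v)))}"
  proof (intro equalityI subsetI)
    fix x assume "x \<in> X"
    then obtain y where y: "y \<in> Y" "x = enc \<circ> y" by (auto simp: X_def)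
    have "Q (\<lambda>(i, j). x (i + u, j + v))" for u v
    proof -
      have "dec \<circ> (\<lambda>(i, j). x (i + u, j + v)) = (\<lambda>(i, j). y (i + u, j + v))"
        using y ed Y_in_V[OF y(1)] by (auto simp: fun_eq_iff)
      moreover have "hor_ok (row (\<lambda>(i, j). y (i + u, j + v)) 0) 0 \<and>
         ver_ok (row (\<lambda>(i, j). y (i + u, j + v)) 0) (row (\<lambda>(i, j). y (i + u, j + v)) (0 + 1)) 0"
        using Y_shift[OF y(1), of u v] unfolding Y_def by blast
      ultimately show ?thesis unfolding Q_def by simp
    qed
    moreover have "range x \<subseteq> {..<m}" using y em Y_in_V[OF y(1)] by auto
    ultimately show "x \<in> {x. range x \<subseteq> {..<m} \<and> (\<forall>u v. Q (\<lambda>(i, j). x (i + u, j + v)))}" by blast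
  next
    fix x :: config assume x: "x \<in> {x. range x \<subseteq> {..<m} \<and> (\<forall>u v. Q (\<lambda>(i, j). x (i + u, j + v)))}"
    let ?y = "dec \<circ> x"
    have "?y \<in> Y" unfolding Y_def mem_Collect_eq
    proof (intro allI)
      fix i t
      have r: "row (dec \<circ> (\<lambda>(a, j). x (a + i, j + t))) s = (\<lambda>k. row ?y (s + t) (k + i))" for s
        by (auto simp: row_def)
      have "Q (\<lambda>(a, j). x (a + i, j + t))" using x by blast
      then show "hor_ok (row ?y t) i \<and> ver_ok (row ?y t) (row ?y (t + 1)) i"
        unfolding Q_def r hor_shift ver_shift by (simp add: add.commute)
    qed
    moreover have "x = enc \<circ> ?y"
    proof
      fix p
      have "x p < m" using x by blast
      then show "x p = (enc \<circ> ?y) p" using de(1) by simp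
    qed
    ultimately show "x \<in> X" unfolding X_def by blast
  qed
  have "countable (Y0 n)" if "0 < n" for n
    using derived_Y0[OF that, of 0] cnt[OF that] by (metis countable_image derived.simps(1))
  then have "countable X" unfolding X_def using countable_Y by blast
  have gX: "derived X k = (\<lambda>y. enc \<circ> y) ` derived Y k" for k
    unfolding X_def
  proof (rule derived_homeo[symmetric])
    fix y :: "int \<times> int \<Rightarrow> 's sym" and D :: "(int \<times> int) set" assume y: "y \<in> Y" and D: "finite D"
    show "\<exists>D'. finite D' \<and> (\<forall>y'\<in>Y. agree D' y y' \<longrightarrow> agree D (enc \<circ> y) (enc \<circ> y'))"
      by (rule exI[of _ D]) (use D in \<open>auto simp: agree_def\<close>)
    show "\<exists>D'. finite D' \<and> (\<forall>y'\<in>Y. agree D' (enc \<circ> y) (enc \<circ> y') \<longrightarrow> agree D y y')"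
    proof (intro exI[of _ D] conjI ballI impI)
      fix y' assume y': "y' \<in> Y" "agree D (enc \<circ> y) (enc \<circ> y')"
      show "agree D y y'"
        unfolding agree_def
      proof
        fix p assume "p \<in> D"
        then have "enc (y p) = enc (y' p)" using y'(2) unfolding agree_def comp_apply by blast
        then have "dec (enc (y p)) = dec (enc (y' p))" by (rule arg_cong)
        then show "y p = y' p" unfolding ed[OF Y_in_V[OF y]] ed[OF Y_in_V[OF y'(1)]] .
      qed
    qed (rule D)
  qed simp
  have inV: "L \<in> V" "R \<in> V" "C r0 Init True False \<in> V" using r0 by (auto simp: V_def phases_def)
  have "occurs (seed (enc L) (enc (C r0 Init True False)) (enc R) n) (cb_deriv X k) \<longleftrightarrow>
      derived (runs mstep (src r0, n)) k \<noteq> {}" (is "?o \<longleftrightarrow> _") if n: "0 < n" for n k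
  proof -
    let ?D = "{(-1, 0), (0, 0), (int n - 1, 0), (int n, 0)}"
    let ?z = "\<lambda>(i, t::int). if i < 0 then L else if i < int n then C r0 Init True False else R"
    have Y0: "Y0 n = {y \<in> Y. agree ?D ?z y}" using n by (auto simp: Y0_def agree_def)
    have eq: "enc (y p) = enc s \<longleftrightarrow> y p = s" if "y \<in> Y" "s \<in> V" for y p s
      using ed Y_in_V that by metis
    have oc: "occurs_in (seed (enc L) (enc (C r0 Init True False)) (enc R) n) (enc \<circ> y) \<longleftrightarrow>
      (\<exists>u v. (\<lambda>(i, t). y (i + u, t + v)) \<in> Y0 n)" if y: "y \<in> Y" for y
      unfolding occurs_in_def seed_match[OF n] Y0_def using Y_shift[OF y] eq[OF y] inV by simp
    have "?o \<longleftrightarrow> (\<exists>y\<in>derived Y k. \<exists>u v. (\<lambda>(i, t). y (i + u, t + v)) \<in> Y0 n)"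
    proof -
      have "?o \<longleftrightarrow> (\<exists>y\<in>derived Y k. occurs_in (seed (enc L) (enc (C r0 Init True False)) (enc R) n) (enc \<circ> y))"
        unfolding occurs_def cb_deriv_derived gX by simp
      also have "\<dots> \<longleftrightarrow> (\<exists>y\<in>derived Y k. \<exists>u v. (\<lambda>(i, t). y (i + u, t + v)) \<in> Y0 n)"
        by (intro bex_cong refl oc) (use derived_subset[of Y k] in blast)
      finally show ?thesis .
    qed
    also have "\<dots> \<longleftrightarrow> (\<exists>y\<in>derived Y k. y \<in> Y0 n)"
    proof
      assume "\<exists>y\<in>derived Y k. y \<in> Y0 n"
      then obtain y where "y \<in> derived Y k" "y \<in> Y0 n" by blast
      moreover have "(\<lambda>(i, t). y (i + 0, t + 0)) = y" by auto
      ultimately show "\<exists>y\<in>derived Y k. \<exists>u v. (\<lambda>(i, t). y (i + u, t + v)) \<in> Y0 n" by metis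
    qed (use derived_shift[OF Y_shift] in blast)
    also have "\<dots> \<longleftrightarrow> derived (Y0 n) k \<noteq> {}"
      unfolding Y0 using derived_cylinder[of ?D Y ?z k] derived_subset[of Y k] by auto
    also have "\<dots> \<longleftrightarrow> derived (runs mstep (src r0, n)) k \<noteq> {}"
      using derived_Y0[OF n, of k] by auto
    finally show ?thesis .
  qed
  then show thesis using that[of m X] sft \<open>countable X\<close> X_eq by metis
qed

end

section \<open>Computable functions\<close>

text \<open>\<open>total_rec\<close> speaks about a function on lists of every length. Comparing
  only on lists of length \<open>n\<close> allows functions to be rewritten into readable
  form.\<close>

definition rec_nary :: "nat \<Rightarrow> (nat list \<Rightarrow> nat) \<Rightarrow> bool" where
  "rec_nary n f \<longleftrightarrow> (\<exists>g. total_rec n g \<and> (\<forall>xs. length xs = n \<longrightarrow> g xs = f xs))"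

lemma computable_rec_nary: "computable f \<longleftrightarrow> rec_nary 1 (\<lambda>xs. f (xs ! 0))"
  unfolding computable_def rec_nary_def by (auto simp: length_Suc_conv)

lemma rec_nary_cong: "rec_nary n f \<Longrightarrow> (\<And>xs. length xs = n \<Longrightarrow> f xs = g xs) \<Longrightarrow> rec_nary n g"
  unfolding rec_nary_def by metis

lemma rec_nary_proj: "i < n \<Longrightarrow> rec_nary n (\<lambda>xs. xs ! i)"
  unfolding rec_nary_def using total_rec.proj by blast

lemma rec_nary_comp:
  assumes "rec_nary m f" "\<And>i. i < m \<Longrightarrow> rec_nary n (a i)"
  shows "rec_nary n (\<lambda>xs. f (map (\<lambda>i. a i xs) [0..<m]))"
proof -
  obtain g where g: "total_rec m g" "\<And>xs. length xs = m \<Longrightarrow> g xs = f xs" using assms unfolding rec_nary_def by blast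
  have "\<forall>i. \<exists>h. i < m \<longrightarrow> total_rec n h \<and> (\<forall>xs. length xs = n \<longrightarrow> h xs = a i xs)"
    using assms(2) unfolding rec_nary_def by blast
  then obtain h where h: "\<And>i. i < m \<Longrightarrow> total_rec n (h i)"
     "\<And>i xs. i < m \<Longrightarrow> length xs = n \<Longrightarrow> h i xs = a i xs" by metis
  have "total_rec n (\<lambda>xs. g (map (\<lambda>i. h i xs) [0..<m]))" using total_rec.comp[OF g(1)] h(1) by blast
  moreover have "g (map (\<lambda>i. h i xs) [0..<m]) = f (map (\<lambda>i. a i xs) [0..<m])" if "length xs = n" for xs
  proof -
    have "map (\<lambda>i. h i xs) [0..<m] = map (\<lambda>i. a i xs) [0..<m]" using h(2)[OF _ that] by simp
    moreover have "length (map (\<lambda>i. h i xs) [0..<m]) = m" by simp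
    ultimately show ?thesis using g(2) by metis
  qed
  ultimately show ?thesis unfolding rec_nary_def by blast
qed

lemma rec_nary_comp1: "computable f \<Longrightarrow> rec_nary n a \<Longrightarrow> rec_nary n (\<lambda>xs. f (a xs))"
  using rec_nary_comp[of 1 "\<lambda>xs. f (xs ! 0)" n "\<lambda>_. a"] by (simp add: computable_rec_nary)

lemma rec_nary_comp2: "rec_nary 2 (\<lambda>xs. F (xs ! 0) (xs ! 1)) \<Longrightarrow> rec_nary n a \<Longrightarrow> rec_nary n b \<Longrightarrow> rec_nary n (\<lambda>xs. F (a xs) (b xs))"
  using rec_nary_comp[of 2 "\<lambda>xs. F (xs ! 0) (xs ! 1)" n "\<lambda>i. if i = 0 then a else b"]
  by (simp add: numeral_2_eq_2 upt_rec)

lemma rec_nary_prim: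
  assumes "rec_nary n g" "rec_nary (Suc (Suc n)) h"
  shows "rec_nary (Suc n) (\<lambda>xs. rec_nat (g (tl xs)) (\<lambda>y r. h (y # r # tl xs)) (hd xs))"
proof -
  obtain g' h' where g: "total_rec n g'" "\<And>xs. length xs = n \<Longrightarrow> g' xs = g xs"
    and h: "total_rec (Suc (Suc n)) h'" "\<And>xs. length xs = Suc (Suc n) \<Longrightarrow> h' xs = h xs"
    using assms unfolding rec_nary_def by blast
  show ?thesis unfolding rec_nary_def
    by (rule exI, rule conjI[OF total_rec.prim[OF g(1) h(1)]]) (simp add: g(2) h(2))
qed

lemma rec_nary_mu:
  assumes "rec_nary (Suc n) g" "\<And>xs. length xs = n \<Longrightarrow> \<exists>y. g (y # xs) = 0"
  shows "rec_nary n (\<lambda>xs. LEAST y. g (y # xs) = 0)"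
proof -
  obtain g' where g: "total_rec (Suc n) g'" "\<And>xs. length xs = Suc n \<Longrightarrow> g' xs = g xs"
    using assms unfolding rec_nary_def by blast
  have "total_rec n (\<lambda>xs. LEAST y. g' (y # xs) = 0)"
    by (rule total_rec.mu[OF g(1)]) (use assms(2) g(2) in auto)
  then show ?thesis unfolding rec_nary_def using g(2) by (intro exI conjI) auto
qed

named_theorems computable_intros

lemma computable_id [computable_intros]: "computable (\<lambda>x. x)"
  unfolding computable_rec_nary by (rule rec_nary_proj) simp

lemma computable_comp: "computable f \<Longrightarrow> computable a \<Longrightarrow> computable (\<lambda>x. f (a x))"
  by (subst computable_rec_nary) (rule rec_nary_comp1, simp_all add: computable_rec_nary)

lemma computable_comp2: "rec_nary 2 (\<lambda>xs. F (xs ! 0) (xs ! 1)) \<Longrightarrow> computable a \<Longrightarrow> computable b \<Longrightarrow>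
    computable (\<lambda>x. F (a x) (b x))"
  by (subst computable_rec_nary) (rule rec_nary_comp2, simp_all add: computable_rec_nary)

lemma computable_Suc0: "computable Suc"
  unfolding computable_def using total_rec.succ by force

lemma computable_Suc [computable_intros]: "computable a \<Longrightarrow> computable (\<lambda>x. Suc (a x))"
  by (rule computable_comp[OF computable_Suc0])

lemma rec_nary_const: "rec_nary n (\<lambda>_. c)"
proof (induction c)
  case 0 show ?case unfolding rec_nary_def using total_rec.zero by blast
next
  case (Suc c) then show ?case using rec_nary_comp1[OF computable_Suc0] by blast
qed

lemma computable_const [computable_intros]: "computable (\<lambda>_. c)"
  unfolding computable_rec_nary by (rule rec_nary_const)

lemma length2: "length xs = 2 \<Longrightarrow> tl xs = [xs ! 1] \<and> hd xs = xs ! 0"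
  by (cases xs; cases "tl xs") (auto simp: numeral_2_eq_2)

lemma rec_nary_add: "rec_nary 2 (\<lambda>xs. xs ! 0 + xs ! 1)"
proof -
  have "rec_nary (Suc 1) (\<lambda>xs. rec_nat (tl xs ! 0) (\<lambda>y r. Suc ((y # r # tl xs) ! 1)) (hd xs))"
    by (rule rec_nary_prim[of 1 "\<lambda>xs. xs ! 0" "\<lambda>xs. Suc (xs ! 1)"]) (auto intro!: rec_nary_proj rec_nary_comp1[OF computable_Suc0])
  moreover have "rec_nat b (\<lambda>y r. Suc r) a = a + b" for a b by (induction a) auto
  ultimately show ?thesis by (auto elim!: rec_nary_cong dest: length2 simp: numeral_2_eq_2[symmetric])
qed

lemma computable_add [computable_intros]: "computable a \<Longrightarrow> computable b \<Longrightarrow> computable (\<lambda>x. a x + b x)"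
  by (rule computable_comp2[OF rec_nary_add])

lemma rec_nary_mult: "rec_nary 2 (\<lambda>xs. xs ! 0 * xs ! 1)"
proof -
  have "rec_nary (Suc 1) (\<lambda>xs. rec_nat 0 (\<lambda>y r. (y # r # tl xs) ! 1 + (y # r # tl xs) ! 2) (hd xs))"
    by (rule rec_nary_prim[of 1 "\<lambda>xs. 0" "\<lambda>xs. xs ! 1 + xs ! 2"]) (auto intro!: rec_nary_proj rec_nary_comp2[OF rec_nary_add] rec_nary_const)
  moreover have "rec_nat 0 (\<lambda>y r. r + b) a = a * b" for a b :: nat by (induction a) auto
  ultimately show ?thesis by (auto elim!: rec_nary_cong dest: length2 simp: numeral_2_eq_2[symmetric])
qed

lemma computable_mult [computable_intros]: "computable a \<Longrightarrow> computable b \<Longrightarrow> computable (\<lambda>x. a x * b x)"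
  by (rule computable_comp2[OF rec_nary_mult])

lemma rec_nary_pred1: "rec_nary 1 (\<lambda>xs. xs ! 0 - 1)"
proof -
  have "rec_nary (Suc 0) (\<lambda>xs. rec_nat 0 (\<lambda>y r. (y # r # tl xs) ! 0) (hd xs))"
    by (rule rec_nary_prim[of 0 "\<lambda>xs. 0" "\<lambda>xs. xs ! 0"]) (auto intro!: rec_nary_proj rec_nary_const)
  moreover have "rec_nat 0 (\<lambda>y r. y) a = a - 1" for a :: nat by (cases a) auto
  ultimately show ?thesis by (auto elim!: rec_nary_cong simp: length_Suc_conv)
qed

lemma computable_pred0: "computable (\<lambda>x. x - 1)"
  unfolding computable_rec_nary by (rule rec_nary_pred1)

lemma rec_nary_sub: "rec_nary 2 (\<lambda>xs. xs ! 1 - xs ! 0)"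
proof -
  have "rec_nary (Suc 1) (\<lambda>xs. rec_nat (tl xs ! 0) (\<lambda>y r. (y # r # tl xs) ! 1 - 1) (hd xs))"
    by (rule rec_nary_prim[of 1 "\<lambda>xs. xs ! 0" "\<lambda>xs. xs ! 1 - 1"]; intro rec_nary_proj rec_nary_comp1[OF computable_pred0]; simp)
  moreover have "rec_nat b (\<lambda>y r. r - 1) a = b - a" for a b :: nat by (induction a) auto
  ultimately show ?thesis by (auto elim!: rec_nary_cong dest: length2 simp: numeral_2_eq_2[symmetric])
qed

lemma computable_sub [computable_intros]: "computable a \<Longrightarrow> computable b \<Longrightarrow> computable (\<lambda>x. a x - b x)"
  by (rule computable_comp2[OF rec_nary_sub, of b a])

lemma computable_triangle0: "computable triangle"
proof -
  have "rec_nary (Suc 0) (\<lambda>xs. rec_nat 0 (\<lambda>y r. (y # r # tl xs) ! 1 + Suc ((y # r # tl xs) ! 0)) (hd xs))"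
    by (rule rec_nary_prim[of 0 "\<lambda>xs. 0" "\<lambda>xs. xs ! 1 + Suc (xs ! 0)"])
      (auto intro!: rec_nary_proj rec_nary_const rec_nary_comp2[OF rec_nary_add] rec_nary_comp1[OF computable_Suc0])
  moreover have "rec_nat 0 (\<lambda>y r. r + Suc y) a = triangle a" for a by (induction a) auto
  ultimately show ?thesis unfolding computable_rec_nary by (auto elim!: rec_nary_cong simp: length_Suc_conv)
qed

section \<open>Cantor pairing and its projections\<close>

definition pr :: "nat \<Rightarrow> nat \<Rightarrow> nat" where "pr x y = prod_encode (x, y)"
definition pi1 :: "nat \<Rightarrow> nat" where "pi1 z = fst (prod_decode z)"
definition pi2 :: "nat \<Rightarrow> nat" where "pi2 z = snd (prod_decode z)"

lemma pi_pr [simp]: "pi1 (pr x y) = x" "pi2 (pr x y) = y" by (simp_all add: pi1_def pi2_def pr_def)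
lemma pr_pi [simp]: "pr (pi1 z) (pi2 z) = z" by (simp add: pi1_def pi2_def pr_def)
lemma rec_nary_pr: "rec_nary n a \<Longrightarrow> rec_nary n b \<Longrightarrow> rec_nary n (\<lambda>xs. pr (a xs) (b xs))"
  unfolding pr_def prod_encode_def prod.case
  by (intro rec_nary_comp2[OF rec_nary_add] rec_nary_comp1[OF computable_triangle0])

lemma computable_pr [computable_intros]: "computable a \<Longrightarrow> computable b \<Longrightarrow> computable (\<lambda>x. pr (a x) (b x))"
  unfolding computable_rec_nary by (rule rec_nary_pr)

lemma triangle_mono: "m \<le> n \<Longrightarrow> triangle m \<le> triangle n"
  by (induction n rule: dec_induct) auto

lemma pi_triangle: "z = triangle (pi1 z + pi2 z) + pi1 z"
  using pr_pi[of z] by (simp add: pr_def prod_encode_def)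

text \<open>\<open>pi1 z + pi2 z\<close> is the index of the diagonal on which \<open>z\<close> lies
  in Cantor's enumeration. Once it is found by search, both projections are differences.\<close>

lemma triangle_root: "(LEAST k. z < triangle (Suc k)) = pi1 z + pi2 z"
proof -
  define x y where "x = pi1 z" and "y = pi2 z"
  have z: "z = triangle (x + y) + x" unfolding x_def y_def by (rule pi_triangle)
  show ?thesis unfolding x_def[symmetric] y_def[symmetric]
  proof (rule Least_equality)
    show "z < triangle (Suc (x + y))" using z by simp
    fix k assume "z < triangle (Suc k)"
    then have "\<not> Suc k \<le> x + y" using z triangle_mono[of "Suc k" "x + y"] by linarith
    then show "x + y \<le> k" by simp
  qed
qed

lemma computable_root: "computable (\<lambda>z. pi1 z + pi2 z)"
proof -
  have "rec_nary 1 (\<lambda>xs. LEAST y. (\<lambda>ys. Suc (ys ! 1) - triangle (Suc (ys ! 0))) (y # xs) = 0)"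
  proof (rule rec_nary_mu)
    show "rec_nary (Suc 1) (\<lambda>ys. Suc (ys ! 1) - triangle (Suc (ys ! 0)))"
      by (intro rec_nary_comp2[OF rec_nary_sub, of _ "\<lambda>ys. triangle (Suc (ys ! 0))" "\<lambda>ys. Suc (ys ! 1)"]
          rec_nary_comp1[OF computable_triangle0] rec_nary_comp1[OF computable_Suc0] rec_nary_proj) auto
    fix xs :: "nat list"
    have "n \<le> triangle n" for n by (induction n) auto
    then have "Suc (xs ! 0) \<le> triangle (Suc (xs ! 0))" .
    then show "\<exists>y. Suc ((y # xs) ! 1) - triangle (Suc ((y # xs) ! 0)) = 0"
      by (intro exI[of _ "xs ! 0"]) simp
  qed
  then show ?thesis unfolding computable_rec_nary triangle_root[symmetric]
    by (simp del: triangle_Suc add: Suc_le_eq)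
qed

lemma computable_pi1 [computable_intros]: "computable a \<Longrightarrow> computable (\<lambda>x. pi1 (a x))"
proof (rule computable_comp[of pi1])
  have "pi1 z = z - triangle (pi1 z + pi2 z)" for z
    using pi_triangle[of z] by simp
  moreover have "computable (\<lambda>z. z - triangle (pi1 z + pi2 z))"
    by (intro computable_sub computable_id computable_comp[OF computable_triangle0] computable_root)
  ultimately show "computable pi1" by presburger
qed

lemma computable_pi2 [computable_intros]: "computable a \<Longrightarrow> computable (\<lambda>x. pi2 (a x))"
proof (rule computable_comp[of pi2])
  have "pi2 z = pi1 z + pi2 z - pi1 z" for z by simp
  moreover have "computable (\<lambda>z. pi1 z + pi2 z - pi1 z)"
    by (intro computable_sub computable_root computable_pi1 computable_id)
  ultimately show "computable pi2" by presburger
qed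

text \<open>As a unary function the step sees parameter, counter and accumulator packed as
  \<open>pr x (pr y r)\<close>.\<close>

lemma computable_rec [computable_intros]:
  assumes "computable a" "computable b" "computable (\<lambda>z. h (pi1 z) (pi1 (pi2 z)) (pi2 (pi2 z)))"
  shows "computable (\<lambda>x. rec_nat (a x) (\<lambda>y r. h x y r) (b x))"
proof -
  have "rec_nary (Suc (Suc 1)) (\<lambda>xs. pr (xs ! 2) (pr (xs ! 0) (xs ! 1)))"
    by (intro rec_nary_pr rec_nary_proj; simp)
  from rec_nary_comp1[OF assms(3) this]
  have h: "rec_nary (Suc (Suc 1)) (\<lambda>xs. h (xs ! 2) (xs ! 0) (xs ! 1))" by simp
  have a: "rec_nary 1 (\<lambda>xs. a (xs ! 0))" using assms(1) unfolding computable_rec_nary .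
  from rec_nary_prim[OF a h] have "rec_nary 2 (\<lambda>xs. rec_nat (a (xs ! 1)) (\<lambda>y r. h (xs ! 1) y r) (xs ! 0))"
    by (auto elim!: rec_nary_cong dest: length2 simp: numeral_2_eq_2[symmetric])
  from computable_comp2[of "\<lambda>u v. rec_nat (a v) (\<lambda>y r. h v y r) u", OF this assms(2) computable_id]
  show ?thesis .
qed

lemma computable_least:
  assumes "computable (\<lambda>z. g (pi1 z) (pi2 z))" "\<And>x. \<exists>y. g x y = 0"
  shows "computable (\<lambda>x. LEAST y. g x y = 0)"
proof -
  have "rec_nary (Suc 1) (\<lambda>ys. pr (ys ! 1) (ys ! 0))" by (intro rec_nary_pr rec_nary_proj; simp)
  from rec_nary_comp1[OF assms(1) this] have g: "rec_nary (Suc 1) (\<lambda>ys. g (ys ! 1) (ys ! 0))" by simp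
  have "rec_nary 1 (\<lambda>xs. LEAST y. (\<lambda>ys. g (ys ! 1) (ys ! 0)) (y # xs) = 0)"
    by (rule rec_nary_mu[OF g]) (use assms(2) in auto)
  then show ?thesis unfolding computable_rec_nary by simp
qed

section \<open>Decidable predicates\<close>

definition decidable :: "(nat \<Rightarrow> bool) \<Rightarrow> bool" where
  "decidable P \<longleftrightarrow> computable (\<lambda>x. if P x then 1 else 0)"

lemma recursive_set_decidable: "recursive_set A \<longleftrightarrow> decidable (\<lambda>x. x \<in> A)"
  by (simp add: recursive_set_def decidable_def)

lemma decidable_eq0: "computable a \<Longrightarrow> decidable (\<lambda>x. a x = 0)"
proof -
  assume "computable a"
  then have "computable (\<lambda>x. 1 - a x)" by (intro computable_intros)
  moreover have "1 - a x = (if a x = 0 then 1 else 0)" for x by simp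
  ultimately show ?thesis by (simp add: decidable_def)
qed

lemma decidable_not [computable_intros]: "decidable P \<Longrightarrow> decidable (\<lambda>x. \<not> P x)"
proof -
  assume "decidable P"
  then have "computable (\<lambda>x. 1 - (if P x then 1 else 0))"
    unfolding decidable_def by (intro computable_sub computable_const)
  moreover have "1 - (if P x then 1 else 0) = (if \<not> P x then 1 else (0::nat))" for x by simp
  ultimately show ?thesis unfolding decidable_def by (simp only:)
qed

lemma decidable_le [computable_intros]: "computable a \<Longrightarrow> computable b \<Longrightarrow> decidable (\<lambda>x. a x \<le> b x)"
  using decidable_eq0[OF computable_sub, of a b] by simp

lemma decidable_less [computable_intros]: "computable a \<Longrightarrow> computable b \<Longrightarrow> decidable (\<lambda>x. a x < b x)"
  using decidable_le[of "\<lambda>x. Suc (a x)" b] by (simp add: Suc_le_eq computable_Suc)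

lemma decidable_conj [computable_intros]: "decidable P \<Longrightarrow> decidable Q \<Longrightarrow> decidable (\<lambda>x. P x \<and> Q x)"
proof -
  assume "decidable P" "decidable Q"
  then have "computable (\<lambda>x. (if P x then 1 else 0) * (if Q x then 1 else 0))"
    unfolding decidable_def by (intro computable_mult)
  moreover have "(if P x then 1 else 0) * (if Q x then 1 else 0) = (if P x \<and> Q x then 1 else 0::nat)" for x by simp
  ultimately show ?thesis unfolding decidable_def by simp
qed

lemma decidable_disj [computable_intros]: "decidable P \<Longrightarrow> decidable Q \<Longrightarrow> decidable (\<lambda>x. P x \<or> Q x)"
  using decidable_not[OF decidable_conj[OF decidable_not decidable_not]] by simp

lemma decidable_imp [computable_intros]: "decidable P \<Longrightarrow> decidable Q \<Longrightarrow> decidable (\<lambda>x. P x \<longrightarrow> Q x)"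
  using decidable_disj[OF decidable_not] by simp

lemma decidable_eq [computable_intros]: "computable a \<Longrightarrow> computable b \<Longrightarrow> decidable (\<lambda>x. a x = b x)"
  using decidable_conj[OF decidable_le decidable_le, of a b b a] by (simp add: order_eq_iff)

lemma decidable_const: "decidable (\<lambda>_. c)"
  unfolding decidable_def by (rule computable_const)

lemma decidable_comp: "decidable P \<Longrightarrow> computable a \<Longrightarrow> decidable (\<lambda>x. P (a x))"
  unfolding decidable_def by (rule computable_comp)

lemma computable_if [computable_intros]:
  assumes "decidable P" "computable a" "computable b"
  shows "computable (\<lambda>x. if P x then a x else b x)"
proof -
  have "computable (\<lambda>x. (if P x then 1 else 0) * a x + (if \<not> P x then 1 else 0) * b x)"
    using assms(1) decidable_not[OF assms(1)] assms(2,3) unfolding decidable_def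
    by (intro computable_add computable_mult)
  moreover have "(if P x then 1 else 0) * a x + (if \<not> P x then 1 else 0) * b x = (if P x then a x else b x)" for x by simp
  ultimately show ?thesis by simp
qed

lemma decidable_all [computable_intros]:
  assumes "decidable (\<lambda>z. P (pi1 z) (pi2 z))" "computable b"
  shows "decidable (\<lambda>x. \<forall>y<b x. P x y)"
proof -
  have "rec_nat 1 (\<lambda>y r. if P x y then r else 0) n = (if \<forall>y<n. P x y then 1 else (0::nat))" for x n
    by (induction n) (auto simp: less_Suc_eq)
  moreover have "computable (\<lambda>x. rec_nat 1 (\<lambda>y r. if P x y then r else 0) (b x))"
  proof (intro computable_intros assms(2))
    show "decidable (\<lambda>z. P (pi1 z) (pi1 (pi2 z)))"
      using decidable_comp[OF assms(1), of "\<lambda>z. pr (pi1 z) (pi1 (pi2 z))"] by (simp add: computable_intros)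
  qed
  ultimately show ?thesis by (simp add: decidable_def)
qed

lemma decidable_ex [computable_intros]:
  assumes "decidable (\<lambda>z. P (pi1 z) (pi2 z))" "computable b"
  shows "decidable (\<lambda>x. \<exists>y<b x. P x y)"
  using decidable_not[OF decidable_all[of "\<lambda>x y. \<not> P x y" b]] assms by (simp add: computable_intros)

lemma computable_Least:
  assumes "decidable (\<lambda>z. P (pi1 z) (pi2 z))" "\<And>x. \<exists>y. P x y"
  shows "computable (\<lambda>x. LEAST y. P x y)"
proof -
  have "computable (\<lambda>x. LEAST y. (if \<not> P x y then 1 else 0::nat) = 0)"
    by (rule computable_least) (use assms decidable_not[OF assms(1)] in \<open>auto simp: decidable_def\<close>)
  moreover have "((if \<not> P x y then 1 else 0::nat) = 0) = P x y" for x y by simp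
  ultimately show ?thesis by (simp only:)
qed

lemma computable_div [computable_intros]: "computable a \<Longrightarrow> computable b \<Longrightarrow> computable (\<lambda>x. a x div b x)"
proof -
  assume a: "computable a" and b: "computable b"
  \<comment> \<open>The disjunct \<open>b x = 0\<close> makes the search total and returns 0 there,
    the value of a division by zero in HOL.\<close>
  have "computable (\<lambda>x. LEAST q. b x = 0 \<or> a x < Suc q * b x)"
  proof (rule computable_Least)
    show "decidable (\<lambda>z. b (pi1 z) = 0 \<or> a (pi1 z) < Suc (pi2 z) * b (pi1 z))"
      by (intro computable_intros computable_comp[OF a] computable_comp[OF b])
    show "\<exists>q. b x = 0 \<or> a x < Suc q * b x" for x
      by (cases "b x") (auto intro!: exI[of _ "a x"])
  qed
  moreover have "(LEAST q. b x = 0 \<or> a x < Suc q * b x) = a x div b x" for x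
  proof (cases "b x = 0")
    case False
    show ?thesis
    proof (rule Least_equality)
      show "b x = 0 \<or> a x < Suc (a x div b x) * b x"
        using False by (metis dividend_less_div_times mult_Suc not_gr_zero)
      fix q assume "b x = 0 \<or> a x < Suc q * b x"
      then have "a x div b x < Suc q" using False by (simp add: div_less_iff_less_mult)
      then show "a x div b x \<le> q" by simp
    qed
  qed (simp add: Least_eq_0)
  ultimately show ?thesis by (simp only:)
qed

lemma computable_mod [computable_intros]: "computable a \<Longrightarrow> computable b \<Longrightarrow> computable (\<lambda>x. a x mod b x)"
proof -
  assume "computable a" "computable b"
  then have "computable (\<lambda>x. a x - a x div b x * b x)" by (intro computable_intros)
  then show ?thesis by (simp add: minus_div_mult_eq_mod)
qed

lemma decidable_dvd [computable_intros]: "computable a \<Longrightarrow> computable b \<Longrightarrow> decidable (\<lambda>x. a x dvd b x)"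
  unfolding dvd_eq_mod_eq_0 by (intro computable_intros)

lemma computable_power [computable_intros]: "computable a \<Longrightarrow> computable b \<Longrightarrow> computable (\<lambda>x. a x ^ b x)"
proof -
  assume a: "computable a" and b: "computable b"
  have "rec_nat 1 (\<lambda>y r. a x * r) n = a x ^ n" for x n by (induction n) auto
  moreover have "computable (\<lambda>x. rec_nat 1 (\<lambda>y r. a x * r) (b x))"
    by (intro computable_intros b computable_comp[OF a])
  ultimately show ?thesis by simp
qed

section \<open>Computable operations on codes of lists\<close>

definition lhd :: "nat \<Rightarrow> nat" where "lhd c = pi1 (c - 1)"
definition ltl :: "nat \<Rightarrow> nat" where "ltl c = pi2 (c - 1)"
definition ldrop :: "nat \<Rightarrow> nat \<Rightarrow> nat" where "ldrop i c = rec_nat c (\<lambda>_ r. ltl r) i"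
definition lnth :: "nat \<Rightarrow> nat \<Rightarrow> nat" where "lnth c i = lhd (ldrop i c)"
definition llen :: "nat \<Rightarrow> nat" where "llen c = (LEAST i. ldrop i c = 0)"

lemma ltl_decode: "list_decode (ltl c) = tl (list_decode c)"
proof (cases c)
  case 0
  have "pr 0 0 = 0" by (simp add: pr_def prod_encode_def)
  then have "pi2 0 = 0" by (metis pi_pr(2))
  then show ?thesis using 0 by (simp add: ltl_def)
next
  case (Suc n) then show ?thesis by (simp add: ltl_def pi2_def split: prod.split)
qed

lemma lhd_decode: "list_decode c \<noteq> [] \<Longrightarrow> lhd c = hd (list_decode c)"
  by (cases c) (auto simp: lhd_def pi1_def split: prod.split)

lemma ldrop_decode: "list_decode (ldrop i c) = drop i (list_decode c)"
  by (induction i) (simp_all add: ldrop_def ltl_decode drop_Suc tl_drop)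

lemma list_decode_Nil: "list_decode c = [] \<longleftrightarrow> c = 0"
  by (cases c) (auto split: prod.split)

lemma llen_eq: "llen c = length (list_decode c)"
  unfolding llen_def list_decode_Nil[symmetric] ldrop_decode
  by (rule Least_equality) auto

lemma lnth_eq: "i < length (list_decode c) \<Longrightarrow> lnth c i = list_decode c ! i"
  unfolding lnth_def by (subst lhd_decode) (auto simp: ldrop_decode hd_drop_conv_nth)

lemma computable_ltl [computable_intros]: "computable a \<Longrightarrow> computable (\<lambda>x. ltl (a x))"
  unfolding ltl_def by (intro computable_intros)

lemma computable_ldrop [computable_intros]: "computable i \<Longrightarrow> computable a \<Longrightarrow> computable (\<lambda>x. ldrop (i x) (a x))"
  unfolding ldrop_def by (intro computable_intros)

lemma computable_lnth [computable_intros]: "computable i \<Longrightarrow> computable a \<Longrightarrow> computable (\<lambda>x. lnth (a x) (i x))"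
  unfolding lnth_def lhd_def by (intro computable_intros)

lemma computable_llen [computable_intros]: "computable a \<Longrightarrow> computable (\<lambda>x. llen (a x))"
proof (rule computable_comp[of llen])
  show "computable llen"
    unfolding llen_def
  proof (rule computable_Least)
    show "\<exists>i. ldrop i c = 0" for c
      by (rule exI[of _ "length (list_decode c)"]) (simp add: list_decode_Nil[symmetric] ldrop_decode)
  qed (intro computable_intros)
qed

definition lcons :: "nat \<Rightarrow> nat \<Rightarrow> nat" where "lcons a c = Suc (pr a c)"

lemma lcons_decode [simp]: "list_decode (lcons a c) = a # list_decode c"
  by (simp add: lcons_def pr_def)

lemma computable_lcons [computable_intros]: "computable a \<Longrightarrow> computable b \<Longrightarrow> computable (\<lambda>x. lcons (a x) (b x))"
  unfolding lcons_def by (intro computable_intros)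

text \<open>The entries of \<open>a\<close> are put in front of \<open>b\<close> from the last one
  to the first, hence the index \<open>llen a - Suc i\<close>.\<close>

definition lapp :: "nat \<Rightarrow> nat \<Rightarrow> nat" where
  "lapp a b = rec_nat b (\<lambda>i r. lcons (lnth a (llen a - Suc i)) r) (llen a)"

lemma lapp_decode: "list_decode (lapp a b) = list_decode a @ list_decode b"
proof -
  have "n \<le> llen a \<Longrightarrow> list_decode (rec_nat b (\<lambda>i r. lcons (lnth a (llen a - Suc i)) r) n)
     = drop (llen a - n) (list_decode a) @ list_decode b" for n
  proof (induction n)
    case (Suc n)
    have "drop (llen a - Suc n) (list_decode a) = list_decode a ! (llen a - Suc n) # drop (llen a - n) (list_decode a)"
      using Suc.prems by (subst Cons_nth_drop_Suc[symmetric]) (auto simp: llen_eq Suc_diff_Suc)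
    then show ?case using Suc by (simp add: lnth_eq llen_eq)
  qed (simp add: llen_eq)
  from this[of "llen a"] show ?thesis by (simp add: lapp_def)
qed

lemma computable_lapp [computable_intros]: "computable a \<Longrightarrow> computable b \<Longrightarrow> computable (\<lambda>x. lapp (a x) (b x))"
proof -
  assume a: "computable a" and b: "computable b"
  show ?thesis unfolding lapp_def by (intro computable_intros a b computable_comp[OF a])
qed

section \<open>A normal form for the arithmetical hierarchy\<close>

definition arith_pred :: "bool \<Rightarrow> nat \<Rightarrow> (nat \<Rightarrow> bool) \<Rightarrow> bool" where
  "arith_pred b n P \<longleftrightarrow> {x. P x} \<in> arith_class b n"

lemma arith_pred_0: "arith_pred b 0 P \<longleftrightarrow> decidable P"
  by (simp add: arith_pred_def recursive_set_decidable)

lemma arith_pred_True_Suc: "arith_pred True (Suc n) P \<longleftrightarrow> (\<exists>Q. arith_pred False n Q \<and> (\<forall>x. P x \<longleftrightarrow> (\<exists>y. Q (pr x y))))"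
proof
  assume "arith_pred True (Suc n) P"
  then obtain B where B: "B \<in> arith_class False n" "{x. P x} = {x. \<exists>y. prod_encode (x, y) \<in> B}"
    unfolding arith_pred_def by auto
  then show "\<exists>Q. arith_pred False n Q \<and> (\<forall>x. P x \<longleftrightarrow> (\<exists>y. Q (pr x y)))"
    by (intro exI[of _ "\<lambda>z. z \<in> B"]) (auto simp: arith_pred_def pr_def)
next
  assume "\<exists>Q. arith_pred False n Q \<and> (\<forall>x. P x \<longleftrightarrow> (\<exists>y. Q (pr x y)))"
  then obtain Q where "arith_pred False n Q" "\<forall>x. P x \<longleftrightarrow> (\<exists>y. Q (pr x y))" by blast
  then show "arith_pred True (Suc n) P"
    unfolding arith_pred_def by (auto simp: pr_def intro!: bexI[of _ "{x. Q x}"])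
qed

lemma arith_pred_False_Suc: "arith_pred False (Suc n) P \<longleftrightarrow> (\<exists>Q. arith_pred True n Q \<and> (\<forall>x. P x \<longleftrightarrow> (\<forall>y. Q (pr x y))))"
proof
  assume "arith_pred False (Suc n) P"
  then obtain B where B: "B \<in> arith_class True n" "{x. P x} = {x. \<forall>y. prod_encode (x, y) \<in> B}"
    unfolding arith_pred_def by auto
  then show "\<exists>Q. arith_pred True n Q \<and> (\<forall>x. P x \<longleftrightarrow> (\<forall>y. Q (pr x y)))"
    by (intro exI[of _ "\<lambda>z. z \<in> B"]) (auto simp: arith_pred_def pr_def)
next
  assume "\<exists>Q. arith_pred True n Q \<and> (\<forall>x. P x \<longleftrightarrow> (\<forall>y. Q (pr x y)))"
  then obtain Q where "arith_pred True n Q" "\<forall>x. P x \<longleftrightarrow> (\<forall>y. Q (pr x y))" by blast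
  then show "arith_pred False (Suc n) P"
    unfolding arith_pred_def by (auto simp: pr_def intro!: bexI[of _ "{x. Q x}"])
qed

lemma arith_pred_not: "arith_pred b n P \<Longrightarrow> arith_pred (\<not> b) n (\<lambda>x. \<not> P x)"
proof (induction n arbitrary: b P)
  case 0 then show ?case unfolding arith_pred_0 by (rule decidable_not)
next
  case (Suc n)
  show ?case
  proof (cases b)
    case True
    then obtain Q where "arith_pred False n Q" "\<forall>x. P x \<longleftrightarrow> (\<exists>y. Q (pr x y))" using Suc.prems arith_pred_True_Suc by auto
    then show ?thesis using True Suc.IH[of False Q] arith_pred_False_Suc by auto
  next
    case False
    then obtain Q where "arith_pred True n Q" "\<forall>x. P x \<longleftrightarrow> (\<forall>y. Q (pr x y))" using Suc.prems arith_pred_False_Suc by auto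
    then show ?thesis using False Suc.IH[of True Q] arith_pred_True_Suc by auto
  qed
qed

lemma arith_pred_comp: "arith_pred b n P \<Longrightarrow> computable f \<Longrightarrow> arith_pred b n (\<lambda>x. P (f x))"
proof (induction n arbitrary: b P f)
  case 0 then show ?case unfolding arith_pred_0 by (rule decidable_comp)
next
  case (Suc n)
  have c: "computable (\<lambda>z. pr (f (pi1 z)) (pi2 z))"
    by (intro computable_intros computable_comp[OF Suc.prems(2)])
  show ?case
  proof (cases b)
    case True
    then obtain Q where Q: "arith_pred False n Q" "\<forall>x. P x \<longleftrightarrow> (\<exists>y. Q (pr x y))" using Suc.prems arith_pred_True_Suc by auto
    have "\<forall>x. P (f x) \<longleftrightarrow> (\<exists>y. Q (pr (f (pi1 (pr x y))) (pi2 (pr x y))))" using Q(2) by simp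
    then have "arith_pred True (Suc n) (\<lambda>x. P (f x))" using Suc.IH[OF Q(1) c] unfolding arith_pred_True_Suc by blast
    then show ?thesis using True by simp
  next
    case False
    then obtain Q where Q: "arith_pred True n Q" "\<forall>x. P x \<longleftrightarrow> (\<forall>y. Q (pr x y))" using Suc.prems arith_pred_False_Suc by auto
    have "\<forall>x. P (f x) \<longleftrightarrow> (\<forall>y. Q (pr (f (pi1 (pr x y))) (pi2 (pr x y))))" using Q(2) by simp
    then have "arith_pred False (Suc n) (\<lambda>x. P (f x))" using Suc.IH[OF Q(1) c] unfolding arith_pred_False_Suc by blast
    then show ?thesis using False by simp
  qed
qed

lemma arith_pred_dummy: "arith_pred b n P \<Longrightarrow> arith_pred (\<not> b) (Suc n) P"
proof -
  assume P: "arith_pred b n P"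
  have "arith_pred b n (\<lambda>z. P (pi1 z))" by (rule arith_pred_comp[OF P]) (intro computable_intros)
  then show ?thesis by (cases b) (auto simp: arith_pred_True_Suc arith_pred_False_Suc intro!: exI[of _ "\<lambda>z. P (pi1 z)"])
qed

lemma arith_pred_Suc_same: "arith_pred b n P \<Longrightarrow> arith_pred b (Suc n) P"
proof (induction n arbitrary: b P)
  case 0
  then show ?case using arith_pred_dummy[of "\<not> b" 0 P] by (simp add: arith_pred_0)
next
  case (Suc n)
  show ?case
  proof (cases b)
    case True
    then have b: "b = True" by simp
    show ?thesis using Suc.prems Suc.IH[of False] unfolding b arith_pred_True_Suc[of n] arith_pred_True_Suc[of "Suc n"] by blast
  next
    case False
    then have b: "b = False" by simp
    show ?thesis using Suc.prems Suc.IH[of True] unfolding b arith_pred_False_Suc[of n] arith_pred_False_Suc[of "Suc n"] by blast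
  qed
qed

lemma arith_pred_Suc: "arith_pred b n P \<Longrightarrow> arith_pred b' (Suc n) P"
  using arith_pred_dummy[of b n P] arith_pred_Suc_same[of b n P] by (cases "b' = b") auto

lemma arith_pred_dec: "decidable P \<Longrightarrow> arith_pred b n P"
  by (induction n arbitrary: b) (auto simp: arith_pred_0 intro: arith_pred_Suc)

lemma arith_pred_conj: "arith_pred b n P \<Longrightarrow> arith_pred b n Q \<Longrightarrow> arith_pred b n (\<lambda>x. P x \<and> Q x)"
proof (induction n arbitrary: b P Q)
  case 0 then show ?case unfolding arith_pred_0 by (rule decidable_conj)
next
  case (Suc n)
  show ?case
  proof (cases b)
    case True
    then obtain P' Q' where P: "arith_pred False n P'" "\<And>x. P x \<longleftrightarrow> (\<exists>y. P' (pr x y))"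
      and Q: "arith_pred False n Q'" "\<And>x. Q x \<longleftrightarrow> (\<exists>y. Q' (pr x y))"
      using Suc.prems arith_pred_True_Suc by auto
    let ?f = "\<lambda>z. pr (pi1 z) (pi1 (pi2 z))" and ?g = "\<lambda>z. pr (pi1 z) (pi2 (pi2 z))"
    have "arith_pred False n (\<lambda>z. P' (?f z) \<and> Q' (?g z))"
    proof (rule Suc.IH)
      show "arith_pred False n (\<lambda>z. P' (?f z))" by (rule arith_pred_comp[OF P(1), of ?f]) (intro computable_intros)
      show "arith_pred False n (\<lambda>z. Q' (?g z))" by (rule arith_pred_comp[OF Q(1), of ?g]) (intro computable_intros)
    qed
    moreover have "(P x \<and> Q x) \<longleftrightarrow> (\<exists>y. P' (?f (pr x y)) \<and> Q' (?g (pr x y)))" for x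
      unfolding P(2) Q(2) by simp (metis pi_pr)
    ultimately have "arith_pred True (Suc n) (\<lambda>x. P x \<and> Q x)" unfolding arith_pred_True_Suc by blast
    then show ?thesis using True by simp
  next
    case False
    then obtain P' Q' where P: "arith_pred True n P'" "\<And>x. P x \<longleftrightarrow> (\<forall>y. P' (pr x y))"
      and Q: "arith_pred True n Q'" "\<And>x. Q x \<longleftrightarrow> (\<forall>y. Q' (pr x y))"
      using Suc.prems arith_pred_False_Suc by auto
    have "arith_pred True n (\<lambda>z. P' z \<and> Q' z)" by (rule Suc.IH[OF P(1) Q(1)])
    moreover have "(P x \<and> Q x) \<longleftrightarrow> (\<forall>y. P' (pr x y) \<and> Q' (pr x y))" for x
      unfolding P(2) Q(2) by blast
    ultimately have "arith_pred False (Suc n) (\<lambda>x. P x \<and> Q x)" unfolding arith_pred_False_Suc by blast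
    then show ?thesis using False by simp
  qed
qed

lemma arith_pred_disj: "arith_pred b n P \<Longrightarrow> arith_pred b n Q \<Longrightarrow> arith_pred b n (\<lambda>x. P x \<or> Q x)"
  using arith_pred_not[OF arith_pred_conj[OF arith_pred_not arith_pred_not], of b n P Q] by simp

lemma arith_pred_imp: "decidable P \<Longrightarrow> arith_pred b n Q \<Longrightarrow> arith_pred b n (\<lambda>x. P x \<longrightarrow> Q x)"
  using arith_pred_disj[OF arith_pred_dec[OF decidable_not]] by simp

lemma arith_pred_ALL: "arith_pred True n (\<lambda>z. P (pi1 z) (pi2 z)) \<Longrightarrow> arith_pred False (Suc n) (\<lambda>x. \<forall>y. P x y)"
  unfolding arith_pred_False_Suc by (rule exI[of _ "\<lambda>z. P (pi1 z) (pi2 z)"]) simp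

lemma arith_pred_EX: "arith_pred False n (\<lambda>z. P (pi1 z) (pi2 z)) \<Longrightarrow> arith_pred True (Suc n) (\<lambda>x. \<exists>y. P x y)"
  unfolding arith_pred_True_Suc by (rule exI[of _ "\<lambda>z. P (pi1 z) (pi2 z)"]) simp

text \<open>Two adjacent universal quantifiers merge into one over pairs.\<close>

lemma arith_pred_all:
  assumes "arith_pred False (Suc n) (\<lambda>z. P (pi1 z) (pi2 z))" shows "arith_pred False (Suc n) (\<lambda>x. \<forall>y. P x y)"
proof -
  obtain Q where Q: "arith_pred True n Q" "\<And>z. P (pi1 z) (pi2 z) \<longleftrightarrow> (\<forall>c. Q (pr z c))"
    using assms arith_pred_False_Suc by auto
  let ?f = "\<lambda>z. pr (pr (pi1 z) (pi1 (pi2 z))) (pi2 (pi2 z))"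
  have "arith_pred True n (\<lambda>z. Q (?f z))" by (rule arith_pred_comp[OF Q(1)]) (intro computable_intros)
  moreover have "(\<forall>y. P x y) \<longleftrightarrow> (\<forall>y. Q (?f (pr x y)))" for x
  proof -
    have "P x y \<longleftrightarrow> (\<forall>c. Q (pr (pr x y) c))" for y using Q(2)[of "pr x y"] by simp
    then show ?thesis by simp (metis pi_pr)
  qed
  ultimately show ?thesis unfolding arith_pred_False_Suc by blast
qed

text \<open>The numbers found so far are collected in \<open>y\<close> by pairing; in the same way
  the program will keep all its guesses in one register.\<close>

fun inf_many :: "(nat \<Rightarrow> bool) \<Rightarrow> nat \<Rightarrow> nat \<Rightarrow> bool" where
  "inf_many P 0 y = P y"
| "inf_many P (Suc k) y = (\<exists>\<^sub>\<infinity>m. inf_many P k (pr y m))"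

text \<open>For fixed \<open>S\<close> there is a unique infinite sequence of entries that searches for witnesses
  \<open>b\<close> of \<open>\<forall>c. S a b c\<close>, for \<open>a = 0, 1, \<dots>\<close> in turn: the entry \<open>0\<close> accepts the current \<open>b\<close> and moves
  on to the next \<open>a\<close>, the entry \<open>Suc c\<close> rejects \<open>b\<close> with the least counterexample \<open>c\<close>. Finite
  prefixes of this sequence, written with the last entry first, are recognised by \<open>valid_entries\<close>; those
  that end with an acceptance are infinite in number iff every \<open>a\<close> has a witness. Recording the
  least counterexamples is what makes the sequence unique.\<close>

context
  fixes S :: "nat \<Rightarrow> nat \<Rightarrow> nat \<Rightarrow> bool"
begin

definition ok_entry :: "nat \<Rightarrow> nat \<Rightarrow> nat \<Rightarrow> bool" where
  "ok_entry a b e \<longleftrightarrow> (e = 0 \<longrightarrow> (\<forall>c. S a b c)) \<and> (e \<noteq> 0 \<longrightarrow> \<not> S a b (e - 1)) \<and> (\<forall>c<e - 1. S a b c)"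

text \<open>The two counts are the current \<open>a\<close> and \<open>b\<close> of the search: as
  the last entry comes first, the initial non-zero entries are the rejections since the latest
  acceptance.\<close>

definition accepted :: "nat list \<Rightarrow> nat" where "accepted w = length (filter (\<lambda>e. e = 0) w)"
definition rejected :: "nat list \<Rightarrow> nat" where "rejected w = length (takeWhile (\<lambda>e. e \<noteq> 0) w)"

fun valid_entries :: "nat list \<Rightarrow> bool" where
  "valid_entries [] = True"
| "valid_entries (e # w) = (ok_entry (accepted w) (rejected w) e \<and> valid_entries w)"

primrec path :: "nat \<Rightarrow> nat list" where
  "path 0 = []"
| "path (Suc n) = (THE e. ok_entry (accepted (path n)) (rejected (path n)) e) # path n"

lemma ok_entry_ex1: "\<exists>!e. ok_entry a b e"
proof (cases "\<forall>c. S a b c")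
  case True
  then show ?thesis by (intro ex1I[of _ 0]) (auto simp: ok_entry_def)
next
  case False
  then obtain c where c: "\<not> S a b c" "\<And>d. d < c \<Longrightarrow> S a b d"
    using exists_least_iff[of "\<lambda>c. \<not> S a b c"] by auto
  show ?thesis
  proof (rule ex1I[of _ "Suc c"])
    show "ok_entry a b (Suc c)" using c by (simp add: ok_entry_def)
    fix e assume e: "ok_entry a b e"
    then obtain d where d: "e = Suc d" using c(1) by (cases e) (auto simp: ok_entry_def)
    then have "\<not> S a b d" "\<forall>c<d. S a b c" using e by (auto simp: ok_entry_def)
    then have "d = c" using c by (metis linorder_neqE_nat)
    then show "e = Suc c" using d by simp
  qed
qed

lemma length_path: "length (path n) = n" by (induction n) auto

lemma valid_entries_iff: "valid_entries w \<longleftrightarrow> w = path (length w)"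
proof (induction w)
  case (Cons e w)
  have "ok_entry (accepted w) (rejected w) e \<longleftrightarrow> e = (THE e. ok_entry (accepted w) (rejected w) e)"
    using theI'[OF ok_entry_ex1[of "accepted w" "rejected w"]] ok_entry_ex1[of "accepted w" "rejected w"] by auto
  then show ?case using Cons length_path by auto
qed simp

lemma valid_entries_path: "valid_entries (path n)" by (simp add: valid_entries_iff length_path)

lemma valid_entries_refuted: "valid_entries w \<Longrightarrow> b < rejected w \<Longrightarrow> \<not> (\<forall>c. S (accepted w) b c)"
proof (induction w)
  case (Cons e w)
  then show ?case
    by (cases "e = 0") (auto simp: accepted_def rejected_def ok_entry_def less_Suc_eq)
qed (simp add: rejected_def)

text \<open>If acceptances end, the search stays at one \<open>a\<close> and rejects every
  \<open>b\<close> in turn, even a true witness. Conversely, the step at which the number of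
  acceptances first exceeds \<open>a\<close> has accepted a witness for \<open>a\<close>.\<close>

lemma accepted_infinitely_often:
  "(\<exists>\<^sub>\<infinity>n. hd (path (Suc n)) = 0) \<longleftrightarrow> (\<forall>a. \<exists>b. \<forall>c. S a b c)"
proof
  assume inf: "\<exists>\<^sub>\<infinity>n. hd (path (Suc n)) = 0"
  have unb: "\<exists>n. accepted (path n) \<ge> K" for K
  proof (induction K)
    case (Suc K)
    then obtain n where n: "K \<le> accepted (path n)" by blast
    have mono: "accepted (path n) \<le> accepted (path (n + j))" for j by (induction j) (auto simp: accepted_def)
    obtain n' where n': "n' > n" "hd (path (Suc n')) = 0" using inf unfolding INFM_nat by blast
    have "accepted (path (Suc n')) = Suc (accepted (path n'))" using n'(2) by (simp add: accepted_def)
    moreover have "accepted (path n) \<le> accepted (path n')" using mono[of "n' - n"] n'(1) by simp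
    ultimately have "Suc K \<le> accepted (path (Suc n'))" using n by simp
    then show ?case by blast
  qed simp
  show "\<forall>a. \<exists>b. \<forall>c. S a b c"
  proof
    fix a
    have ex: "\<exists>n. accepted (path n) \<ge> Suc a" using unb .
    define n where "n = (LEAST n. accepted (path n) \<ge> Suc a)"
    have n: "accepted (path n) \<ge> Suc a" unfolding n_def by (rule LeastI_ex[OF ex])
    then obtain n' where n': "n = Suc n'" by (cases n) (auto simp: accepted_def)
    have "\<not> accepted (path n') \<ge> Suc a" using not_less_Least[of n' "\<lambda>n. accepted (path n) \<ge> Suc a"] n' n_def by auto
    then have *: "accepted (path n') = a" "hd (path (Suc n')) = 0"
      using n unfolding n' by (auto simp: accepted_def split: if_splits)
    have "valid_entries (path (Suc n'))" by (rule valid_entries_path)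
    then have "ok_entry a (rejected (path n')) 0" using * by auto
    then show "\<exists>b. \<forall>c. S a b c" by (auto simp: ok_entry_def)
  qed
next
  assume all: "\<forall>a. \<exists>b. \<forall>c. S a b c"
  show "\<exists>\<^sub>\<infinity>n. hd (path (Suc n)) = 0"
  proof (rule ccontr)
    assume "\<not> (\<exists>\<^sub>\<infinity>n. hd (path (Suc n)) = 0)"
    then have "\<exists>N. \<forall>n. n > N \<longrightarrow> hd (path (Suc n)) \<noteq> 0"
      by (simp only: INFM_nat not_all not_ex de_Morgan_conj imp_conv_disj simp_thms)
    then obtain N where N: "\<And>n. n > N \<Longrightarrow> hd (path (Suc n)) \<noteq> 0" by (elim exE) metis
    have st: "accepted (path (Suc N + j)) = accepted (path (Suc N)) \<and> rejected (path (Suc N + j)) = rejected (path (Suc N)) + j" for j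
    proof (induction j)
      case (Suc j)
      have "hd (path (Suc (Suc N + j))) \<noteq> 0" by (rule N) simp
      then show ?case using Suc by (simp add: accepted_def rejected_def)
    qed simp
    obtain b where b: "\<forall>c. S (accepted (path (Suc N))) b c" using all by blast
    have "\<not> (\<forall>c. S (accepted (path (Suc N + Suc b))) b c)"
      by (rule valid_entries_refuted[OF valid_entries_path]) (use st[of "Suc b"] in simp)
    then show False using b st[of "Suc b"] by simp
  qed
qed

text \<open>Prefixes of one sequence correspond to their lengths, and every list has a single code,
  so counting codes amounts to counting lengths.\<close>

lemma valid_entries_infinitely_often:
  "(\<exists>\<^sub>\<infinity>m. list_decode m \<noteq> [] \<and> hd (list_decode m) = 0 \<and> valid_entries (list_decode m)) \<longleftrightarrow> (\<forall>a. \<exists>b. \<forall>c. S a b c)"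
proof -
  let ?A = "{m. list_decode m \<noteq> [] \<and> hd (list_decode m) = 0 \<and> valid_entries (list_decode m)}"
  let ?B = "{n. hd (path (Suc n)) = 0}"
  let ?f = "\<lambda>n. list_encode (path (Suc n))"
  have "?A = ?f ` ?B"
  proof (intro equalityI subsetI)
    fix m assume m: "m \<in> ?A"
    then obtain n where n: "length (list_decode m) = Suc n" by (cases "list_decode m") auto
    have "valid_entries (list_decode m)" using m by blast
    then have p: "list_decode m = path (Suc n)" unfolding valid_entries_iff n .
    have "m = ?f n" unfolding p[symmetric] by simp
    moreover have "n \<in> ?B" using m unfolding mem_Collect_eq p by blast
    ultimately show "m \<in> ?f ` ?B" by blast
  next
    fix m assume "m \<in> ?f ` ?B"
    then obtain n where n: "hd (path (Suc n)) = 0" "list_decode m = path (Suc n)" by force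
    show "m \<in> ?A" unfolding mem_Collect_eq n(2) using n(1) valid_entries_path[of "Suc n"] by simp
  qed
  moreover have "inj_on ?f ?B"
  proof (rule inj_onI)
    fix n n' assume "?f n = ?f n'"
    then have "path (Suc n) = path (Suc n')" by (simp only: list_encode_eq)
    then have "length (path (Suc n)) = length (path (Suc n'))" by (rule arg_cong)
    then show "n = n'" unfolding length_path by simp
  qed
  ultimately have "infinite ?A \<longleftrightarrow> infinite ?B" using finite_image_iff[of ?f ?B] by argo
  then show ?thesis using accepted_infinitely_often unfolding INFM_iff_infinite by argo
qed

lemma valid_entries_nth: "valid_entries w \<longleftrightarrow> (\<forall>i<length w. ok_entry (accepted (drop (Suc i) w)) (rejected (drop (Suc i) w)) (w ! i))"
proof (induction w)
  case (Cons e w)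
  then show ?case by (simp add: All_less_Suc2)
qed simp

end

definition accepted_code :: "nat \<Rightarrow> nat" where
  "accepted_code c = rec_nat 0 (\<lambda>i r. if lnth c i = 0 then Suc r else r) (llen c)"

definition rejected_code :: "nat \<Rightarrow> nat" where
  "rejected_code c = (LEAST j. llen c \<le> j \<or> lnth c j = 0)"

lemma accepted_code_eq: "accepted_code c = accepted (list_decode c)"
proof -
  have "n \<le> llen c \<Longrightarrow> rec_nat 0 (\<lambda>i r. if lnth c i = 0 then Suc r else r) n = accepted (take n (list_decode c))" for n
  proof (induction n)
    case (Suc n)
    then have "take (Suc n) (list_decode c) = take n (list_decode c) @ [lnth c n]"
      by (simp add: take_Suc_conv_app_nth llen_eq lnth_eq)
    then show ?case using Suc by (simp add: accepted_def)
  qed (simp add: accepted_def)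
  from this[of "llen c"] show ?thesis by (simp add: accepted_code_def llen_eq)
qed

lemma rejected_code_eq: "rejected_code c = rejected (list_decode c)"
proof -
  let ?l = "list_decode c"
  show ?thesis unfolding rejected_code_def rejected_def
  proof (rule Least_equality)
    let ?n = "length (takeWhile (\<lambda>e. e \<noteq> 0) ?l)"
    show "llen c \<le> ?n \<or> lnth c ?n = 0"
    proof (cases "?n < length ?l")
      case True
      then show ?thesis using nth_length_takeWhile[OF True] lnth_eq[OF True] by simp
    qed (simp add: llen_eq)
    fix j assume j: "llen c \<le> j \<or> lnth c j = 0"
    show "?n \<le> j"
    proof (rule ccontr)
      assume "\<not> ?n \<le> j"
      then have lt: "j < ?n" by simp
      then have "j < length ?l" using length_takeWhile_le less_le_trans by blast
      moreover have "?l ! j \<noteq> 0" using lt nth_mem[OF lt] takeWhile_nth[OF lt] set_takeWhileD by metis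
      ultimately show False using j by (auto simp: llen_eq lnth_eq)
    qed
  qed
qed

lemma computable_accepted_code [computable_intros]: "computable a \<Longrightarrow> computable (\<lambda>x. accepted_code (a x))"
  by (rule computable_comp[of accepted_code]) (unfold accepted_code_def, intro computable_intros)

lemma computable_rejected_code [computable_intros]: "computable a \<Longrightarrow> computable (\<lambda>x. rejected_code (a x))"
proof (rule computable_comp[of rejected_code])
  show "computable rejected_code" unfolding rejected_code_def
    by (rule computable_Least) (intro computable_intros, blast)
qed

text \<open>Three quantifiers in front of a \<Sigma> predicate of level \<open>n\<close> become one
  \<open>\<exists>\<^sub>\<infinity>\<close> in front of a \<Pi> predicate of level
  \<open>Suc n\<close>. An accepting entry asks for \<open>S\<close> at all \<open>c\<close>, a
  rejecting one for a failure of \<open>S\<close> and finitely many instances of \<open>S\<close>;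
  the class \<Pi> of level \<open>Suc n\<close> contains all of these.\<close>

lemma Pi_step:
  assumes S: "arith_pred True n S"
  shows "\<exists>Q. arith_pred False (Suc n) Q \<and>
    (\<forall>x. (\<forall>a. \<exists>b. \<forall>c. S (pr (pr (pr x a) b) c)) \<longleftrightarrow> (\<exists>\<^sub>\<infinity>m. Q (pr x m)))"
proof -
  define T where "T x = (\<lambda>a b c. S (pr (pr (pr x a) b) c))" for x
  define Q where "Q z \<longleftrightarrow> list_decode (pi2 z) \<noteq> [] \<and> hd (list_decode (pi2 z)) = 0 \<and> valid_entries (T (pi1 z)) (list_decode (pi2 z))" for z
  define A where "A z i = accepted_code (ldrop (Suc i) (pi2 z))" for z i
  define B where "B z i = rejected_code (ldrop (Suc i) (pi2 z))" for z i
  define e where "e z i = lnth (pi2 z) i" for z i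
  define U where "U z i c = pr (pr (pr (pi1 z) (A z i)) (B z i)) c" for z i c
  have Q: "Q z \<longleftrightarrow> (0 < llen (pi2 z) \<and> lnth (pi2 z) 0 = 0) \<and> (\<forall>i<llen (pi2 z).
      (\<forall>c. e z i = 0 \<longrightarrow> S (U z i c)) \<and> (e z i \<noteq> 0 \<longrightarrow> \<not> S (U z i (e z i - 1))) \<and> (\<forall>c<e z i - 1. S (U z i c)))" for z
  proof -
    have "ok_entry (T (pi1 z)) (accepted (drop (Suc i) (list_decode (pi2 z)))) (rejected (drop (Suc i) (list_decode (pi2 z)))) (list_decode (pi2 z) ! i)
      \<longleftrightarrow> (\<forall>c. e z i = 0 \<longrightarrow> S (U z i c)) \<and> (e z i \<noteq> 0 \<longrightarrow> \<not> S (U z i (e z i - 1))) \<and> (\<forall>c<e z i - 1. S (U z i c))"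
      if "i < llen (pi2 z)" for i
      unfolding ok_entry_def using that
      by (simp add: T_def e_def lnth_eq llen_eq U_def A_def B_def accepted_code_eq rejected_code_eq ldrop_decode)
    moreover have "(list_decode (pi2 z) \<noteq> [] \<and> hd (list_decode (pi2 z)) = 0) \<longleftrightarrow> (0 < llen (pi2 z) \<and> lnth (pi2 z) 0 = 0)"
      by (cases "list_decode (pi2 z)") (auto simp: llen_eq lnth_eq)
    ultimately show ?thesis unfolding Q_def valid_entries_nth llen_eq[symmetric] by blast
  qed
  have S1: "arith_pred False (Suc n) S" using S by (rule arith_pred_Suc)
  have S2: "arith_pred False (Suc n) (\<lambda>x. \<not> S x)" using arith_pred_not[OF S] by (rule arith_pred_Suc)
  have "arith_pred False (Suc n) Q"
    unfolding Q[abs_def] e_def U_def A_def B_def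
  proof (rule arith_pred_conj)
    show "arith_pred False (Suc n) (\<lambda>z. 0 < llen (pi2 z) \<and> lnth (pi2 z) 0 = 0)" by (intro arith_pred_dec computable_intros)
  qed (intro arith_pred_conj arith_pred_all arith_pred_imp arith_pred_comp[OF S1] arith_pred_comp[OF S2] computable_intros)
  moreover have "(\<forall>a. \<exists>b. \<forall>c. S (pr (pr (pr x a) b) c)) \<longleftrightarrow> (\<exists>\<^sub>\<infinity>m. Q (pr x m))" for x
    using valid_entries_infinitely_often[of "T x"] by (simp add: Q_def T_def)
  ultimately show ?thesis by blast
qed

theorem Pi_normal_form:
  "arith_pred False (2 * k + 1) B \<Longrightarrow> \<exists>R. decidable R \<and> (\<forall>x. B x \<longleftrightarrow> inf_many (\<lambda>y. \<forall>c. R (pr y c)) k x)"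
proof (induction k arbitrary: B)
  case 0
  then show ?case by (simp add: arith_pred_False_Suc arith_pred_0)
next
  case (Suc k)
  have "arith_pred False (Suc (Suc (Suc (2 * k)))) B" using Suc.prems by simp
  then obtain C where C: "arith_pred True (Suc (Suc (2 * k))) C" "\<And>x. B x \<longleftrightarrow> (\<forall>a. C (pr x a))"
    unfolding arith_pred_False_Suc by blast
  obtain D where D: "arith_pred False (Suc (2 * k)) D" "\<And>x. C x \<longleftrightarrow> (\<exists>b. D (pr x b))"
    using C(1) unfolding arith_pred_True_Suc by blast
  obtain S where S: "arith_pred True (2 * k) S" "\<And>x. D x \<longleftrightarrow> (\<forall>c. S (pr x c))"
    using D(1) unfolding arith_pred_False_Suc by blast
  obtain Q where Q: "arith_pred False (Suc (2 * k)) Q"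
    "\<And>x. (\<forall>a. \<exists>b. \<forall>c. S (pr (pr (pr x a) b) c)) \<longleftrightarrow> (\<exists>\<^sub>\<infinity>m. Q (pr x m))"
    using Pi_step[OF S(1)] by blast
  obtain R where R: "decidable R" "\<And>x. Q x \<longleftrightarrow> inf_many (\<lambda>y. \<forall>c. R (pr y c)) k x"
    using Suc.IH[of Q] Q(1) by auto
  have "B x \<longleftrightarrow> inf_many (\<lambda>y. \<forall>c. R (pr y c)) (Suc k) x" for x
    using C(2) D(2) S(2) Q(2) R(2) by simp
  then show ?case using R(1) by blast
qed

section \<open>Patterns of derivatives of subshifts of finite type\<close>

definition closed_set :: "('p \<Rightarrow> 'a) set \<Rightarrow> bool" where
  "closed_set Y \<longleftrightarrow> (\<forall>y. (\<forall>D. finite D \<longrightarrow> (\<exists>x\<in>Y. agree D y x)) \<longrightarrow> y \<in> Y)"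

text \<open>A limit of non-isolated points that was itself isolated would coincide with one of
  them.\<close>

lemma closed_derived: "closed_set Y \<Longrightarrow> closed_set (derived Y k)"
proof (induction k)
  case (Suc k)
  then have IH: "closed_set (derived Y k)" by blast
  show ?case unfolding closed_set_def
  proof (intro allI impI)
    fix y assume lim: "\<forall>D. finite D \<longrightarrow> (\<exists>x\<in>derived Y (Suc k). agree D y x)"
    then have y: "y \<in> derived Y k" using IH unfolding closed_set_def by (metis derived_Suc_subset subsetD)
    have "\<not> isolated y (derived Y k)"
    proof
      assume "isolated y (derived Y k)"
      then obtain D where D: "finite D" "\<forall>x\<in>derived Y k. agree D y x \<longrightarrow> x = y" unfolding isolated_def by blast
      then obtain x where x: "x \<in> derived Y (Suc k)" "agree D y x" using lim by blast
      then have "x = y" using D derived_Suc_subset by blast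
      then show False using x D unfolding derived.simps isolated_def by blast
    qed
    then show "y \<in> derived Y (Suc k)" using y by simp
  qed
qed simp

section \<open>Numbered cells and compactness\<close>

definition cellc :: "nat \<Rightarrow> int \<times> int" where "cellc n = (int_decode (pi1 n), int_decode (pi2 n))"
definition ccode :: "int \<times> int \<Rightarrow> nat" where "ccode p = pr (int_encode (fst p)) (int_encode (snd p))"

lemma cellc_ccode [simp]: "cellc (ccode p) = p" "ccode (cellc n) = n"
  by (simp_all add: cellc_def ccode_def)

lemma cellc_eq [simp]: "cellc a = cellc b \<longleftrightarrow> a = b" by (metis cellc_ccode(2))

lemma finite_cells_bounded: "finite D \<Longrightarrow> \<exists>M. \<forall>p\<in>D. ccode p < M"
  using finite_nat_set_iff_bounded[of "ccode ` D"] by auto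

text \<open>Koenig's lemma: a word is \<open>good\<close> if infinitely many of the
  \<open>x j\<close> begin with it, and one of its \<open>m\<close> extensions is good again.
  Infinitely many indices, and not just one, are kept because the uses need \<open>j\<close> beyond
  a given bound.\<close>

lemma accumulation_point:
  fixes x :: "nat \<Rightarrow> config"
  assumes m: "\<And>j p. x j p < m"
  shows "\<exists>y. (\<forall>p. y p < m) \<and> (\<forall>N. \<exists>\<^sub>\<infinity>j. \<forall>c<N. x j (cellc c) = y (cellc c))"
proof -
  define good where "good w \<longleftrightarrow> (\<exists>\<^sub>\<infinity>j. \<forall>c<length w. x j (cellc c) = w ! c)" for w
  have ext: "\<exists>a. a < m \<and> good (w @ [a])" if "good w" for w
  proof (rule ccontr)
    assume "\<not> ?thesis"
    then have "\<forall>a<m. \<not> good (w @ [a])" by blast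
    then have "\<forall>a\<in>{..<m}. \<forall>\<^sub>\<infinity>j. \<not> (\<forall>c<length (w @ [a]). x j (cellc c) = (w @ [a]) ! c)"
      unfolding good_def by (simp add: not_frequently)
    then have "\<forall>\<^sub>\<infinity>j. \<forall>a\<in>{..<m}. \<not> (\<forall>c<length (w @ [a]). x j (cellc c) = (w @ [a]) ! c)"
      by (rule eventually_ball_finite[OF finite_lessThan])
    moreover have "(\<forall>c<length (w @ [x j (cellc (length w))]). x j (cellc c) = (w @ [x j (cellc (length w))]) ! c)"
      if "\<forall>c<length w. x j (cellc c) = w ! c" for j
      using that by (auto simp: nth_append less_Suc_eq)
    ultimately have "\<forall>\<^sub>\<infinity>j. \<not> (\<forall>c<length w. x j (cellc c) = w ! c)"
      by (elim eventually_mono) (metis lessThan_iff m)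
    then show False using \<open>good w\<close> unfolding good_def by (simp add: frequently_def)
  qed
  have "\<exists>f. \<forall>n. (good (f n) \<and> length (f n) = n) \<and> (\<exists>a<m. f (Suc n) = f n @ [a])"
  proof (rule dependent_nat_choice)
    show "\<exists>w. good w \<and> length w = 0" by (auto simp: good_def INFM_nat)
    fix w n assume "good w \<and> length w = n"
    then show "\<exists>w'. (good w' \<and> length w' = Suc n) \<and> (\<exists>a<m. w' = w @ [a])" using ext[of w] by auto
  qed
  then obtain f where f: "\<And>n. good (f n)" "\<And>n. length (f n) = n" "\<And>n. \<exists>a<m. f (Suc n) = f n @ [a]" by blast
  define y where "y p = f (Suc (ccode p)) ! ccode p" for p
  have fy: "c < n \<Longrightarrow> f n ! c = y (cellc c)" for c n
  proof (induction n)
    case (Suc n)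
    obtain a where "f (Suc n) = f n @ [a]" using f(3) by blast
    then show ?case using Suc f(2)[of n] by (cases "c = n") (auto simp: y_def nth_append)
  qed simp
  have "y p < m" for p
  proof -
    obtain a where "a < m" "f (Suc (ccode p)) = f (ccode p) @ [a]" using f(3) by blast
    then show ?thesis using f(2)[of "ccode p"] by (simp add: y_def nth_append)
  qed
  moreover have "\<exists>\<^sub>\<infinity>j. \<forall>c<N. x j (cellc c) = y (cellc c)" for N
    using f(1)[of N] unfolding good_def f(2) using fy[of _ N] by (simp cong: conj_cong)
  ultimately show ?thesis by blast
qed

text \<open>Unlike in \<open>occurs_in\<close> there is no translation, which saves a quantifier;
  shift invariance reconciles the two notions in the end.\<close>

definition matches :: "nat \<Rightarrow> config \<Rightarrow> bool" where
  "matches n x \<longleftrightarrow> (\<forall>p a. decode_pattern n p = Some a \<longrightarrow> x p = a)"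

definition keys :: "nat \<Rightarrow> nat set" where "keys n = pi1 ` set (list_decode n)"

lemma decode_entry_eq: "decode_entry c = (cellc (pi1 c), pi2 c)"
  by (simp add: decode_entry_def cellc_def pi1_def pi2_def split: prod.split)

lemma decode_pattern_eq: "decode_pattern n = map_of (map (\<lambda>c. (cellc (pi1 c), pi2 c)) (list_decode n))"
  by (simp add: decode_pattern_def decode_entry_eq[abs_def])

lemma dom_decode_pattern: "decode_pattern n p = None \<longleftrightarrow> ccode p \<notin> keys n"
proof -
  have "fst ` set (map (\<lambda>c. (cellc (pi1 c), pi2 c)) (list_decode n)) = cellc ` keys n"
    unfolding keys_def by (simp add: image_image)
  moreover have "p \<in> cellc ` S \<longleftrightarrow> ccode p \<in> S" for S by (metis cellc_ccode imageE imageI)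
  ultimately show ?thesis unfolding decode_pattern_eq map_of_eq_None_iff by simp
qed

lemma finite_keys: "finite (keys n)" by (simp add: keys_def)

lemma keys_lapp [simp]: "keys (lapp a b) = keys a \<union> keys b" by (auto simp: keys_def lapp_decode)

lemma decode_lcons: "decode_pattern (lcons (pr c a) h) = (decode_pattern h)(cellc c \<mapsto> a)"
  by (simp add: decode_pattern_eq)

lemma decode_lapp: "decode_pattern (lapp a b) = decode_pattern b ++ decode_pattern a"
  by (simp add: decode_pattern_eq lapp_decode)

lemma matches_lcons: "c \<notin> keys h \<Longrightarrow> matches (lcons (pr c a) h) x \<longleftrightarrow> x (cellc c) = a \<and> matches h x"
proof -
  assume "c \<notin> keys h"
  then have n: "decode_pattern h (cellc c) = None" using dom_decode_pattern[of h "cellc c"] by simp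
  show ?thesis
  proof
    assume l: "matches (lcons (pr c a) h) x"
    have "matches h x" unfolding matches_def
    proof (intro allI impI)
      fix p b assume "decode_pattern h p = Some b"
      moreover then have "p \<noteq> cellc c" using n by auto
      ultimately show "x p = b" using l unfolding matches_def decode_lcons by (metis fun_upd_other)
    qed
    moreover have "x (cellc c) = a" using l unfolding matches_def decode_lcons by (metis fun_upd_same)
    ultimately show "x (cellc c) = a \<and> matches h x" by blast
  next
    assume "x (cellc c) = a \<and> matches h x"
    then show "matches (lcons (pr c a) h) x"
      unfolding matches_def decode_lcons by (metis fun_upd_apply option.inject)
  qed
qed

lemma matches_lappD: "matches (lapp n g) x \<Longrightarrow> matches n x"
  unfolding matches_def decode_lapp by (meson map_add_find_right)

lemma matches_agree: "matches n x \<Longrightarrow> agree (cellc ` keys n) x y \<Longrightarrow> matches n y"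
  unfolding matches_def agree_def
  by (metis cellc_ccode(1) dom_decode_pattern imageI option.distinct(1))

lemma matches_agree2: "matches h x \<Longrightarrow> matches h y \<Longrightarrow> c \<in> keys h \<Longrightarrow> x (cellc c) = y (cellc c)"
  unfolding matches_def using dom_decode_pattern[of h "cellc c"] by (metis cellc_ccode(2) not_None_eq)

text \<open>A pair of points that agree on the first \<open>N\<close> cells and differ elsewhere is
  replaced by patterns: \<open>g\<close> completes \<open>n\<close> on those cells, and
  \<open>c\<close> is a further cell with two possible values. Only statements that a pattern is
  matched in \<open>Z\<close> remain. In the converse the pairs accumulate at some \<open>z\<close>,
  and as the members of a pair differ, one of them differs from \<open>z\<close>.\<close>

lemma deriv_step:
  fixes Z :: "config set"
  assumes cl: "closed_set Z" and m: "\<And>x p. x \<in> Z \<Longrightarrow> x p < m"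
  shows "(\<exists>x\<in>Z. \<not> isolated x Z \<and> matches n x) \<longleftrightarrow>
    (\<forall>N. \<exists>g c a b. a \<noteq> b \<and> c \<notin> keys (lapp n g) \<and> (\<forall>d<N. d \<in> keys (lapp n g)) \<and>
       (\<exists>x\<in>Z. matches (lcons (pr c a) (lapp n g)) x) \<and> (\<exists>x\<in>Z. matches (lcons (pr c b) (lapp n g)) x))"
proof
  assume "\<exists>x\<in>Z. \<not> isolated x Z \<and> matches n x"
  then obtain x where x: "x \<in> Z" "\<not> isolated x Z" "matches n x" by blast
  show "\<forall>N. \<exists>g c a b. a \<noteq> b \<and> c \<notin> keys (lapp n g) \<and> (\<forall>d<N. d \<in> keys (lapp n g)) \<and>
       (\<exists>x\<in>Z. matches (lcons (pr c a) (lapp n g)) x) \<and> (\<exists>x\<in>Z. matches (lcons (pr c b) (lapp n g)) x)"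
  proof
    fix N
    let ?D = "cellc ` (keys n \<union> {..<N})"
    have "finite ?D" using finite_keys by simp
    then obtain y where y: "y \<in> Z" "agree ?D x y" "y \<noteq> x" using x(2) unfolding isolated_def by blast
    then obtain p where p: "x p \<noteq> y p" by (metis ext)
    define g where "g = list_encode (map (\<lambda>c. pr c (x (cellc c))) [0..<N])"
    have kg: "keys g = {..<N}" by (auto simp: keys_def g_def image_iff)
    have c: "ccode p \<notin> keys (lapp n g)"
    proof
      assume "ccode p \<in> keys (lapp n g)"
      then have "p \<in> ?D" using kg by (metis cellc_ccode(1) imageI keys_lapp)
      then show False using y(2) p by (auto simp: agree_def)
    qed
    have mg: "matches g x"
      unfolding matches_def decode_pattern_eq g_def by (auto simp: map_of_map_restrict dest!: map_of_SomeD)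
    have mh: "matches (lapp n g) x"
      unfolding matches_def decode_lapp using x(3) mg unfolding matches_def by (auto simp: map_add_Some_iff)
    moreover have "matches (lapp n g) y" using matches_agree[OF mh] y(2) kg by simp
    ultimately have "matches (lcons (pr (ccode p) (x p)) (lapp n g)) x" "matches (lcons (pr (ccode p) (y p)) (lapp n g)) y"
      using matches_lcons[OF c] by auto
    moreover have "\<forall>d<N. d \<in> keys (lapp n g)" using kg by simp
    ultimately have "x p \<noteq> y p \<and> ccode p \<notin> keys (lapp n g) \<and> (\<forall>d<N. d \<in> keys (lapp n g)) \<and>
       (\<exists>x'\<in>Z. matches (lcons (pr (ccode p) (x p)) (lapp n g)) x') \<and>
       (\<exists>x'\<in>Z. matches (lcons (pr (ccode p) (y p)) (lapp n g)) x')" using p c x(1) y(1) by blast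
    then show "\<exists>g c a b. a \<noteq> b \<and> c \<notin> keys (lapp n g) \<and> (\<forall>d<N. d \<in> keys (lapp n g)) \<and>
       (\<exists>x\<in>Z. matches (lcons (pr c a) (lapp n g)) x) \<and> (\<exists>x\<in>Z. matches (lcons (pr c b) (lapp n g)) x)"
      by (intro exI)
  qed
next
  assume R: "\<forall>N. \<exists>g c a b. a \<noteq> b \<and> c \<notin> keys (lapp n g) \<and> (\<forall>d<N. d \<in> keys (lapp n g)) \<and>
       (\<exists>x\<in>Z. matches (lcons (pr c a) (lapp n g)) x) \<and> (\<exists>x\<in>Z. matches (lcons (pr c b) (lapp n g)) x)"
  have "\<exists>x y. x \<in> Z \<and> y \<in> Z \<and> x \<noteq> y \<and> matches n x \<and> (\<forall>d<N. x (cellc d) = y (cellc d))" for N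
  proof -
    from R obtain g c a b x y where h: "a \<noteq> b" "c \<notin> keys (lapp n g)" "\<forall>d<N. d \<in> keys (lapp n g)"
       "x \<in> Z" "matches (lcons (pr c a) (lapp n g)) x" "y \<in> Z" "matches (lcons (pr c b) (lapp n g)) y" by metis
    then have "matches (lapp n g) x" "matches (lapp n g) y" "x (cellc c) \<noteq> y (cellc c)" using matches_lcons by auto
    then show ?thesis using h matches_lappD matches_agree2 by metis
  qed
  then obtain x y where xy: "\<And>N. x N \<in> Z" "\<And>N. y N \<in> Z" "\<And>N. x N \<noteq> y N" "\<And>N. matches n (x N)"
    "\<And>N d. d < N \<Longrightarrow> x N (cellc d) = y N (cellc d)" by metis
  obtain z where z: "\<And>N. \<exists>\<^sub>\<infinity>j. \<forall>c<N. x j (cellc c) = z (cellc c)"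
    using accumulation_point[of x m] m xy(1) by blast
  have near: "\<exists>j\<ge>M. agree D z (x j) \<and> agree D z (y j)" if D: "finite D" for D M
  proof -
    obtain K where K: "\<forall>p\<in>D. ccode p < K" using finite_cells_bounded[OF D] by blast
    obtain j where j: "j > max K M" "\<forall>c<K. x j (cellc c) = z (cellc c)" using z[of K] unfolding INFM_nat by blast
    have "agree D z (x j)" unfolding agree_def using j(2) K by (metis cellc_ccode(1))
    moreover have "agree D z (y j)" unfolding agree_def
    proof
      fix p assume "p \<in> D"
      then have "ccode p < K" using K by blast
      then have "x j (cellc (ccode p)) = y j (cellc (ccode p))" using xy(5)[of "ccode p" j] j(1) by simp
      moreover have "x j (cellc (ccode p)) = z (cellc (ccode p))" using j(2) \<open>ccode p < K\<close> by blast
      ultimately show "z p = y j p" by simp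
    qed
    ultimately show ?thesis using j(1) by (intro exI[of _ j]) auto
  qed
  have zZ: "z \<in> Z" using cl near[of _ 0] xy(1) unfolding closed_set_def by blast
  moreover have "\<not> isolated z Z"
  proof
    assume "isolated z Z"
    then obtain D where "finite D" "\<forall>y\<in>Z. agree D z y \<longrightarrow> y = z" unfolding isolated_def by blast
    then show False using near[of D 0] xy(1,2,3) by metis
  qed
  moreover have "matches n z"
  proof -
    obtain j where "agree (cellc ` keys n) z (x j)" using near[of "cellc ` keys n" 0] finite_keys by blast
    then show ?thesis using matches_agree[OF xy(4)[of j]] by (simp add: agree_def)
  qed
  ultimately show "\<exists>x\<in>Z. \<not> isolated x Z \<and> matches n x" by blast
qed

lemma deriv_step_ar:
  fixes Z :: "config set"
  assumes cl: "closed_set Z" and m: "\<And>x p. x \<in> Z \<Longrightarrow> x p < m"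
    and arith_pred: "arith_pred False l (\<lambda>n. \<exists>x\<in>Z. matches n x)"
  shows "arith_pred False (Suc (Suc l)) (\<lambda>n. \<exists>x\<in>Z. \<not> isolated x Z \<and> matches n x)"
proof -
  define G where "G n N t \<longleftrightarrow> (let g = pi1 (pi1 t); c = pi2 (pi1 t); a = pi1 (pi2 t); b = pi2 (pi2 t) in
     a \<noteq> b \<and> c \<notin> keys (lapp n g) \<and> (\<forall>d<N. d \<in> keys (lapp n g)) \<and>
       (\<exists>x\<in>Z. matches (lcons (pr c a) (lapp n g)) x) \<and> (\<exists>x\<in>Z. matches (lcons (pr c b) (lapp n g)) x))" for n N t
  have k: "c \<in> keys h \<longleftrightarrow> (\<exists>i<llen h. pi1 (lnth h i) = c)" for c h
  proof
    assume "c \<in> keys h"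
    then obtain i where "i < llen h" "c = pi1 (list_decode h ! i)"
      unfolding keys_def llen_eq by (metis imageE in_set_conv_nth)
    then show "\<exists>i<llen h. pi1 (lnth h i) = c" by (metis llen_eq lnth_eq)
  next
    assume "\<exists>i<llen h. pi1 (lnth h i) = c"
    then show "c \<in> keys h" unfolding keys_def llen_eq by (metis imageI lnth_eq nth_mem)
  qed
  have "(\<exists>x\<in>Z. \<not> isolated x Z \<and> matches n x) \<longleftrightarrow> (\<forall>N. \<exists>t. G n N t)" for n
  proof -
    have "(\<exists>t. G n N t) \<longleftrightarrow> (\<exists>g c a b. a \<noteq> b \<and> c \<notin> keys (lapp n g) \<and> (\<forall>d<N. d \<in> keys (lapp n g)) \<and>
       (\<exists>x\<in>Z. matches (lcons (pr c a) (lapp n g)) x) \<and> (\<exists>x\<in>Z. matches (lcons (pr c b) (lapp n g)) x))" (is "?l \<longleftrightarrow> ?r") for N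
    proof
      assume ?r
      then obtain g c a b where "a \<noteq> b \<and> c \<notin> keys (lapp n g) \<and> (\<forall>d<N. d \<in> keys (lapp n g)) \<and>
       (\<exists>x\<in>Z. matches (lcons (pr c a) (lapp n g)) x) \<and> (\<exists>x\<in>Z. matches (lcons (pr c b) (lapp n g)) x)" by blast
      then have "G n N (pr (pr g c) (pr a b))" by (simp add: G_def Let_def)
      then show ?l by blast
    qed (unfold G_def Let_def, blast)
    then show ?thesis using deriv_step[OF cl, of m n] m by simp
  qed
  moreover have "arith_pred False (Suc (Suc l)) (\<lambda>n. \<forall>N. \<exists>t. G n N t)"
    unfolding G_def Let_def k
    by (intro arith_pred_ALL arith_pred_EX arith_pred_conj) (intro arith_pred_comp[OF arith_pred] computable_intros | intro arith_pred_dec computable_intros)+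
  ultimately show ?thesis by simp
qed


section \<open>Patterns of the subshift itself\<close>

lemma decidable_Ball:
  assumes "finite A" "\<And>a. a \<in> A \<Longrightarrow> decidable (P a)"
  shows "decidable (\<lambda>x. \<forall>a\<in>A. P a x)"
  using assms
proof (induction A)
  case empty show ?case using decidable_const[of True] by simp
next
  case (insert a A)
  then have "decidable (\<lambda>x. P a x \<and> (\<forall>a\<in>A. P a x))" by (intro decidable_conj) auto
  then show ?case by simp
qed

lemma decidable_Bex:
  assumes "finite A" "\<And>a. a \<in> A \<Longrightarrow> decidable (P a)"
  shows "decidable (\<lambda>x. \<exists>a\<in>A. P a x)"
  using decidable_not[OF decidable_Ball[OF assms(1), of "\<lambda>a x. \<not> P a x"]] assms(2) decidable_not by simp

lemma int_decode_if: "int_decode u = (if even u then int (u div 2) else - int (u div 2) - 1)"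
  by (simp add: int_decode_def sum_decode_def)

text \<open>Codes of non-negative integers are even, those of negative ones odd, and a unit shift
  moves the code by 2 except where the sign changes; a fixed shift iterates this.\<close>

lemma computable_int_shift:
  assumes "computable a" shows "computable (\<lambda>x. int_encode (i + int_decode (a x)))"
proof -
  have up: "int_encode (int_decode u + 1) = (if 2 dvd u then u + 2 else if u = 1 then 0 else u - 2)" for u
  proof -
    have "int_decode (if 2 dvd u then u + 2 else if u = 1 then 0 else u - 2) = int_decode u + 1"
    proof (cases "even u")
      case False
      then obtain k where "u = 2 * k + 1" by (elim oddE)
      then show ?thesis by (cases k) (auto simp: int_decode_if)
    qed (auto simp: int_decode_if)
    from this[symmetric] show ?thesis by (simp only: int_decode_inverse)
  qed
  have dn: "int_encode (int_decode u - 1) = (if 2 dvd u then (if u = 0 then 1 else u - 2) else u + 2)" for u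
  proof -
    have "int_decode (if 2 dvd u then (if u = 0 then 1 else u - 2) else u + 2) = int_decode u - 1"
    proof (cases "even u")
      case True
      then obtain k where "u = 2 * k" by (elim evenE)
      then show ?thesis by (cases k) (auto simp: int_decode_if)
    qed (auto simp: int_decode_if)
    from this[symmetric] show ?thesis by (simp only: int_decode_inverse)
  qed
  have cu: "computable (\<lambda>u. int_encode (int_decode u + 1))" unfolding up by (intro computable_intros)
  have cd: "computable (\<lambda>u. int_encode (int_decode u - 1))" unfolding dn by (intro computable_intros)
  have "computable (\<lambda>u. int_encode (i + int_decode u))"
  proof (induction i rule: int_induct[where k = 0])
    case base show ?case by (simp add: computable_id)
  next
    case (step1 i)
    from computable_comp[OF cu step1(2)] show ?case by (simp add: algebra_simps)
  next
    case (step2 i)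
    from computable_comp[OF cd step2(2)] show ?case by (simp add: algebra_simps)
  qed
  from computable_comp[OF this assms] show ?thesis .
qed

definition translate :: "int \<times> int \<Rightarrow> nat \<Rightarrow> nat" where
  "translate p t = ccode (fst p + fst (cellc t), snd p + snd (cellc t))"

lemma computable_tr: "computable a \<Longrightarrow> computable (\<lambda>x. translate p (a x))"
proof -
  assume a: "computable a"
  show ?thesis unfolding translate_def ccode_def cellc_def fst_conv snd_conv
    by (intro computable_pr computable_int_shift computable_pi1 computable_pi2 a)
qed

text \<open>A number below \<open>m ^ N\<close> stores in its base \<open>m\<close> digits the
  contents of the cells with codes below \<open>N\<close>, so a search through all fillings of a
  window is a bounded quantifier.\<close>

definition digit :: "nat \<Rightarrow> nat \<Rightarrow> nat \<Rightarrow> nat" where "digit m q c = q div m ^ c mod m"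

lemma digits_exist:
  assumes f: "\<And>c. f c < m"
  shows "\<exists>q<m ^ N. \<forall>c<N. digit m q c = f c"
proof (induction N)
  case (Suc N)
  then obtain q where q: "q < m ^ N" "\<forall>c<N. digit m q c = f c" by blast
  have m: "0 < m" using f[of 0] by linarith
  let ?q = "q + f N * m ^ N"
  have "?q < (1 + f N) * m ^ N" using q(1) by simp
  also have "\<dots> \<le> m * m ^ N" using f[of N] by (intro mult_le_mono1) simp
  finally have "?q < m ^ Suc N" by simp
  moreover have "digit m ?q c = f c" if "c < Suc N" for c
  proof (cases "c = N")
    case True then show ?thesis using q(1) f[of N] m by (simp add: digit_def)
  next
    case False
    then have c: "c < N" using that by simp
    then obtain d where d: "N = c + Suc d" using less_iff_Suc_add by auto
    have e: "?q = q + (f N * m ^ d * m) * m ^ c" by (simp add: d power_add algebra_simps)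
    have "?q div m ^ c = f N * m ^ d * m + q div m ^ c"
      unfolding e by (rule div_mult_self1) (use m in simp)
    then show ?thesis using q(2) c by (simp add: digit_def)
  qed
  ultimately show ?case by blast
qed simp

lemma map_of_first:
  assumes "i < length l" "\<forall>j<i. fst (l ! j) \<noteq> fst (l ! i)"
  shows "map_of l (fst (l ! i)) = Some (snd (l ! i))"
  using assms
proof (induction l arbitrary: i)
  case (Cons e l)
  show ?case
  proof (cases i)
    case (Suc k)
    have "fst (l ! k) \<noteq> fst e" using Cons.prems(2) Suc by force
    moreover have "\<forall>j<k. fst (l ! j) \<noteq> fst (l ! k)"
    proof (intro allI impI)
      fix j assume "j < k"
      then show "fst (l ! j) \<noteq> fst (l ! k)" using Cons.prems(2)[rule_format, of "Suc j"] Suc by simp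
    qed
    ultimately show ?thesis using Cons.IH[of k] Cons.prems(1) Suc by (cases e) simp
  qed (cases e; simp)
qed simp

text \<open>An entry counts unless an earlier one names the same cell, which is the rule of
  \<open>map_of\<close>. In this form a match can be tested on the code.\<close>

lemma matches_nth:
  "matches n x \<longleftrightarrow> (\<forall>i<llen n. (\<exists>j<i. pi1 (lnth n j) = pi1 (lnth n i)) \<or> x (cellc (pi1 (lnth n i))) = pi2 (lnth n i))"
proof -
  define l where "l = map (\<lambda>c. (cellc (pi1 c), pi2 c)) (list_decode n)"
  have len: "length l = llen n" by (simp add: l_def llen_eq)
  have nth: "l ! i = (cellc (pi1 (lnth n i)), pi2 (lnth n i))" if "i < llen n" for i
    using that by (simp add: l_def llen_eq lnth_eq)
  show ?thesis
  proof
    assume m: "matches n x"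
    show "\<forall>i<llen n. (\<exists>j<i. pi1 (lnth n j) = pi1 (lnth n i)) \<or> x (cellc (pi1 (lnth n i))) = pi2 (lnth n i)"
    proof (intro allI impI disjCI)
      fix i assume i: "i < llen n" and "x (cellc (pi1 (lnth n i))) \<noteq> pi2 (lnth n i)"
      then have "decode_pattern n (cellc (pi1 (lnth n i))) \<noteq> Some (pi2 (lnth n i))" using m unfolding matches_def by blast
      then have "\<exists>j<i. fst (l ! j) = fst (l ! i)"
        using map_of_first[of i l] i nth[OF i] len unfolding decode_pattern_eq l_def[symmetric] by auto
      then show "\<exists>j<i. pi1 (lnth n j) = pi1 (lnth n i)" using nth i by (metis cellc_eq fst_conv less_trans)
    qed
  next
    assume r: "\<forall>i<llen n. (\<exists>j<i. pi1 (lnth n j) = pi1 (lnth n i)) \<or> x (cellc (pi1 (lnth n i))) = pi2 (lnth n i)"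
    show "matches n x" unfolding matches_def
    proof (intro allI impI)
      fix p a assume pa: "decode_pattern n p = Some a"
      then have "(p, a) \<in> set l" unfolding decode_pattern_eq l_def[symmetric] by (rule map_of_SomeD)
      then have ex: "\<exists>i. i < llen n \<and> fst (l ! i) = p" using len by (metis fst_conv in_set_conv_nth)
      define i where "i = (LEAST i. i < llen n \<and> fst (l ! i) = p)"
      have i: "i < llen n" "fst (l ! i) = p" using LeastI_ex[OF ex] unfolding i_def by auto
      have least: "fst (l ! j) \<noteq> p" if "j < i" for j
        using not_less_Least[of j "\<lambda>i. i < llen n \<and> fst (l ! i) = p"] that i unfolding i_def[symmetric] by auto
      have "map_of l p = Some (snd (l ! i))" using map_of_first[of i l] i least len by auto
      then have a: "a = pi2 (lnth n i)" using pa nth[OF i(1)] unfolding decode_pattern_eq l_def[symmetric] by simp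
      have "\<not> (\<exists>j<i. pi1 (lnth n j) = pi1 (lnth n i))" using least nth i by (metis fst_conv less_trans)
      then show "x p = a" using r i a nth[OF i(1)] by auto
    qed
  qed
qed

lemma SFT_closed:
  assumes "is_SFT m X" shows "closed_set X" "x \<in> X \<Longrightarrow> x p < m"
    "x \<in> X \<Longrightarrow> (\<lambda>(i, t). x (i + u, t + v)) \<in> X"
proof -
  obtain F where F: "finite F" "\<forall>P\<in>F. finite (dom P)"
    "X = {x. range x \<subseteq> {..<m} \<and> (\<forall>P\<in>F. \<not> occurs_in P x)}" using assms unfolding is_SFT_def by blast
  show "closed_set X" unfolding closed_set_def
  proof (intro allI impI)
    fix y assume lim: "\<forall>D. finite D \<longrightarrow> (\<exists>x\<in>X. agree D y x)"
    have "y p < m" for p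
    proof -
      obtain x where "x \<in> X" "agree {p} y x" using lim by blast
      then show ?thesis using F(3) by (auto simp: agree_def)
    qed
    moreover have "\<not> occurs_in P y" if P: "P \<in> F" for P
    proof
      assume "occurs_in P y"
      then obtain u v where uv: "\<And>i j a. P (i, j) = Some a \<Longrightarrow> y (i + u, j + v) = a" unfolding occurs_in_def by blast
      obtain x where x: "x \<in> X" "agree ((\<lambda>(i, j). (i + u, j + v)) ` dom P) y x"
        using lim F(2) P by (meson finite_imageI)
      have "x (i + u, j + v) = a" if "P (i, j) = Some a" for i j a
        using x(2) uv[OF that] that unfolding agree_def by force
      then have "occurs_in P x" unfolding occurs_in_def by blast
      then show False using x(1) F(3) P by blast
    qed
    ultimately show "y \<in> X" unfolding F(3) by blast
  qed
  show "x \<in> X \<Longrightarrow> x p < m" using F(3) by auto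
  have "occurs_in P x" if o: "occurs_in P (\<lambda>(i, t). x (i + u, t + v))" for P
  proof -
    obtain a b where "\<And>i j c. P (i, j) = Some c \<Longrightarrow> x (i + a + u, j + b + v) = c"
      using o unfolding occurs_in_def by auto
    then show ?thesis unfolding occurs_in_def by (metis add.assoc)
  qed
  then show "x \<in> X \<Longrightarrow> (\<lambda>(i, t). x (i + u, t + v)) \<in> X" unfolding F(3) by auto
qed

text \<open>By compactness a point exists iff every window has a filling \<open>q\<close> that
  agrees with \<open>n\<close> and shows no complete forbidden pattern, both tested inside the
  window only. \<open>t\<close> runs through codes of translations.\<close>

lemma SFT_patterns_Pi1:
  assumes "is_SFT m X"
  shows "arith_pred False 1 (\<lambda>n. \<exists>x\<in>X. matches n x)"
proof -
  obtain F where F: "finite F" "\<forall>P\<in>F. finite (dom P)"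
    "X = {x. range x \<subseteq> {..<m} \<and> (\<forall>P\<in>F. \<not> occurs_in P x)}" using assms unfolding is_SFT_def by blast
  define V1 where "V1 n N q \<longleftrightarrow> (\<forall>i<llen n. pi1 (lnth n i) < N \<longrightarrow>
     (\<exists>j<i. pi1 (lnth n j) = pi1 (lnth n i)) \<or> digit m q (pi1 (lnth n i)) = pi2 (lnth n i))" for n N q
  define V2 where "V2 N q \<longleftrightarrow> (\<forall>P\<in>F. \<forall>t<N. \<exists>p\<in>dom P. N \<le> translate p t \<or> digit m q (translate p t) \<noteq> the (P p))" for N q
  have "(\<exists>x\<in>X. matches n x) \<longleftrightarrow> (\<forall>N. \<exists>q<m ^ N. V1 n N q \<and> V2 N q)" for n
  proof
    assume "\<exists>x\<in>X. matches n x"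
    then obtain x where x: "x \<in> X" "matches n x" by blast
    show "\<forall>N. \<exists>q<m ^ N. V1 n N q \<and> V2 N q"
    proof
      fix N
      have "x (cellc c) < m" for c using SFT_closed(2)[OF assms x(1)] .
      then obtain q where q: "q < m ^ N" "\<forall>c<N. digit m q c = x (cellc c)"
        using digits_exist[of "\<lambda>c. x (cellc c)" m N] by blast
      have "V1 n N q" using x(2) q(2) unfolding V1_def matches_nth by metis
      moreover have "V2 N q" unfolding V2_def
      proof (intro ballI allI impI, rule ccontr)
        fix P t assume P: "P \<in> F" "t < N" "\<not> (\<exists>p\<in>dom P. N \<le> translate p t \<or> digit m q (translate p t) \<noteq> the (P p))"
        have "x (i + fst (cellc t), j + snd (cellc t)) = a" if "P (i, j) = Some a" for i j a
        proof -
          have "(i, j) \<in> dom P" using that by blast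
          then have "translate (i, j) t < N" "digit m q (translate (i, j) t) = a" using P(3) that by force+
          then show ?thesis using q(2) by (simp add: translate_def)
        qed
        then have "occurs_in P x" unfolding occurs_in_def by blast
        then show False using x(1) P(1) F(3) by blast
      qed
      ultimately show "\<exists>q<m ^ N. V1 n N q \<and> V2 N q" using q(1) by blast
    qed
  next
    assume "\<forall>N. \<exists>q<m ^ N. V1 n N q \<and> V2 N q"
    then obtain q where q: "\<And>N. q N < m ^ N" "\<And>N. V1 n N (q N)" "\<And>N. V2 N (q N)" by metis
    have m: "0 < m" using q(1)[of 1] by (cases m) auto
    \<comment> \<open>The default 0 outside the window is below \<open>m\<close> and disappears in
      the limit, as the windows grow.\<close>
    define x where "x N p = (if ccode p < N then digit m (q N) (ccode p) else 0)" for N p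
    have xm: "x j p < m" for j p using m by (simp add: x_def digit_def)
    obtain y where y: "\<And>p. y p < m" "\<And>N. \<exists>\<^sub>\<infinity>j. \<forall>c<N. x j (cellc c) = y (cellc c)"
      using accumulation_point[of x m, OF xm] by blast
    have near: "\<exists>N>K. \<forall>c<K. digit m (q N) c = y (cellc c)" for K
    proof -
      obtain N where N: "N > K" "\<forall>c<K. x N (cellc c) = y (cellc c)" using y(2)[of K] unfolding INFM_nat by blast
      then have "\<forall>c<K. digit m (q N) c = y (cellc c)" by (auto simp: x_def)
      then show ?thesis using N(1) by blast
    qed
    have "\<not> occurs_in P y" if P: "P \<in> F" for P
    proof
      assume "occurs_in P y"
      then obtain u v where uv: "\<And>i j a. P (i, j) = Some a \<Longrightarrow> y (i + u, j + v) = a" unfolding occurs_in_def by blast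
      define t where "t = ccode (u, v)"
      obtain K where K: "\<forall>p\<in>dom P. translate p t < K"
        using finite_nat_set_iff_bounded[of "(\<lambda>p. translate p t) ` dom P"] F(2) P by auto
      obtain N where N: "N > max K t" "\<forall>c<max K t. digit m (q N) c = y (cellc c)" using near by blast
      obtain p where p: "p \<in> dom P" "N \<le> translate p t \<or> digit m (q N) (translate p t) \<noteq> the (P p)"
        using q(3)[of N] P N(1) unfolding V2_def by force
      obtain i j where ij: "p = (i, j)" by fastforce
      have lt: "translate p t < K" using K p(1) by blast
      then have "digit m (q N) (translate p t) = y (cellc (translate p t))" using N(2) by simp
      also have "\<dots> = the (P p)" using p(1) uv[of i j] ij by (auto simp: translate_def t_def)
      finally show False using p(2) lt N(1) by simp
    qed
    moreover have "matches n y" unfolding matches_nth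
    proof (intro allI impI)
      fix i assume i: "i < llen n"
      obtain N where N: "N > Suc (pi1 (lnth n i))" "\<forall>c<Suc (pi1 (lnth n i)). digit m (q N) c = y (cellc c)"
        using near by blast
      then show "(\<exists>j<i. pi1 (lnth n j) = pi1 (lnth n i)) \<or> y (cellc (pi1 (lnth n i))) = pi2 (lnth n i)"
        using q(2)[of N] i unfolding V1_def by (metis Suc_lessD lessI)
    qed
    ultimately show "\<exists>x\<in>X. matches n x" using y(1) unfolding F(3) by blast
  qed
  moreover have "arith_pred False 1 (\<lambda>n. \<forall>N. \<exists>q<m ^ N. V1 n N q \<and> V2 N q)"
    unfolding One_nat_def
  proof (intro arith_pred_ALL arith_pred_dec computable_intros)
    show "decidable (\<lambda>z. V1 (pi1 (pi1 z)) (pi2 (pi1 z)) (pi2 z))"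
      unfolding V1_def digit_def by (intro computable_intros)
    show "decidable (\<lambda>z. V2 (pi2 (pi1 z)) (pi2 z))"
      unfolding V2_def digit_def using F
      by (intro decidable_Ball decidable_Bex computable_intros computable_tr) auto
  qed
  ultimately show ?thesis by simp
qed

theorem SFT_derivative_patterns_Pi:
  assumes X: "is_SFT m X"
  shows "{n. occurs (decode_pattern n) (cb_deriv X k)} \<in> Pi0 (2 * k + 1)"
proof -
  have "arith_pred False (2 * k + 1) (\<lambda>n. \<exists>x\<in>derived X k. matches n x)"
  proof (induction k)
    case 0 then show ?case using SFT_patterns_Pi1[OF X] by simp
  next
    case (Suc k)
    have "x p < m" if "x \<in> derived X k" for x p using SFT_closed(2)[OF X] that derived_subset by blast
    then have "arith_pred False (Suc (Suc (2 * k + 1))) (\<lambda>n. \<exists>x\<in>derived X k. \<not> isolated x (derived X k) \<and> matches n x)"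
      by (intro deriv_step_ar[where m = m] closed_derived SFT_closed(1)[OF X] Suc)
    moreover have "(\<exists>x\<in>derived X k. \<not> isolated x (derived X k) \<and> matches n x) \<longleftrightarrow> (\<exists>x\<in>derived X (Suc k). matches n x)" for n
      by auto
    ultimately show ?case by (simp only: mult_Suc_right add_Suc_right add_2_eq_Suc add_Suc Suc_eq_plus1[symmetric])
  qed
  moreover have "occurs (decode_pattern n) (cb_deriv X k) \<longleftrightarrow> (\<exists>x\<in>derived X k. matches n x)" for n
  proof
    assume "occurs (decode_pattern n) (cb_deriv X k)"
    then obtain x u v where x: "x \<in> derived X k" "\<And>i j a. decode_pattern n (i, j) = Some a \<Longrightarrow> x (i + u, j + v) = a"
      unfolding occurs_def occurs_in_def cb_deriv_derived by blast
    have "(\<lambda>(i, t). x (i + u, t + v)) \<in> derived X k"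
      by (rule derived_shift[OF _ x(1)]) (rule SFT_closed(3)[OF X])
    moreover have "matches n (\<lambda>(i, t). x (i + u, t + v))" unfolding matches_def using x(2) by auto
    ultimately show "\<exists>x\<in>derived X k. matches n x" by blast
  next
    assume "\<exists>x\<in>derived X k. matches n x"
    then obtain x where x: "x \<in> derived X k" "matches n x" by blast
    have "occurs_in (decode_pattern n) x" unfolding occurs_in_def
      by (intro exI[of _ 0]) (use x(2) in \<open>simp add: matches_def\<close>)
    then show "occurs (decode_pattern n) (cb_deriv X k)" unfolding occurs_def cb_deriv_derived using x(1) by blast
  qed
  ultimately show ?thesis by (simp add: arith_pred_def)
qed

section \<open>While programs\<close>

text \<open>\<open>Guess r\<close> increments the register \<open>r\<close> an arbitrary number of times, possibly forever.\<close>

datatype com = Inc nat | Dec nat | Seq com com | Whl nat com | Guess nat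

definition prime_nr :: "nat \<Rightarrow> nat" where "prime_nr = enumerate {p. prime p}"

lemma prime_prime_nr: "prime (prime_nr r)"
  using enumerate_in_set[OF primes_infinite, of r] by (simp add: prime_nr_def)

lemma prime_nr_less: "r < s \<Longrightarrow> prime_nr r < prime_nr s"
  unfolding prime_nr_def by (rule enumerate_mono[OF _ primes_infinite])

lemma prime_nr_eq: "prime_nr r = prime_nr s \<longleftrightarrow> r = s"
  using prime_nr_less by (metis less_irrefl linorder_neqE_nat)

lemma prime_nr_gt1: "1 < prime_nr r" using prime_prime_nr prime_gt_1_nat by blast

definition reg :: "nat \<Rightarrow> nat \<Rightarrow> nat" where "reg n r = multiplicity (prime_nr r) n"

lemma reg_mult: "0 < a \<Longrightarrow> 0 < b \<Longrightarrow> reg (a * b) r = reg a r + reg b r"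
  unfolding reg_def using prime_prime_nr by (intro prime_elem_multiplicity_mult_distrib) auto

lemma reg_prime_nr: "reg (prime_nr s) r = (if r = s then 1 else 0)"
  unfolding reg_def using prime_prime_nr prime_nr_eq by (auto simp: prime_multiplicity_other multiplicity_prime)

lemma reg_power: "reg (prime_nr s ^ k) r = (if r = s then k else 0)"
proof (induction k)
  case 0 show ?case by (simp add: reg_def)
next
  case (Suc k)
  have "0 < prime_nr s" using prime_nr_gt1[of s] by simp
  then show ?case using Suc reg_mult[of "prime_nr s" "prime_nr s ^ k" r] by (simp add: reg_prime_nr)
qed

lemma reg_dvd: "0 < n \<Longrightarrow> prime_nr r dvd n \<longleftrightarrow> 0 < reg n r"
  unfolding reg_def using prime_prime_nr[of r] by (simp add: prime_multiplicity_gt_zero_iff)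

lemma reg_div:
  assumes "0 < n" "prime_nr s dvd n"
  shows "reg (n div prime_nr s) r = reg n r - (if r = s then 1 else 0)" "0 < n div prime_nr s"
proof -
  obtain k where k: "n = prime_nr s * k" using assms by blast
  then have "0 < k" "0 < prime_nr s" using assms(1) by auto
  then show "reg (n div prime_nr s) r = reg n r - (if r = s then 1 else 0)" "0 < n div prime_nr s"
    using k reg_mult[of "prime_nr s" k r] by (auto simp: reg_prime_nr)
qed

text \<open>While programs are run on a single number whose prime exponents are the registers. The state
  of control is the list of commands still to be executed. If \<open>entry P K\<close> is \<open>(d, a, K1, b, K2, g)\<close>,
  the step from \<open>(K, n)\<close> leads to \<open>(K1, n div d * a)\<close> if \<open>d\<close> divides \<open>n\<close>, and to \<open>(K2, n * b)\<close>
  otherwise; the flag \<open>g\<close> marks a guess, where both are possible. The additional prime factor \<open>P\<close>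
  is larger than all \<open>d\<close> and makes \<open>n\<close> increase.\<close>

fun entry :: "nat \<Rightarrow> com list \<Rightarrow> nat \<times> nat \<times> com list \<times> nat \<times> com list \<times> bool" where
  "entry P (Inc r # K) = (1, prime_nr r * P, K, P, K, False)"
| "entry P (Dec r # K) = (prime_nr r, P, K, P, K, False)"
| "entry P (Seq a b # K) = (1, P, a # b # K, P, K, False)"
| "entry P (Whl r c # K) = (prime_nr r, prime_nr r * P, c # Whl r c # K, P, K, False)"
| "entry P (Guess r # K) = (1, prime_nr r * P, Guess r # K, P, K, True)"
| "entry P [] = (1, P, [], P, [], False)"

definition wstep :: "nat \<Rightarrow> com list \<times> nat \<Rightarrow> com list \<times> nat \<Rightarrow> bool" where
  "wstep P c c' \<longleftrightarrow> fst c \<noteq> [] \<and> (case entry P (fst c) of (d, a, K1, b, K2, g) \<Rightarrow>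
     d dvd snd c \<and> c' = (K1, snd c div d * a) \<or> (\<not> d dvd snd c \<or> g) \<and> c' = (K2, snd c * b))"

lemma forced_Inc: "forced (wstep P) (Inc r # K, n) (K, n * (prime_nr r * P))"
  and forced_Dec: "forced (wstep P) (Dec r # K, n) (K, if prime_nr r dvd n then n div prime_nr r * P else n * P)"
  and forced_Seq: "forced (wstep P) (Seq a b # K, n) (a # b # K, n * P)"
  and forced_Whl: "forced (wstep P) (Whl r c # K, n)
    (if prime_nr r dvd n then (c # Whl r c # K, n div prime_nr r * (prime_nr r * P)) else (K, n * P))"
  by (auto simp: forced_def wstep_def)

lemma step_Gs: "wstep P (Guess r # K, n) u \<longleftrightarrow> u = (Guess r # K, n * (prime_nr r * P)) \<or> u = (K, n * P)"
  by (auto simp: wstep_def)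

lemma step_Nil: "\<not> wstep P ([], n) u" by (simp add: wstep_def)

text \<open>\<open>Guess\<close> has no clause: this semantics serves the deterministic parts of the
  program, where all steps are forced.\<close>

inductive bigstep :: "com \<Rightarrow> (nat \<Rightarrow> nat) \<Rightarrow> (nat \<Rightarrow> nat) \<Rightarrow> bool" where
  Inc: "bigstep (Inc r) s (s(r := Suc (s r)))"
| Dec: "bigstep (Dec r) s (s(r := s r - 1))"
| Seq: "bigstep a s t \<Longrightarrow> bigstep b t u \<Longrightarrow> bigstep (Seq a b) s u"
| Whl0: "s r = 0 \<Longrightarrow> bigstep (Whl r c) s s"
| Whl: "0 < s r \<Longrightarrow> bigstep c s t \<Longrightarrow> bigstep (Whl r c) t u \<Longrightarrow> bigstep (Whl r c) s u"

primrec regs_below :: "com \<Rightarrow> nat \<Rightarrow> bool" where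
  "regs_below (Inc r) N = (r < N)"
| "regs_below (Dec r) N = (r < N)"
| "regs_below (Seq a b) N = (regs_below a N \<and> regs_below b N)"
| "regs_below (Whl r c) N = (r < N \<and> regs_below c N)"
| "regs_below (Guess r) N = (r < N)"

lemma regs_below_mono: "regs_below c N \<Longrightarrow> N \<le> N' \<Longrightarrow> regs_below c N'" by (induction c) auto

lemma regs_below_ex: "\<exists>N. regs_below c N"
proof (induction c)
  case (Seq a b)
  then obtain A B where "regs_below a A" "regs_below b B" by blast
  then show ?case using regs_below_mono[of a A "max A B"] regs_below_mono[of b B "max A B"] by auto
next
  case (Whl r c)
  then obtain A where "regs_below c A" by blast
  then show ?case using regs_below_mono[of c A "max A (Suc r)"] by (intro exI[of _ "max A (Suc r)"]) auto
qed auto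

text \<open>Only the exponents of primes with index below \<open>N\<close> are prescribed; that of
  \<open>prime_nr N\<close> is left free because it grows with every step.\<close>

definition regs :: "nat \<Rightarrow> nat \<Rightarrow> (nat \<Rightarrow> nat) \<Rightarrow> bool" where
  "regs N n s \<longleftrightarrow> 0 < n \<and> (\<forall>r<N. reg n r = s r)"

lemma regs_grow: "regs N n s \<Longrightarrow> regs N (n * prime_nr N) s"
  unfolding regs_def using prime_nr_gt1[of N] by (auto simp: reg_mult reg_prime_nr)

lemma regs_inc: "regs N n s \<Longrightarrow> regs N (n * (prime_nr r * prime_nr N)) (s(r := Suc (s r)))"
  unfolding regs_def using prime_nr_gt1[of N] prime_nr_gt1[of r] by (auto simp: reg_mult reg_prime_nr)

lemma regs_dec: "regs N n s \<Longrightarrow> prime_nr r dvd n \<Longrightarrow> regs N (n div prime_nr r * prime_nr N) (s(r := s r - 1))"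
  unfolding regs_def using prime_nr_gt1[of N] by (auto simp: reg_mult reg_prime_nr reg_div)

lemma regs_zero: "regs N n s \<Longrightarrow> r < N \<Longrightarrow> prime_nr r dvd n \<longleftrightarrow> 0 < s r"
  unfolding regs_def by (auto simp: reg_dvd)

text \<open>Every command takes at least one step, hence the strict closure; the progress arguments
  for infinite loops rest on it.\<close>

lemma bigstep_leads:
  assumes "bigstep c s t" "regs_below c N" "regs N n s"
  shows "\<exists>n'. regs N n' t \<and> (forced (wstep (prime_nr N)))\<^sup>+\<^sup>+ (c # K, n) (K, n')"
  using assms
proof (induction arbitrary: n K rule: bigstep.induct)
  case (Inc r s)
  then show ?case using forced_Inc[of "prime_nr N" r K n] regs_inc by blast
next
  case (Dec r s)
  show ?case
  proof (cases "prime_nr r dvd n")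
    case True
    then have "forced (wstep (prime_nr N)) (Dec r # K, n) (K, n div prime_nr r * prime_nr N)" using forced_Dec[of "prime_nr N" r K n] by simp
    then show ?thesis using regs_dec[OF Dec(2) True] by blast
  next
    case False
    then have "s r = 0" using regs_zero[OF Dec(2), of r] Dec(1) by simp
    then have e: "s(r := s r - 1) = s" by auto
    have "forced (wstep (prime_nr N)) (Dec r # K, n) (K, n * prime_nr N)" using forced_Dec[of "prime_nr N" r K n] False by simp
    then show ?thesis unfolding e using regs_grow[OF Dec(2)] by blast
  qed
next
  case (Seq a s t b u)
  have 1: "(forced (wstep (prime_nr N)))\<^sup>+\<^sup>+ (Seq a b # K, n) (a # b # K, n * prime_nr N)" using forced_Seq by blast
  obtain n1 where n1: "regs N n1 t" "(forced (wstep (prime_nr N)))\<^sup>+\<^sup>+ (a # b # K, n * prime_nr N) (b # K, n1)"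
    using Seq.IH(1)[OF _ regs_grow[OF Seq.prems(2)]] Seq.prems(1) by auto
  obtain n2 where n2: "regs N n2 u" "(forced (wstep (prime_nr N)))\<^sup>+\<^sup>+ (b # K, n1) (K, n2)"
    using Seq.IH(2)[OF _ n1(1)] Seq.prems(1) by auto
  show ?case using 1 n1(2) n2 by (meson tranclp_trans)
next
  case (Whl0 s r c)
  then have "\<not> prime_nr r dvd n" using regs_zero[of N n s r] by auto
  then show ?case using forced_Whl[of "prime_nr N" r c K n] regs_grow[OF Whl0(3)] by auto
next
  case (Whl s r c t u)
  have d: "prime_nr r dvd n" using regs_zero[OF Whl.prems(2), of r] Whl by auto
  then have e: "n div prime_nr r * (prime_nr r * prime_nr N) = n * prime_nr N" by (metis dvd_div_mult_self mult.assoc)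
  have 1: "(forced (wstep (prime_nr N)))\<^sup>+\<^sup>+ (Whl r c # K, n) (c # Whl r c # K, n * prime_nr N)"
    using forced_Whl[of "prime_nr N" r c K n] d e by auto
  obtain n1 where n1: "regs N n1 t" "(forced (wstep (prime_nr N)))\<^sup>+\<^sup>+ (c # Whl r c # K, n * prime_nr N) (Whl r c # K, n1)"
    using Whl.IH(1)[OF _ regs_grow[OF Whl.prems(2)]] Whl.prems(1) by auto
  obtain n2 where n2: "regs N n2 u" "(forced (wstep (prime_nr N)))\<^sup>+\<^sup>+ (Whl r c # K, n1) (K, n2)"
    using Whl.IH(2)[OF Whl.prems(1) n1(1)] by auto
  show ?case using 1 n1(2) n2 by (meson tranclp_trans)
qed

section \<open>Compilation of recursive functions\<close>

definition clear :: "nat \<Rightarrow> com" where "clear r = Whl r (Dec r)"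

lemma bigstep_clr: "bigstep (clear r) s (s(r := 0))"
proof (induction "s r" arbitrary: s)
  case 0
  then have "s(r := 0) = s" by auto
  then show ?case using 0 bigstep.Whl0[of s r] by (simp add: clear_def)
next
  case (Suc k)
  have "bigstep (clear r) (s(r := s r - 1)) ((s(r := s r - 1))(r := 0))" by (rule Suc(1)) (use Suc(2) in simp)
  then show ?case using bigstep.Whl[of s r "Dec r", OF _ bigstep.Dec] Suc(2) by (simp add: clear_def)
qed

text \<open>Moving by decrements destroys the source; \<open>t\<close> receives a second copy, from
  which it is restored.\<close>

definition copy :: "nat \<Rightarrow> nat \<Rightarrow> nat \<Rightarrow> com" where
  "copy a d t = Seq (clear d) (Seq (clear t) (Seq (Whl a (Seq (Dec a) (Seq (Inc d) (Inc t)))) (Whl t (Seq (Dec t) (Inc a)))))"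

lemma bigstep_cpy:
  assumes "a \<noteq> d" "a \<noteq> t" "d \<noteq> t"
  shows "bigstep (copy a d t) s (s(d := s a, t := 0))"
proof -
  have l1: "bigstep (Whl a (Seq (Dec a) (Seq (Inc d) (Inc t)))) s (s(a := 0, d := s d + s a, t := s t + s a))" for s
  proof (induction "s a" arbitrary: s)
    case 0
    then have e: "s(a := 0, d := s d + s a, t := s t + s a) = s" by auto
    show ?case unfolding e by (rule bigstep.Whl0) (use 0 in simp)
  next
    case (Suc k)
    let ?s = "s(a := s a - 1, d := Suc (s d), t := Suc (s t))"
    have b: "bigstep (Seq (Dec a) (Seq (Inc d) (Inc t))) s ?s"
      using bigstep.Seq[OF bigstep.Dec[of a s] bigstep.Seq[OF bigstep.Inc[of d] bigstep.Inc[of t]]] assms by simp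
    have "bigstep (Whl a (Seq (Dec a) (Seq (Inc d) (Inc t)))) ?s (?s(a := 0, d := ?s d + ?s a, t := ?s t + ?s a))"
      by (rule Suc(1)) (use Suc(2) assms in simp)
    moreover have "?s(a := 0, d := ?s d + ?s a, t := ?s t + ?s a) = s(a := 0, d := s d + s a, t := s t + s a)"
      using Suc(2) assms by (auto simp: fun_eq_iff)
    ultimately show ?case using bigstep.Whl[OF _ b] Suc(2) by simp
  qed
  have l2: "bigstep (Whl t (Seq (Dec t) (Inc a))) s (s(t := 0, a := s a + s t))" for s
  proof (induction "s t" arbitrary: s)
    case 0
    then have e: "s(t := 0, a := s a + s t) = s" by auto
    show ?case unfolding e by (rule bigstep.Whl0) (use 0 in simp)
  next
    case (Suc k)
    let ?s = "s(t := s t - 1, a := Suc (s a))"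
    have b: "bigstep (Seq (Dec t) (Inc a)) s ?s"
      using bigstep.Seq[OF bigstep.Dec[of t s] bigstep.Inc[of a]] assms by simp
    have "bigstep (Whl t (Seq (Dec t) (Inc a))) ?s (?s(t := 0, a := ?s a + ?s t))"
      by (rule Suc(1)) (use Suc(2) assms in simp)
    moreover have "?s(t := 0, a := ?s a + ?s t) = s(t := 0, a := s a + s t)"
      using Suc(2) assms by (auto simp: fun_eq_iff)
    ultimately show ?case using bigstep.Whl[OF _ b] Suc(2) by simp
  qed
  let ?s1 = "s(d := 0, t := 0)"
  let ?s2 = "?s1(a := 0, d := ?s1 d + ?s1 a, t := ?s1 t + ?s1 a)"
  have "bigstep (copy a d t) s (?s2(t := 0, a := ?s2 a + ?s2 t))"
    unfolding copy_def by (rule bigstep.Seq[OF bigstep_clr bigstep.Seq[OF bigstep_clr bigstep.Seq[OF l1 l2]]])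
  moreover have "?s2(t := 0, a := ?s2 a + ?s2 t) = s(d := s a, t := 0)"
    using assms by (auto simp: fun_eq_iff)
  ultimately show ?thesis by simp
qed

primrec copy_block :: "nat \<Rightarrow> nat \<Rightarrow> nat \<Rightarrow> nat \<Rightarrow> com" where
  "copy_block f g t 0 = clear t"
| "copy_block f g t (Suc k) = Seq (copy_block f g t k) (copy (f + k) (g + k) t)"

lemma bigstep_cpb:
  assumes "f + k \<le> t" "t < g"
  shows "\<exists>u. bigstep (copy_block f g t k) s u \<and> (\<forall>i<k. u (g + i) = s (f + i)) \<and> (\<forall>r. r \<noteq> t \<longrightarrow> \<not> (g \<le> r \<and> r < g + k) \<longrightarrow> u r = s r)"
  using assms
proof (induction k)
  case 0
  show ?case
  proof (intro exI[of _ "s(t := 0)"] conjI)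
    show "bigstep (copy_block f g t 0) s (s(t := 0))" unfolding copy_block.simps by (rule bigstep_clr)
  qed auto
next
  case (Suc k)
  then obtain u where u: "bigstep (copy_block f g t k) s u" "\<forall>i<k. u (g + i) = s (f + i)"
    "\<forall>r. r \<noteq> t \<longrightarrow> \<not> (g \<le> r \<and> r < g + k) \<longrightarrow> u r = s r" by auto
  have "bigstep (copy (f + k) (g + k) t) u (u(g + k := u (f + k), t := 0))"
    using Suc.prems by (intro bigstep_cpy) auto
  then have b: "bigstep (copy_block f g t (Suc k)) s (u(g + k := u (f + k), t := 0))"
    unfolding copy_block.simps by (rule bigstep.Seq[OF u(1)])
  have e: "u (f + k) = s (f + k)" using u(3) Suc.prems by simp
  show ?case
    by (intro exI, intro conjI, rule b) (use e u Suc.prems in \<open>auto simp: less_Suc_eq\<close>)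
qed

definition args :: "(nat \<Rightarrow> nat) \<Rightarrow> nat \<Rightarrow> nat \<Rightarrow> nat list" where
  "args s b n = map (\<lambda>i. s (b + i)) [0..<n]"

text \<open>Inputs are in the registers \<open>b + 1, \<dots>, b + n\<close>, the output is in \<open>b\<close>. Registers from \<open>b\<close> on may
  hold arbitrary values at the start and are not preserved.\<close>

definition computes :: "com \<Rightarrow> nat \<Rightarrow> nat \<Rightarrow> (nat list \<Rightarrow> nat) \<Rightarrow> bool" where
  "computes c b n f \<longleftrightarrow> (\<forall>s. \<exists>t. bigstep c s t \<and> t b = f (args s (b + 1) n) \<and> (\<forall>r<b. t r = s r))"

lemma length_args [simp]: "length (args s b n) = n" by (simp add: args_def)

lemma args_cong: "(\<And>i. i < n \<Longrightarrow> s (b + i) = t (d + i)) \<Longrightarrow> args s b n = args t d n"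
  by (simp add: args_def)

lemma args_Suc: "args s b (Suc n) = s b # args s (Suc b) n"
  by (simp add: args_def upt_conv_Cons map_Suc_upt[symmetric] del: upt_Suc)

text \<open>The calling convention: arguments are copied into a frame at \<open>B\<close>, above
  everything in use, and the result is copied back to \<open>d\<close>, with \<open>t\<close> as
  scratch.\<close>

lemma computes_call:
  assumes c: "computes c B n f" and "F + n \<le> t" "t < B" "d < B" "d \<noteq> t"
  shows "\<exists>u. bigstep (Seq (copy_block F (B + 1) t n) (Seq c (copy B d t))) s u \<and> u d = f (args s F n) \<and>
    (\<forall>r<B. r \<noteq> d \<longrightarrow> r \<noteq> t \<longrightarrow> u r = s r)"
proof -
  obtain s1 where s1: "bigstep (copy_block F (B + 1) t n) s s1" "\<forall>i<n. s1 (B + 1 + i) = s (F + i)"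
    "\<forall>r. r \<noteq> t \<longrightarrow> \<not> (B + 1 \<le> r \<and> r < B + 1 + n) \<longrightarrow> s1 r = s r"
    using bigstep_cpb[of F n t "B + 1" s] assms by auto
  obtain s2 where s2: "bigstep c s1 s2" "s2 B = f (args s1 (B + 1) n)" "\<forall>r<B. s2 r = s1 r"
    using c unfolding computes_def by blast
  have a: "args s1 (B + 1) n = args s F n" using s1(2) by (intro args_cong) simp
  have "bigstep (copy B d t) s2 (s2(d := s2 B, t := 0))" using assms by (intro bigstep_cpy) auto
  then have b: "bigstep (Seq (copy_block F (B + 1) t n) (Seq c (copy B d t))) s (s2(d := s2 B, t := 0))"
    using s1(1) s2(1) by (intro bigstep.Seq)
  show ?thesis by (intro exI, intro conjI, rule b) (use s1 s2 a assms in auto)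
qed

lemma computes_compile: "total_rec n f \<Longrightarrow> \<exists>c. computes c b n f"
proof (induction arbitrary: b rule: total_rec.induct)
  case (zero n)
  have "computes (clear b) b n (\<lambda>_. 0)"
    unfolding computes_def by (intro allI exI, intro conjI, rule bigstep_clr) auto
  then show ?case by blast
next
  case succ
  have "computes (Seq (copy (b + 1) b (b + 2)) (Inc b)) b 1 (\<lambda>xs. Suc (xs ! 0))"
    unfolding computes_def
  proof
    fix s :: "nat \<Rightarrow> nat"
    let ?s1 = "s(b := s (b + 1), b + 2 := 0)"
    have "bigstep (copy (b + 1) b (b + 2)) s ?s1" by (rule bigstep_cpy) auto
    from bigstep.Seq[OF this bigstep.Inc[of b]]
    have b: "bigstep (Seq (copy (b + 1) b (b + 2)) (Inc b)) s (?s1(b := Suc (?s1 b)))" .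
    show "\<exists>t. bigstep (Seq (copy (b + 1) b (b + 2)) (Inc b)) s t \<and> t b = Suc (args s (b + 1) 1 ! 0) \<and> (\<forall>r<b. t r = s r)"
      by (intro exI, intro conjI, rule b) (auto simp: args_def)
  qed
  then show ?case by blast
next
  case (proj i n)
  have "computes (copy (b + 1 + i) b (b + 1 + n)) b n (\<lambda>xs. xs ! i)"
    unfolding computes_def
  proof
    fix s
    have b: "bigstep (copy (b + 1 + i) b (b + 1 + n)) s (s(b := s (b + 1 + i), b + 1 + n := 0))"
      using proj by (intro bigstep_cpy) auto
    show "\<exists>t. bigstep (copy (b + 1 + i) b (b + 1 + n)) s t \<and> t b = args s (b + 1) n ! i \<and> (\<forall>r<b. t r = s r)"
      by (intro exI, intro conjI, rule b) (use proj in \<open>auto simp: args_def\<close>)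
  qed
  then show ?case by blast
next
  case (comp m g n fs)
  \<comment> \<open>Layout: the arguments at \<open>b + 1\<close>, ..., \<open>b + n\<close>, the
    \<open>m\<close> inner results behind them, one scratch register \<open>t\<close>, and the frame
    of the callee from \<open>B\<close> on.\<close>
  define B where "B = b + n + m + 2"
  define t where "t = b + n + m + 1"
  obtain cg where cg: "computes cg B m g" using comp.IH(1) by blast
  have "\<forall>i. \<exists>c. i < m \<longrightarrow> computes c B n (fs i)" using comp.IH(2) by blast
  then obtain cf where cf: "\<And>i. i < m \<Longrightarrow> computes (cf i) B n (fs i)" by metis
  define qs where "qs = rec_nat (clear t) (\<lambda>j c. Seq c (Seq (copy_block (b + 1) (B + 1) t n) (Seq (cf j) (copy B (b + n + 1 + j) t))))"
  have qs: "j \<le> m \<Longrightarrow> \<exists>u. bigstep (qs j) s u \<and> (\<forall>i<j. u (b + n + 1 + i) = fs i (args s (b + 1) n)) \<and> (\<forall>r\<le>b + n. u r = s r)" for j s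
  proof (induction j)
    case 0
    have b: "bigstep (qs 0) s (s(t := 0))" unfolding qs_def nat.rec by (rule bigstep_clr)
    show ?case by (intro exI, intro conjI, rule b) (auto simp: t_def)
  next
    case (Suc j)
    then obtain u where u: "bigstep (qs j) s u" "\<forall>i<j. u (b + n + 1 + i) = fs i (args s (b + 1) n)" "\<forall>r\<le>b + n. u r = s r" by auto
    obtain v where v: "bigstep (Seq (copy_block (b + 1) (B + 1) t n) (Seq (cf j) (copy B (b + n + 1 + j) t))) u v"
      "v (b + n + 1 + j) = fs j (args u (b + 1) n)" "\<forall>r<B. r \<noteq> b + n + 1 + j \<longrightarrow> r \<noteq> t \<longrightarrow> v r = u r"
      using computes_call[OF cf[of j], of "b + 1" t "b + n + 1 + j" u] Suc.prems by (auto simp: B_def t_def)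
    have "args u (b + 1) n = args s (b + 1) n" using u(3) by (intro args_cong) simp
    moreover have "bigstep (qs (Suc j)) s v" using u(1) v(1) by (simp add: qs_def bigstep.Seq)
    ultimately show ?case using u v Suc.prems
      by (intro exI[of _ v]) (auto simp: less_Suc_eq B_def t_def)
  qed
  have "computes (Seq (qs m) (Seq (copy_block (b + n + 1) (B + 1) t m) (Seq cg (copy B b t)))) b n
      (\<lambda>xs. g (map (\<lambda>i. fs i xs) [0..<m]))"
    unfolding computes_def
  proof
    fix s
    obtain u where u: "bigstep (qs m) s u" "\<forall>i<m. u (b + n + 1 + i) = fs i (args s (b + 1) n)" "\<forall>r\<le>b + n. u r = s r"
      using qs[of m s] by auto
    obtain v where v: "bigstep (Seq (copy_block (b + n + 1) (B + 1) t m) (Seq cg (copy B b t))) u v"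
      "v b = g (args u (b + n + 1) m)" "\<forall>r<B. r \<noteq> b \<longrightarrow> r \<noteq> t \<longrightarrow> v r = u r"
      using computes_call[OF cg, of "b + n + 1" t b u] by (auto simp: B_def t_def)
    have "args u (b + n + 1) m = map (\<lambda>i. fs i (args s (b + 1) n)) [0..<m]"
      using u(2) by (simp add: args_def)
    then show "\<exists>t'. bigstep (Seq (qs m) (Seq (copy_block (b + n + 1) (B + 1) t m) (Seq cg (copy B b t)))) s t' \<and>
        t' b = g (map (\<lambda>i. fs i (args s (b + 1) n)) [0..<m]) \<and> (\<forall>r<b. t' r = s r)"
      using u v by (intro exI[of _ v]) (auto intro: bigstep.Seq simp: B_def t_def)
  qed
  then show ?case by blast
next
  case (prim n g h)
  \<comment> \<open>\<open>Yr\<close> is the counter and \<open>Yr + 1\<close> the accumulator,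
    followed by the parameters, so that the arguments of \<open>h\<close> form a block starting at
    \<open>Yr\<close>. \<open>X\<close> counts the rounds that remain.\<close>
  define Yr where "Yr = b + n + 2"
  define t where "t = b + 2 * n + 6"
  define X where "X = b + 2 * n + 7"
  define B where "B = b + 2 * n + 8"
  note defs = Yr_def t_def X_def B_def
  obtain cg where cg: "computes cg B n g" using prim.IH(1) by blast
  obtain ch where ch: "computes ch B (Suc (Suc n)) h" using prim.IH(2) by blast
  define body where "body = Seq (Dec X) (Seq (Seq (copy_block Yr (B + 1) t (Suc (Suc n))) (Seq ch (copy B (Yr + 1) t))) (Inc Yr))"
  define pre where "pre = Seq (copy_block (b + 2) (Yr + 2) (Yr + 1) n)
     (Seq (Seq (copy_block (b + 2) (B + 1) t n) (Seq cg (copy B (Yr + 1) t))) (Seq (clear Yr) (copy (b + 1) X t)))"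
  define rc where "rc xs = rec_nat (g xs) (\<lambda>y r. h (y # r # xs))" for xs
  have pre: "\<exists>u. bigstep pre s u \<and> u Yr = 0 \<and> u (Yr + 1) = g (args s (b + 2) n) \<and>
      args u (Yr + 2) n = args s (b + 2) n \<and> u X = s (b + 1) \<and> (\<forall>r<b. u r = s r)" for s
  proof -
    obtain s1 where s1: "bigstep (copy_block (b + 2) (Yr + 2) (Yr + 1) n) s s1" "\<forall>i<n. s1 (Yr + 2 + i) = s (b + 2 + i)"
      "\<forall>r. r \<noteq> Yr + 1 \<longrightarrow> \<not> (Yr + 2 \<le> r \<and> r < Yr + 2 + n) \<longrightarrow> s1 r = s r"
      using bigstep_cpb[of "b + 2" n "Yr + 1" "Yr + 2" s] by (auto simp: defs)
    obtain s2 where s2: "bigstep (Seq (copy_block (b + 2) (B + 1) t n) (Seq cg (copy B (Yr + 1) t))) s1 s2"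
      "s2 (Yr + 1) = g (args s1 (b + 2) n)" "\<forall>r<B. r \<noteq> Yr + 1 \<longrightarrow> r \<noteq> t \<longrightarrow> s2 r = s1 r"
      using computes_call[OF cg, of "b + 2" t "Yr + 1" s1] by (auto simp: defs)
    let ?s3 = "s2(Yr := 0)"
    let ?s4 = "?s3(X := ?s3 (b + 1), t := 0)"
    have "bigstep (copy (b + 1) X t) ?s3 ?s4" by (rule bigstep_cpy) (auto simp: defs)
    then have b: "bigstep pre s ?s4"
      unfolding pre_def by (rule bigstep.Seq[OF s1(1) bigstep.Seq[OF s2(1) bigstep.Seq[OF bigstep_clr]]])
    have 1: "args s1 (b + 2) n = args s (b + 2) n" using s1(3) by (intro args_cong) (simp add: defs)
    have 2: "args ?s4 (Yr + 2) n = args s (b + 2) n" using s1(2) s2(3) by (intro args_cong) (simp add: defs)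
    have 3: "?s4 X = s (b + 1)" using s1(3) s2(3) by (simp add: defs)
    have 4: "\<forall>r<b. ?s4 r = s r" using s1(3) s2(3) by (simp add: defs)
    have 5: "?s4 Yr = 0" "?s4 (Yr + 1) = g (args s (b + 2) n)" using s2(2) 1 by (simp_all add: defs)
    show ?thesis by (intro exI conjI, rule b, rule 5, rule 5, rule 2, rule 3, rule 4)
  qed
  have loop: "\<exists>v. bigstep (Whl X body) u v \<and> v (Yr + 1) = rc xs (y + k) \<and> (\<forall>r<b. v r = u r)"
    if "u X = k" "u Yr = y" "u (Yr + 1) = rc xs y" "args u (Yr + 2) n = xs" for u k y xs
    using that
  proof (induction k arbitrary: u y)
    case 0
    then show ?case using bigstep.Whl0[of u X body] by (intro exI[of _ u]) simp
  next
    case (Suc k)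
    let ?u1 = "u(X := u X - 1)"
    obtain u2 where u2: "bigstep (Seq (copy_block Yr (B + 1) t (Suc (Suc n))) (Seq ch (copy B (Yr + 1) t))) ?u1 u2"
      "u2 (Yr + 1) = h (args ?u1 Yr (Suc (Suc n)))" "\<forall>r<B. r \<noteq> Yr + 1 \<longrightarrow> r \<noteq> t \<longrightarrow> u2 r = ?u1 r"
      using computes_call[OF ch, of Yr t "Yr + 1" ?u1] by (auto simp: defs)
    have "args ?u1 (Suc (Suc Yr)) n = xs" using Suc.prems(4) by (subst Suc.prems(4)[symmetric]) (rule args_cong, simp add: defs)
    then have "args ?u1 Yr (Suc (Suc n)) = y # rc xs y # xs"
      using Suc.prems by (simp add: args_Suc defs)
    then have r: "u2 (Yr + 1) = rc xs (Suc y)" using u2(2) by (simp add: rc_def)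
    let ?u3 = "u2(Yr := Suc (u2 Yr))"
    have b: "bigstep body u ?u3" unfolding body_def
      by (rule bigstep.Seq[OF bigstep.Dec bigstep.Seq[OF u2(1) bigstep.Inc]])
    have "\<exists>v. bigstep (Whl X body) ?u3 v \<and> v (Yr + 1) = rc xs (Suc y + k) \<and> (\<forall>r<b. v r = ?u3 r)"
    proof (rule Suc.IH)
      show "?u3 X = k" using u2(3) Suc.prems(1) by (simp add: defs)
      show "?u3 Yr = Suc y" using u2(3) Suc.prems(2) by (simp add: defs)
      show "?u3 (Yr + 1) = rc xs (Suc y)" using r by simp
      show "args ?u3 (Yr + 2) n = xs" using Suc.prems(4) u2(3)
        by (subst Suc.prems(4)[symmetric]) (rule args_cong, simp add: defs)
    qed
    then obtain v where v: "bigstep (Whl X body) ?u3 v" "v (Yr + 1) = rc xs (Suc y + k)" "\<forall>r<b. v r = ?u3 r" by blast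
    have "bigstep (Whl X body) u v" using bigstep.Whl[OF _ b v(1)] Suc.prems(1) by simp
    then show ?case using v u2(3) by (intro exI[of _ v]) (auto simp: defs)
  qed
  have "computes (Seq pre (Seq (Whl X body) (copy (Yr + 1) b t))) b (Suc n)
      (\<lambda>xs. rec_nat (g (tl xs)) (\<lambda>y r. h (y # r # tl xs)) (hd xs))"
    unfolding computes_def
  proof
    fix s
    obtain u where u: "bigstep pre s u" "u Yr = 0" "u (Yr + 1) = g (args s (b + 2) n)"
      "args u (Yr + 2) n = args s (b + 2) n" "u X = s (b + 1)" "\<forall>r<b. u r = s r" using pre by blast
    obtain v where v: "bigstep (Whl X body) u v" "v (Yr + 1) = rc (args s (b + 2) n) (0 + s (b + 1))" "\<forall>r<b. v r = u r"
      using loop[OF u(5,2) _ u(4)] u(3) by (auto simp: rc_def)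
    have "bigstep (copy (Yr + 1) b t) v (v(b := v (Yr + 1), t := 0))" by (rule bigstep_cpy) (auto simp: defs)
    then have b: "bigstep (Seq pre (Seq (Whl X body) (copy (Yr + 1) b t))) s (v(b := v (Yr + 1), t := 0))"
      using u(1) v(1) by (intro bigstep.Seq)
    have a: "args s (b + 1) (Suc n) = s (b + 1) # args s (b + 2) n" by (simp add: args_Suc)
    show "\<exists>t'. bigstep (Seq pre (Seq (Whl X body) (copy (Yr + 1) b t))) s t' \<and>
       t' b = rec_nat (g (tl (args s (b + 1) (Suc n)))) (\<lambda>y r. h (y # r # tl (args s (b + 1) (Suc n)))) (hd (args s (b + 1) (Suc n))) \<and>
       (\<forall>r<b. t' r = s r)"
      by (intro exI, intro conjI, rule b) (use a u(6) v(2,3) in \<open>simp_all add: rc_def defs\<close>)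
  qed
  then show ?case by blast
next
  case (mu n g)
  \<comment> \<open>\<open>Yr\<close> holds the candidate, followed by a copy of the arguments, so
    that the input of \<open>g\<close> is again a block; \<open>v\<close> holds the value of
    \<open>g\<close> and controls the loop.\<close>
  define Yr where "Yr = b + n + 1"
  define v where "v = b + 2 * n + 2"
  define t where "t = b + 2 * n + 3"
  define B where "B = b + 2 * n + 4"
  note defs = Yr_def t_def v_def B_def
  obtain cg where cg: "computes cg B (Suc n) g" using mu.IH by blast
  define call where "call = Seq (copy_block Yr (B + 1) t (Suc n)) (Seq cg (copy B v t))"
  define pre where "pre = Seq (copy_block (b + 1) (Yr + 1) Yr n) (Seq (clear Yr) call)"
  have call: "\<exists>u. bigstep call s u \<and> u v = g (s Yr # args s (Yr + 1) n) \<and> (\<forall>r<v. u r = s r)" for s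
    using computes_call[OF cg, of Yr t v s] unfolding call_def by (auto simp: defs args_Suc)
  have loop: "\<exists>w. bigstep (Whl v (Seq (Inc Yr) call)) u w \<and> w Yr = (LEAST y. g (y # xs) = 0) \<and> (\<forall>r<b. w r = u r)"
    if "u v = g (u Yr # xs)" "args u (Yr + 1) n = xs" "\<forall>z<u Yr. g (z # xs) \<noteq> 0" for u xs
    using that
  proof (induction "(LEAST y. g (y # xs) = 0) - u Yr" arbitrary: u rule: less_induct)
    case less
    have "length xs = n" using less.prems(2) by auto
    then have ex: "\<exists>y. g (y # xs) = 0" using mu.hyps(2) by blast
    let ?m = "LEAST y. g (y # xs) = 0"
    have m: "g (?m # xs) = 0" by (rule LeastI_ex[OF ex])
    have le: "u Yr \<le> ?m" using less.prems(3) m by (meson not_le)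
    show ?case
    proof (cases "u v = 0")
      case True
      then have "u Yr = ?m" using less.prems(1) le Least_le[of "\<lambda>y. g (y # xs) = 0" "u Yr"] by simp
      then show ?thesis using True bigstep.Whl0[of u v] by (intro exI[of _ u]) simp
    next
      case False
      then have lt: "u Yr < ?m" using le m less.prems(1) by (metis le_neq_implies_less)
      let ?u1 = "u(Yr := Suc (u Yr))"
      obtain u2 where u2: "bigstep call ?u1 u2" "u2 v = g (?u1 Yr # args ?u1 (Yr + 1) n)" "\<forall>r<v. u2 r = ?u1 r"
        using call by blast
      have a1: "args ?u1 (Yr + 1) n = xs" using less.prems(2)
        by (subst less.prems(2)[symmetric]) (rule args_cong, simp add: defs)
      have y2: "u2 Yr = Suc (u Yr)" using u2(3) by (simp add: defs)
      have "\<exists>w. bigstep (Whl v (Seq (Inc Yr) call)) u2 w \<and> w Yr = ?m \<and> (\<forall>r<b. w r = u2 r)"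
      proof (rule less.hyps)
        show "?m - u2 Yr < ?m - u Yr" using lt y2 by simp
        show "u2 v = g (u2 Yr # xs)" using u2(2) a1 y2 by simp
        show "args u2 (Yr + 1) n = xs" using u2(3)
          by (subst less.prems(2)[symmetric]) (rule args_cong, simp add: defs)
        show "\<forall>z<u2 Yr. g (z # xs) \<noteq> 0" using less.prems(1,3) False y2 by (auto simp: less_Suc_eq)
      qed
      then obtain w where w: "bigstep (Whl v (Seq (Inc Yr) call)) u2 w" "w Yr = ?m" "\<forall>r<b. w r = u2 r" by blast
      have "bigstep (Whl v (Seq (Inc Yr) call)) u w"
        using bigstep.Whl[OF _ bigstep.Seq[OF bigstep.Inc u2(1)] w(1)] False by simp
      then show ?thesis using w u2(3) by (intro exI[of _ w]) (auto simp: defs)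
    qed
  qed
  have "computes (Seq pre (Seq (Whl v (Seq (Inc Yr) call)) (copy Yr b t))) b n (\<lambda>xs. LEAST y. g (y # xs) = 0)"
    unfolding computes_def
  proof
    fix s
    let ?xs = "args s (b + 1) n"
    obtain s1 where s1: "bigstep (copy_block (b + 1) (Yr + 1) Yr n) s s1" "\<forall>i<n. s1 (Yr + 1 + i) = s (b + 1 + i)"
      "\<forall>r. r \<noteq> Yr \<longrightarrow> \<not> (Yr + 1 \<le> r \<and> r < Yr + 1 + n) \<longrightarrow> s1 r = s r"
      using bigstep_cpb[of "b + 1" n Yr "Yr + 1" s] by (auto simp: defs)
    let ?s2 = "s1(Yr := 0)"
    obtain u where u: "bigstep call ?s2 u" "u v = g (?s2 Yr # args ?s2 (Yr + 1) n)" "\<forall>r<v. u r = ?s2 r" using call by blast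
    have p: "bigstep pre s u" unfolding pre_def by (rule bigstep.Seq[OF s1(1) bigstep.Seq[OF bigstep_clr u(1)]])
    have a: "args ?s2 (Yr + 1) n = ?xs" using s1(2) by (intro args_cong) simp
    have au: "args u (Yr + 1) n = ?xs" using u(3) s1(2) by (intro args_cong) (simp add: defs)
    have y: "u Yr = 0" using u(3) by (simp add: defs)
    obtain w where w: "bigstep (Whl v (Seq (Inc Yr) call)) u w" "w Yr = (LEAST y. g (y # ?xs) = 0)" "\<forall>r<b. w r = u r"
      using loop[of u ?xs] u(2) a au y by auto
    have "bigstep (copy Yr b t) w (w(b := w Yr, t := 0))" by (rule bigstep_cpy) (auto simp: defs)
    then have b: "bigstep (Seq pre (Seq (Whl v (Seq (Inc Yr) call)) (copy Yr b t))) s (w(b := w Yr, t := 0))"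
      using p w(1) by (intro bigstep.Seq)
    have e: "\<forall>r<b. w r = s r" using w(3) u(3) s1(3) by (simp add: defs)
    show "\<exists>t'. bigstep (Seq pre (Seq (Whl v (Seq (Inc Yr) call)) (copy Yr b t))) s t' \<and>
        t' b = (LEAST y. g (y # ?xs) = 0) \<and> (\<forall>r<b. t' r = s r)"
      by (intro exI, intro conjI, rule b) (use e w(2) in \<open>simp_all add: defs\<close>)
  qed
  then show ?case by blast
qed

section \<open>A universal function\<close>

instance com :: countable by countable_datatype

text \<open>The continuations that can arise while \<open>c\<close> runs in front of
  \<open>K\<close>. Each belongs to a subcommand, so the control is finite although control states
  are lists of commands.\<close>

fun control_states :: "com \<Rightarrow> com list \<Rightarrow> com list set" where
  "control_states (Seq a b) K = insert (Seq a b # K) (control_states a (b # K) \<union> control_states b K)"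
| "control_states (Whl r c) K = insert (Whl r c # K) (control_states c (Whl r c # K))"
| "control_states c K = {c # K}"

lemma finite_control_states: "finite (control_states c K)" by (induction c K rule: control_states.induct) auto

lemma control_states_self: "c # K \<in> control_states c K" by (cases c) auto

lemma control_states_not_Nil: "[] \<notin> control_states c K" by (induction c K rule: control_states.induct) auto

lemma control_states_ent: "K' \<in> control_states c K \<Longrightarrow> entry P K' = (d, a, K1, b, K2, g) \<Longrightarrow>
    K1 \<in> insert K (control_states c K) \<and> K2 \<in> insert K (control_states c K)"
  by (induction c K rule: control_states.induct) (auto simp: control_states_self)

lemma control_states_bnd: "K' \<in> control_states c K \<Longrightarrow> regs_below c N \<Longrightarrow> regs_below (hd K') N"
  by (induction c K rule: control_states.induct) auto

lemma entry_bounds: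
  assumes "regs_below (hd K) N" "K \<noteq> []" "entry (prime_nr N) K = (d, a, K1, b, K2, g)"
  shows "0 < d" "d < a" "d < prime_nr N" "prime_nr N \<le> a" "b = prime_nr N" "g \<Longrightarrow> d = 1 \<and> a \<noteq> b"
proof -
  obtain c K' where K: "K = c # K'" using assms(2) by (cases K) auto
  have P: "1 < prime_nr N" by (rule prime_nr_gt1)
  have m: "prime_nr N < prime_nr r * prime_nr N" "prime_nr r < prime_nr r * prime_nr N" "0 < prime_nr r" for r
    using prime_nr_gt1[of r] P by auto
  have m1: "1 < prime_nr r * prime_nr N" "prime_nr N \<le> prime_nr r * prime_nr N" for r
    using m(1)[of r] P by (metis less_trans, simp)
  have lt: "r < N \<Longrightarrow> prime_nr r < prime_nr N" for r by (rule prime_nr_less)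
  have "0 < d \<and> d < a \<and> d < prime_nr N \<and> prime_nr N \<le> a \<and> b = prime_nr N \<and> (g \<longrightarrow> d = 1 \<and> a \<noteq> b)"
  proof (cases c)
    case (Inc r)
    define z where "z = prime_nr r * prime_nr N"
    with Inc have "d = 1" "a = z" "b = prime_nr N" "\<not> g" using assms(3) K z_def by auto
    then show ?thesis using P m1[of r, folded z_def] by simp
  next
    case (Dec r)
    then have "d = prime_nr r" "a = prime_nr N" "b = prime_nr N" "\<not> g" "r < N" using assms(1,3) K by auto
    then show ?thesis using m(3)[of r] lt by simp
  next
    case (Seq x y)
    then have "d = 1" "a = prime_nr N" "b = prime_nr N" "\<not> g" using assms(3) K by auto
    then show ?thesis using P by simp
  next
    case (Whl r x)
    define z where "z = prime_nr r * prime_nr N"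
    with Whl have "d = prime_nr r" "a = z" "b = prime_nr N" "\<not> g" "r < N" using assms(1,3) K z_def by auto
    then show ?thesis using m[of r, folded z_def] m1[of r, folded z_def] lt by simp
  next
    case (Guess r)
    define z where "z = prime_nr r * prime_nr N"
    with Guess have "d = 1" "a = z" "b = prime_nr N" using assms(3) K z_def by auto
    then show ?thesis using P m(1)[of r, folded z_def] m1[of r, folded z_def] by simp
  qed
  then show "0 < d" "d < a" "d < prime_nr N" "prime_nr N \<le> a" "b = prime_nr N" "g \<Longrightarrow> d = 1 \<and> a \<noteq> b" by auto
qed

lemma rec_nary_computes: "rec_nary n f \<Longrightarrow> \<exists>c. computes c b n f"
proof -
  assume "rec_nary n f"
  then obtain g where g: "total_rec n g" "\<And>xs. length xs = n \<Longrightarrow> g xs = f xs" unfolding rec_nary_def by blast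
  obtain c where "computes c b n g" using computes_compile[OF g(1)] by blast
  then show ?thesis unfolding computes_def using g(2) by auto
qed

text \<open>Registers: 0 the code of a program, 1 its argument, 2 the bound \<open>c\<close>, 3 the result of the last
  test, 4 the number of guesses left, 5 the guessed number, 6 scratch; calls use 7 and above.\<close>

abbreviation vcall :: "com \<Rightarrow> com" where
  "vcall cf \<equiv> Seq (copy_block 0 (7 + 1) 6 3) (Seq cf (copy 7 3 6))"
definition vloop :: "com \<Rightarrow> com" where "vloop cf = Whl 3 (Seq (vcall cf) (Inc 2))"
definition vprog :: "com \<Rightarrow> com" where "vprog cf = Seq (clear 2) (Seq (clear 3) (Seq (Inc 3) (vloop cf)))"

context
  fixes cf :: com and f :: "nat list \<Rightarrow> nat" and N :: nat
  assumes cf: "computes cf 7 3 f" and N: "7 < N" "regs_below (vprog cf) N"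
begin

abbreviation leads where "leads \<equiv> (forced (wstep (prime_nr N)))\<^sup>+\<^sup>+"

lemma bnds: "regs_below (vloop cf) N" "regs_below (Seq (vcall cf) (Inc 2)) N"
  using N(2) by (auto simp: vprog_def vloop_def)

lemma verify_iter:
  assumes "regs N n s" "s 0 = e" "s 1 = y" "s 2 = c" "0 < s 3"
  shows "\<exists>n' s'. leads (vloop cf # K, n) (vloop cf # K, n') \<and> regs N n' s' \<and> s' 0 = e \<and> s' 1 = y \<and>
     s' 2 = Suc c \<and> s' 3 = f [e, y, c]"
proof -
  obtain u where u: "bigstep (vcall cf) s u" "u 3 = f (args s 0 3)" "\<forall>r<7. r \<noteq> 3 \<longrightarrow> r \<noteq> 6 \<longrightarrow> u r = s r"
    using computes_call[OF cf, of 0 6 3 s] by auto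
  have a: "args s 0 3 = [e, y, c]" using assms by (simp add: args_def numeral_3_eq_3 numeral_2_eq_2)
  let ?s = "u(2 := Suc (u 2))"
  have b: "bigstep (Seq (vcall cf) (Inc 2)) s ?s" by (rule bigstep.Seq[OF u(1) bigstep.Inc])
  have d: "prime_nr 3 dvd n" using regs_zero[OF assms(1), of 3] N assms(5) by auto
  then have e: "n div prime_nr 3 * (prime_nr 3 * prime_nr N) = n * prime_nr N" by (metis dvd_div_mult_self mult.assoc)
  have 1: "leads (vloop cf # K, n) (Seq (vcall cf) (Inc 2) # vloop cf # K, n * prime_nr N)"
    using forced_Whl[of "prime_nr N" 3 "Seq (vcall cf) (Inc 2)" K n] d e unfolding vloop_def by auto
  obtain n' where n': "regs N n' ?s" "leads (Seq (vcall cf) (Inc 2) # vloop cf # K, n * prime_nr N) (vloop cf # K, n')"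
    using bigstep_leads[OF b bnds(2) regs_grow[OF assms(1)]] by blast
  have "leads (vloop cf # K, n) (vloop cf # K, n')" using 1 n'(2) by (rule tranclp_trans)
  moreover have "?s 0 = e" "?s 1 = y" "?s 2 = Suc c" "?s 3 = f [e, y, c]" using u a assms by auto
  ultimately show ?thesis using n'(1) by blast
qed

lemma verify_start:
  assumes "regs N n s" "s 0 = e" "s 1 = y"
  shows "\<exists>n' s'. leads (vprog cf # K, n) (vloop cf # K, n') \<and> regs N n' s' \<and> s' 0 = e \<and> s' 1 = y \<and> s' 2 = 0 \<and> 0 < s' 3"
proof -
  have B: "regs_below (clear 2) N" "regs_below (clear 3) N" "regs_below (Inc 3) N" using N by (auto simp: clear_def)
  have 1: "leads (vprog cf # K, n) (clear 2 # Seq (clear 3) (Seq (Inc 3) (vloop cf)) # K, n * prime_nr N)"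
    unfolding vprog_def using forced_Seq by blast
  obtain n1 where n1: "regs N n1 (s(2 := 0))"
    "leads (clear 2 # Seq (clear 3) (Seq (Inc 3) (vloop cf)) # K, n * prime_nr N) (Seq (clear 3) (Seq (Inc 3) (vloop cf)) # K, n1)"
    using bigstep_leads[OF bigstep_clr B(1) regs_grow[OF assms(1)]] by blast
  have 2: "leads (Seq (clear 3) (Seq (Inc 3) (vloop cf)) # K, n1) (clear 3 # Seq (Inc 3) (vloop cf) # K, n1 * prime_nr N)"
    using forced_Seq by blast
  obtain n2 where n2: "regs N n2 ((s(2 := 0))(3 := 0))"
    "leads (clear 3 # Seq (Inc 3) (vloop cf) # K, n1 * prime_nr N) (Seq (Inc 3) (vloop cf) # K, n2)"
    using bigstep_leads[OF bigstep_clr B(2) regs_grow[OF n1(1)]] by blast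
  have 3: "leads (Seq (Inc 3) (vloop cf) # K, n2) (Inc 3 # vloop cf # K, n2 * prime_nr N)" using forced_Seq by blast
  let ?s2 = "(s(2 := 0))(3 := 0)"
  obtain n3 where n3: "regs N n3 (?s2(3 := Suc (?s2 3)))" "leads (Inc 3 # vloop cf # K, n2 * prime_nr N) (vloop cf # K, n3)"
    using bigstep_leads[OF bigstep.Inc B(3) regs_grow[OF n2(1)]] by blast
  have "leads (vprog cf # K, n) (vloop cf # K, n3)"
    using 1 n1(2) 2 n2(2) 3 n3(2) by (meson tranclp_trans)
  moreover have "(?s2(3 := Suc (?s2 3))) 0 = e" "(?s2(3 := Suc (?s2 3))) 1 = y" "(?s2(3 := Suc (?s2 3))) 2 = 0"
    "0 < (?s2(3 := Suc (?s2 3))) 3" using assms by auto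
  ultimately show ?thesis using n3(1) by blast
qed

lemma verify_forever:
  assumes "regs N n s" "s 0 = e" "s 1 = y" "\<forall>c. f [e, y, c] \<noteq> 0"
  shows "\<exists>m. leads (vprog cf # K, n) (vloop cf # K, m 0) \<and> (\<forall>j. leads (vloop cf # K, m j) (vloop cf # K, m (Suc j)))"
proof -
  obtain n0 s0 where n0: "leads (vprog cf # K, n) (vloop cf # K, n0)" "regs N n0 s0" "s0 0 = e" "s0 1 = y" "0 < s0 3"
    using verify_start[OF assms(1-3)] by blast
  have "\<exists>m. \<forall>j. ((\<exists>s. regs N (m j) s \<and> s 0 = e \<and> s 1 = y \<and> 0 < s 3) \<and> (j = 0 \<longrightarrow> m j = n0)) \<and>
      leads (vloop cf # K, m j) (vloop cf # K, m (Suc j))"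
  proof (rule dependent_nat_choice)
    show "\<exists>x. (\<exists>s. regs N x s \<and> s 0 = e \<and> s 1 = y \<and> 0 < s 3) \<and> (0 = (0::nat) \<longrightarrow> x = n0)" using n0 by blast
    fix x and j :: nat
    assume "(\<exists>s. regs N x s \<and> s 0 = e \<and> s 1 = y \<and> 0 < s 3) \<and> (j = 0 \<longrightarrow> x = n0)"
    then obtain s where s: "regs N x s" "s 0 = e" "s 1 = y" "0 < s 3" by blast
    from verify_iter[OF s(1-3) refl s(4), of K] assms(4)
    show "\<exists>x'. ((\<exists>s. regs N x' s \<and> s 0 = e \<and> s 1 = y \<and> 0 < s 3) \<and> (Suc j = 0 \<longrightarrow> x' = n0)) \<and>
        leads (vloop cf # K, x) (vloop cf # K, x')" by (metis Zero_not_Suc neq0_conv)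
  qed
  then show ?thesis using n0(1) by metis
qed

text \<open>Induction on the distance of the counter from the given zero; the loop may stop earlier
  at another zero, which does no harm.\<close>

lemma verify_halts:
  assumes "regs N n s" "s 0 = e" "s 1 = y" "f [e, y, c] = 0"
  shows "\<exists>n'. leads (vprog cf # K, n) (K, n')"
proof -
  obtain n0 s0 where n0: "leads (vprog cf # K, n) (vloop cf # K, n0)" "regs N n0 s0" "s0 0 = e" "s0 1 = y" "s0 2 = 0" "0 < s0 3"
    using verify_start[OF assms(1-3)] by blast
  have "\<exists>n'. leads (vloop cf # K, n0) (K, n')"
    if "regs N n0 s0" "s0 0 = e" "s0 1 = y" "s0 2 + k = c" "0 < s0 3" for k n0 s0
    using that
  proof (induction k arbitrary: n0 s0)
    case (0 n0 s0)
    from verify_iter[OF 0(1-3) refl 0(5), of K] obtain n1 s1 where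
      n1: "leads (vloop cf # K, n0) (vloop cf # K, n1)" "regs N n1 s1" "s1 3 = 0" using 0(4) assms(4) by auto
    have "\<not> prime_nr 3 dvd n1" using regs_zero[OF n1(2), of 3] N n1(3) by auto
    then have "leads (vloop cf # K, n1) (K, n1 * prime_nr N)"
      using forced_Whl[of "prime_nr N" 3 "Seq (vcall cf) (Inc 2)" K n1] unfolding vloop_def by auto
    then show ?case using n1(1) by (meson tranclp_trans)
  next
    case (Suc k n0 s0)
    from verify_iter[OF Suc.prems(1-3) refl Suc.prems(5), of K] obtain n1 s1 where
      n1: "leads (vloop cf # K, n0) (vloop cf # K, n1)" "regs N n1 s1" "s1 0 = e" "s1 1 = y" "s1 2 = Suc (s0 2)"
        "s1 3 = f [e, y, s0 2]" by auto
    show ?case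
    proof (cases "s1 3 = 0")
      case True
      then have "\<not> prime_nr 3 dvd n1" using regs_zero[OF n1(2), of 3] N by auto
      then have "leads (vloop cf # K, n1) (K, n1 * prime_nr N)"
        using forced_Whl[of "prime_nr N" 3 "Seq (vcall cf) (Inc 2)" K n1] unfolding vloop_def by auto
      then show ?thesis using n1(1) by (meson tranclp_trans)
    next
      case False
      have "\<exists>n'. leads (vloop cf # K, n1) (K, n')"
        by (rule Suc.IH[OF n1(2-4)]) (use n1(5) Suc.prems(4) False in auto)
      then show ?thesis using n1(1) by (meson tranclp_trans)
    qed
  qed
  from this[OF n0(2-4) _ n0(6), of c] obtain n' where "leads (vloop cf # K, n0) (K, n')" using n0(5) by auto
  then show ?thesis using n0(1) by (meson tranclp_trans)
qed

end

text \<open>A total deterministic version of \<open>wstep\<close> for the interpreter: it agrees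
  with forced steps and stays in \<open>[]\<close> once it is there.\<close>

definition wnext :: "nat \<Rightarrow> com list \<times> nat \<Rightarrow> com list \<times> nat" where
  "wnext P c = (case entry P (fst c) of (d, a, K1, b, K2, g) \<Rightarrow>
     if d dvd snd c then (K1, snd c div d * a) else (K2, snd c * b))"

lemma wstep_wnext: "fst c \<noteq> [] \<Longrightarrow> wstep P c (wnext P c)"
  unfolding wstep_def wnext_def by (auto split: prod.splits)

lemma forced_wnext:
  assumes "forced (wstep P) c c'" shows "wnext P c = c' \<and> fst c \<noteq> []"
proof -
  have "wstep P c c'" using assms unfolding forced_def by blast
  then have "fst c \<noteq> []" by (simp add: wstep_def)
  then show ?thesis using wstep_wnext[of c P] assms unfolding forced_def by blast
qed

lemma wnext_Nil: "fst c = [] \<Longrightarrow> fst (wnext P c) = []" by (simp add: wnext_def)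

lemma leads_wnext: "(forced (wstep P))\<^sup>+\<^sup>+ c c' \<Longrightarrow> \<exists>t>0. (wnext P ^^ t) c = c'"
proof (induction rule: tranclp_induct)
  case (base c')
  then show ?case using forced_wnext by (intro exI[of _ 1]) auto
next
  case (step c' c'')
  then obtain t where "t > 0" "(wnext P ^^ t) c = c'" by blast
  then show ?case using forced_wnext[OF step(2)] by (intro exI[of _ "Suc t"]) auto
qed

text \<open>The interpreter reads a table of entries \<open>entry P K\<close> in which control states are replaced by
  their indices; the halting state has index 0.\<close>

definition ustep :: "nat \<Rightarrow> nat \<Rightarrow> nat" where
  "ustep tb st = (if pi1 (pi1 (lnth tb (pi1 st))) dvd pi2 st
     then pr (pi1 (pi2 (lnth tb (pi1 st)))) (pi2 st div pi1 (pi1 (lnth tb (pi1 st))) * pi2 (pi1 (lnth tb (pi1 st))))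
     else pr (pi2 (pi2 (pi2 (lnth tb (pi1 st))))) (pi2 st * pi1 (pi2 (pi2 (lnth tb (pi1 st))))))"

text \<open>\<open>e\<close> consists of the table, the start state and the base of the power that
  encodes \<open>y\<close>. The value is the index of the control state after \<open>c\<close>
  steps, so 0 means that the program has halted.\<close>

definition universal :: "nat \<Rightarrow> nat \<Rightarrow> nat \<Rightarrow> nat" where
  "universal e y c = pi1 (rec_nat (pr (pi1 (pi2 e)) (pi2 (pi2 e) ^ y)) (\<lambda>_ st. ustep (pi1 e) st) c)"

lemma rec_nary_universal: "rec_nary 3 (\<lambda>xs. universal (xs ! 0) (xs ! 1) (xs ! 2))"
proof -
  have c: "computable (\<lambda>z. universal (pi1 z) (pi1 (pi2 z)) (pi2 (pi2 z)))"
    unfolding universal_def ustep_def by (intro computable_intros)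
  have "rec_nary 3 (\<lambda>xs. pr (xs ! 0) (pr (xs ! 1) (xs ! 2)))" by (intro rec_nary_pr rec_nary_proj; simp)
  from rec_nary_comp1[OF c this] show ?thesis by simp
qed

text \<open>Only the statements quantified over \<open>c\<close> correspond, not the single
  instances. A program that tests \<open>R (pr y 0)\<close>, \<open>R (pr y 1)\<close>, \<dots> in
  turn runs forever iff all tests succeed, and \<open>universal\<close> watches whether it has
  halted after \<open>c\<close> steps.\<close>

lemma universal_complete:
  fixes R :: "nat \<Rightarrow> bool"
  assumes R: "decidable R"
  shows "\<exists>e. \<forall>y. (\<forall>c. R (pr y c)) \<longleftrightarrow> (\<forall>c. universal e y c \<noteq> 0)"
proof -
  define f where "f xs = (if R (pr (xs ! 1) (xs ! 2)) then 1 else 0::nat)" for xs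
  have "rec_nary 3 f" unfolding f_def
    by (rule rec_nary_comp1[OF R[unfolded decidable_def]]) (intro rec_nary_pr rec_nary_proj; simp)
  then obtain cf where cf: "computes cf 7 3 f" using rec_nary_computes by blast
  obtain N0 where "regs_below (vprog cf) N0" using regs_below_ex by blast
  then obtain N where N: "7 < N" "regs_below (vprog cf) N" using regs_below_mono[of "vprog cf" N0 "max 8 N0"]
    by (intro that[of "max 8 N0"]) auto
  let ?P = "prime_nr N"
  define S where "S = insert [] (control_states (vprog cf) [])"
  obtain ks0 where ks0: "set ks0 = control_states (vprog cf) []" "distinct ks0"
    using finite_distinct_list[OF finite_control_states] by blast
  \<comment> \<open>\<open>[]\<close> heads the list so that the halting state gets index 0.\<close>
  define ks where "ks = [] # ks0"
  have ks: "set ks = S" "distinct ks" using ks0 control_states_not_Nil by (auto simp: ks_def S_def)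
  define idx where "idx K = (THE i. i < length ks \<and> ks ! i = K)" for K
  have idx: "idx K < length ks \<and> ks ! idx K = K" if "K \<in> S" for K
  proof -
    have "\<exists>!i. i < length ks \<and> ks ! i = K"
      using that ks by (metis in_set_conv_nth nth_eq_iff_index_eq)
    then show ?thesis unfolding idx_def by (rule theI')
  qed
  have idx0: "idx K = 0 \<longleftrightarrow> K = []" if "K \<in> S" for K
  proof -
    have "idx [] < length ks" "ks ! idx [] = ks ! 0" using idx[of "[]"] by (auto simp: S_def ks_def)
    moreover have "ks \<noteq> []" by (simp add: ks_def)
    ultimately have "idx [] = 0" using nth_eq_iff_index_eq[OF ks(2), of "idx []" 0] by auto
    then show ?thesis using idx[OF that] by (auto simp: ks_def)
  qed
  define tb where "tb = list_encode (map (\<lambda>K. case entry ?P K of (d, a, K1, b, K2, g) \<Rightarrow>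
     pr (pr d a) (pr (idx K1) (pr b (idx K2)))) ks)"
  have closed: "K1 \<in> S \<and> K2 \<in> S" if K: "K \<in> S" "entry ?P K = (d, a, K1, b, K2, g)" for K d a K1 b K2 g
    using K control_states_ent[of K "vprog cf" "[]" ?P] by (cases "K = []") (auto simp: S_def)
  have sim: "ustep tb (pr (idx K) n) = pr (idx (fst (wnext ?P (K, n)))) (snd (wnext ?P (K, n))) \<and> fst (wnext ?P (K, n)) \<in> S"
    if K: "K \<in> S" for K n
  proof -
    obtain d a K1 b K2 g where e: "entry ?P K = (d, a, K1, b, K2, g)" by (metis prod_cases6)
    have "lnth tb (idx K) = pr (pr d a) (pr (idx K1) (pr b (idx K2)))"
      using idx[OF K] e by (simp add: tb_def lnth_eq)
    then show ?thesis using closed[OF K e] e by (simp add: ustep_def wnext_def)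
  qed
  \<comment> \<open>With the base \<open>prime_nr 1\<close>, the power with exponent
    \<open>y\<close> puts \<open>y\<close> into register 1, where \<open>vprog\<close> expects its
    argument.\<close>
  define e where "e = pr tb (pr (idx [vprog cf]) (prime_nr 1))"
  have D: "[vprog cf] \<in> S" using control_states_self by (simp add: S_def)
  have it: "rec_nat (pr (idx [vprog cf]) (prime_nr 1 ^ y)) (\<lambda>_ st. ustep tb st) c =
     pr (idx (fst ((wnext ?P ^^ c) ([vprog cf], prime_nr 1 ^ y)))) (snd ((wnext ?P ^^ c) ([vprog cf], prime_nr 1 ^ y))) \<and>
     fst ((wnext ?P ^^ c) ([vprog cf], prime_nr 1 ^ y)) \<in> S" for y c
  proof (induction c)
    case (Suc c)
    then show ?case using sim[of "fst ((wnext ?P ^^ c) ([vprog cf], prime_nr 1 ^ y))" "snd ((wnext ?P ^^ c) ([vprog cf], prime_nr 1 ^ y))"]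
      by simp
  qed (use D in simp)
  have u: "universal e y c \<noteq> 0 \<longleftrightarrow> fst ((wnext ?P ^^ c) ([vprog cf], prime_nr 1 ^ y)) \<noteq> []" for y c
    unfolding universal_def using it[of y c] idx0 by (simp add: e_def)
  have "(\<forall>c. R (pr y c)) \<longleftrightarrow> (\<forall>c. universal e y c \<noteq> 0)" for y
  proof -
    let ?n = "prime_nr 1 ^ y"
    have "0 < ?n" using prime_nr_gt1[of 1] by simp
    then have rg: "regs N ?n (reg ?n)" by (simp add: regs_def)
    have r1: "reg ?n 1 = y" by (simp add: reg_power)
    have fR: "f [reg ?n 0, y, c] \<noteq> 0 \<longleftrightarrow> R (pr y c)" for c by (simp add: f_def)
    show ?thesis
    proof
      assume "\<forall>c. R (pr y c)"
      then have "\<forall>c. f [reg ?n 0, y, c] \<noteq> 0" using fR by blast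
      from verify_forever[OF cf N rg refl r1 this, of "[]"] obtain m where
        m: "(forced (wstep ?P))\<^sup>+\<^sup>+ ([vprog cf], ?n) ([vloop cf], m 0)"
          "\<And>j. (forced (wstep ?P))\<^sup>+\<^sup>+ ([vloop cf], m j) ([vloop cf], m (Suc j))" by blast
      have far: "\<exists>t\<ge>j. (wnext ?P ^^ t) ([vprog cf], ?n) = ([vloop cf], m j)" for j :: nat
      proof (induction j)
        case 0 then show ?case using leads_wnext[OF m(1)] by auto
      next
        case (Suc j)
        then obtain t where t: "t \<ge> j" "(wnext ?P ^^ t) ([vprog cf], ?n) = ([vloop cf], m j)" by blast
        obtain t' where "t' > 0" "(wnext ?P ^^ t') ([vloop cf], m j) = ([vloop cf], m (Suc j))"
          using leads_wnext[OF m(2)] by blast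
        then show ?case using t by (intro exI[of _ "t' + t"]) (auto simp: funpow_add)
      qed
      show "\<forall>c. universal e y c \<noteq> 0" unfolding u
      proof
        fix c
        show "fst ((wnext ?P ^^ c) ([vprog cf], ?n)) \<noteq> []"
        proof
          assume z: "fst ((wnext ?P ^^ c) ([vprog cf], ?n)) = []"
          have "fst ((wnext ?P ^^ (d + c)) ([vprog cf], ?n)) = []" for d
            by (induction d) (use z in \<open>simp_all add: wnext_Nil\<close>)
          moreover obtain t where "t \<ge> c" "(wnext ?P ^^ t) ([vprog cf], ?n) = ([vloop cf], m c)" using far by blast
          ultimately show False by (metis fst_conv le_add_diff_inverse2 list.distinct(1))
        qed
      qed
    next
      assume all: "\<forall>c. universal e y c \<noteq> 0"
      show "\<forall>c. R (pr y c)"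
      proof (rule ccontr)
        assume "\<not> (\<forall>c. R (pr y c))"
        then obtain c where "f [reg ?n 0, y, c] = 0" using fR by blast
        from verify_halts[OF cf N rg refl r1 this, of "[]"] obtain n' where
          "(forced (wstep ?P))\<^sup>+\<^sup>+ ([vprog cf], ?n) ([], n')" by blast
        then obtain t where "(wnext ?P ^^ t) ([vprog cf], ?n) = ([], n')" using leads_wnext by blast
        then show False using all u[of y t] by simp
      qed
    qed
  qed
  then show ?thesis by blast
qed

section \<open>Guessing and the theorem\<close>

lemma derived_empty: "derived {} k = {}" using derived_subset by blast

text \<open>The block handed over consists of the registers 1 to 5; its entries 0 and 4 are the
  argument and the guessed number.\<close>

definition pairf :: "nat list \<Rightarrow> nat" where "pairf xs = pr (xs ! 0) (xs ! 4)"
definition pcall :: "com \<Rightarrow> com" where "pcall cp = Seq (copy_block 1 (7 + 1) 6 5) (Seq cp (copy 7 1 6))"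
definition gbody :: "com \<Rightarrow> com" where "gbody cp = Seq (Dec 4) (Seq (clear 5) (Seq (Guess 5) (pcall cp)))"
definition gloop :: "com \<Rightarrow> com" where "gloop cp = Whl 4 (gbody cp)"
definition main_prog :: "com \<Rightarrow> com \<Rightarrow> com" where "main_prog cf cp = Seq (Inc 6) (Seq (gloop cp) (vprog cf))"

context
  fixes cf cp :: com and f :: "nat list \<Rightarrow> nat" and N :: nat
  assumes cf: "computes cf 7 3 f" and cp: "computes cp 7 5 pairf" and N: "7 < N" "regs_below (main_prog cf cp) N"
begin

abbreviation wst where "wst \<equiv> wstep (prime_nr N)"

lemma bnds': "regs_below (vprog cf) N" "regs_below (pcall cp) N" "regs_below (Dec 4) N" "regs_below (clear 5) N"
  using N by (auto simp: main_prog_def gloop_def gbody_def)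

text \<open>If all tests succeed, every step is forced and there is exactly one run; if one fails,
  the program halts and there is none. The universal statement thus becomes non-emptiness at
  derivative 0.\<close>

lemma verify_rank:
  assumes r: "regs N n s" "s 0 = e" "s 1 = y"
  shows "derived (runs wst ([vprog cf], n)) (Suc 0) = {}"
    "runs wst ([vprog cf], n) \<noteq> {} \<longleftrightarrow> (\<forall>c. f [e, y, c] \<noteq> 0)"
proof -
  have *: "derived (runs wst ([vprog cf], n)) (Suc 0) = {} \<and> (runs wst ([vprog cf], n) \<noteq> {} \<longleftrightarrow> (\<forall>c. f [e, y, c] \<noteq> 0))"
  proof (cases "\<forall>c. f [e, y, c] \<noteq> 0")
    case True
    from verify_forever[OF cf N(1) bnds'(1) r True, of "[]"] obtain m where
      m: "(forced wst)\<^sup>+\<^sup>+ ([vprog cf], n) ([vloop cf], m 0)"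
        "\<And>j. (forced wst)\<^sup>+\<^sup>+ ([vloop cf], m j) ([vloop cf], m (Suc j))" by blast
    have l: "(forced wst)\<^sup>*\<^sup>* ([vprog cf], n) ([vloop cf], m 0)" using m(1) by simp
    have "derived (runs wst ([vloop cf], m 0)) (Suc 0) = {}"
      using derived_runs_progress[of wst "\<lambda>j. ([vloop cf], m j)"] m(2) by blast
    moreover have "runs wst ([vloop cf], m 0) \<noteq> {}"
      using runs_nonempty_if_progress[of wst "\<lambda>j. ([vloop cf], m j)"] m(2) by blast
    ultimately show ?thesis
      using derived_runs_leads[OF l, of "Suc 0"] derived_runs_leads[OF l, of 0] True unfolding derived.simps(1) by blast
  next
    case False
    then obtain c where "f [e, y, c] = 0" by blast
    from verify_halts[OF cf N(1) bnds'(1) r this, of "[]"] obtain n' where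
      "(forced wst)\<^sup>+\<^sup>+ ([vprog cf], n) ([], n')" by blast
    then have l: "(forced wst)\<^sup>*\<^sup>* ([vprog cf], n) ([], n')" by simp
    have "runs wst ([], n') = {}" by (auto simp: runs_def) (metis step_Nil)
    then have "derived (runs wst ([], n')) k = {}" for k using derived_empty by simp
    then show ?thesis using derived_runs_leads[OF l, of "Suc 0"] derived_runs_leads[OF l, of 0] False
      unfolding derived.simps(1) by (metis derived.simps(1))
  qed
  then show "derived (runs wst ([vprog cf], n)) (Suc 0) = {}"
    "runs wst ([vprog cf], n) \<noteq> {} \<longleftrightarrow> (\<forall>c. f [e, y, c] \<noteq> 0)" by blast+
qed

lemma guess_setup:
  assumes r: "regs N n s" "s 4 = Suc k"
  shows "\<exists>n1. (forced wst)\<^sup>+\<^sup>+ (gloop cp # K, n) (Guess 5 # pcall cp # gloop cp # K, n1) \<and> regs N n1 (s(4 := k, 5 := 0))"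
proof -
  let ?G = "gloop cp # K"
  have d: "prime_nr 4 dvd n" using regs_zero[OF r(1), of 4] N r(2) by auto
  then have e: "n div prime_nr 4 * (prime_nr 4 * prime_nr N) = n * prime_nr N" by (metis dvd_div_mult_self mult.assoc)
  have 1: "(forced wst)\<^sup>+\<^sup>+ (?G, n) (gbody cp # ?G, n * prime_nr N)"
    using forced_Whl[of "prime_nr N" 4 "gbody cp" K n] d e unfolding gloop_def by auto
  have 2: "(forced wst)\<^sup>+\<^sup>+ (gbody cp # ?G, n * prime_nr N) (Dec 4 # Seq (clear 5) (Seq (Guess 5) (pcall cp)) # ?G, n * prime_nr N * prime_nr N)"
    unfolding gbody_def using forced_Seq by blast
  obtain n2 where n2: "regs N n2 (s(4 := s 4 - 1))"
    "(forced wst)\<^sup>+\<^sup>+ (Dec 4 # Seq (clear 5) (Seq (Guess 5) (pcall cp)) # ?G, n * prime_nr N * prime_nr N) (Seq (clear 5) (Seq (Guess 5) (pcall cp)) # ?G, n2)"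
    using bigstep_leads[OF bigstep.Dec bnds'(3) regs_grow[OF regs_grow[OF r(1)]]] by blast
  have 3: "(forced wst)\<^sup>+\<^sup>+ (Seq (clear 5) (Seq (Guess 5) (pcall cp)) # ?G, n2) (clear 5 # Seq (Guess 5) (pcall cp) # ?G, n2 * prime_nr N)"
    using forced_Seq by blast
  obtain n3 where n3: "regs N n3 ((s(4 := s 4 - 1))(5 := 0))"
    "(forced wst)\<^sup>+\<^sup>+ (clear 5 # Seq (Guess 5) (pcall cp) # ?G, n2 * prime_nr N) (Seq (Guess 5) (pcall cp) # ?G, n3)"
    using bigstep_leads[OF bigstep_clr bnds'(4) regs_grow[OF n2(1)]] by blast
  have 4: "(forced wst)\<^sup>+\<^sup>+ (Seq (Guess 5) (pcall cp) # ?G, n3) (Guess 5 # pcall cp # ?G, n3 * prime_nr N)"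
    using forced_Seq by blast
  have "(forced wst)\<^sup>+\<^sup>+ (?G, n) (Guess 5 # pcall cp # ?G, n3 * prime_nr N)"
    using 1 2 n2(2) 3 n3(2) 4 by (meson tranclp_trans)
  moreover have "s 4 - 1 = k" using r(2) by simp
  ultimately show ?thesis using regs_grow[OF n3(1)] by auto
qed

lemma guess_exit:
  assumes r: "regs N n s" "s 0 = e" "s 1 = y" "s 4 = k" "s 5 = i"
  shows "\<exists>n' s'. (forced wst)\<^sup>*\<^sup>* (pcall cp # K, n) (K, n') \<and> regs N n' s' \<and> s' 0 = e \<and> s' 1 = pr y i \<and> s' 4 = k"
proof -
  obtain u where u: "bigstep (pcall cp) s u" "u 1 = pairf (args s 1 5)" "\<forall>r<7. r \<noteq> 1 \<longrightarrow> r \<noteq> 6 \<longrightarrow> u r = s r"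
    using computes_call[OF cp, of 1 6 1 s] unfolding pcall_def by auto
  have "pairf (args s 1 5) = pr y i" using r by (simp add: pairf_def args_def)
  moreover obtain n' where "regs N n' u" "(forced wst)\<^sup>+\<^sup>+ (pcall cp # K, n) (K, n')"
    using bigstep_leads[OF u(1) bnds'(2) r(1)] by blast
  ultimately show ?thesis using u r by (intro exI[of _ n'] exI[of _ u]) auto
qed

text \<open>Each guess is a branching as in \<open>derived_runs_branch\<close>: the spine increments
  register 5 forever, and leaving it after \<open>i\<close> increments replaces \<open>y\<close> by
  \<open>pr y i\<close> with \<open>k\<close> guesses still to come. The induction also provides the
  bound on the rank of the branches.\<close>

lemma guess_rank:
  assumes "regs N n s" "s 0 = e" "s 1 = y" "s 4 = k"
  shows "derived (runs wst ([gloop cp, vprog cf], n)) (Suc k) = {} \<and>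
    (derived (runs wst ([gloop cp, vprog cf], n)) k \<noteq> {} \<longleftrightarrow> inf_many (\<lambda>y. \<forall>c. f [e, y, c] \<noteq> 0) k y)"
  using assms
proof (induction k arbitrary: n s y)
  case 0
  have "\<not> prime_nr 4 dvd n" using regs_zero[OF 0(1), of 4] N 0(4) by auto
  then have d: "forced wst ([gloop cp, vprog cf], n) ([vprog cf], n * prime_nr N)"
    using forced_Whl[of "prime_nr N" 4 "gbody cp" "[vprog cf]" n] unfolding gloop_def by auto
  show ?case
    using verify_rank[OF regs_grow[OF 0(1)] 0(2,3)] derived_runs_det[OF d, of "Suc 0"] derived_runs_det[OF d, of 0]
    unfolding derived.simps(1) inf_many.simps by blast
next
  case (Suc k)
  let ?K = "[gloop cp, vprog cf]"
  obtain n1 where n1: "(forced wst)\<^sup>+\<^sup>+ (?K, n) (Guess 5 # pcall cp # ?K, n1)" "regs N n1 (s(4 := k, 5 := 0))"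
    using guess_setup[OF Suc.prems(1,4)] by blast
  have l: "(forced wst)\<^sup>*\<^sup>* (?K, n) (Guess 5 # pcall cp # ?K, n1)" using n1(1) by simp
  define st where "st i = (Guess 5 # pcall cp # ?K, n1 * (prime_nr 5 * prime_nr N) ^ i)" for i
  define v where "v i = (pcall cp # ?K, n1 * (prime_nr 5 * prime_nr N) ^ i * prime_nr N)" for i
  have rg: "regs N (n1 * (prime_nr 5 * prime_nr N) ^ i) (s(4 := k, 5 := i))" for i
  proof (induction i)
    case 0 then show ?case using n1(2) unfolding power_0 mult_1_right .
  next
    case (Suc i)
    have 1: "n1 * (prime_nr 5 * prime_nr N) ^ i * (prime_nr 5 * prime_nr N) = n1 * (prime_nr 5 * prime_nr N) ^ Suc i" by (simp only: power_Suc2 mult.assoc)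
    have 2: "(s(4 := k, 5 := i))(5 := Suc ((s(4 := k, 5 := i)) 5)) = s(4 := k, 5 := Suc i)" by (simp only: fun_upd_upd fun_upd_same)
    show ?case using regs_inc[OF Suc, of 5] unfolding 1 2 .
  qed
  have ex: "derived (runs wst (v i)) (Suc k) = {} \<and> (derived (runs wst (v i)) k \<noteq> {} \<longleftrightarrow> inf_many (\<lambda>y. \<forall>c. f [e, y, c] \<noteq> 0) k (pr y i))" for i
  proof -
    obtain n' s' where n': "(forced wst)\<^sup>*\<^sup>* (v i) (?K, n')" "regs N n' s'" "s' 0 = e" "s' 1 = pr y i" "s' 4 = k"
      using guess_exit[OF regs_grow[OF rg[of i]], of e y k i ?K] Suc.prems unfolding v_def by auto
    show ?thesis using Suc.IH[OF n'(2-5)] derived_runs_leads[OF n'(1)] by blast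
  qed
  have step: "wst (st i) u \<longleftrightarrow> u = st (Suc i) \<or> u = v i" for i u
    unfolding st_def v_def step_Gs by (simp add: mult.assoc mult.commute mult.left_commute)
  have ne: "v i \<noteq> st (Suc i)" for i by (auto simp: v_def st_def pcall_def)
  have "derived (runs wst (st 0)) (Suc k) \<noteq> {} \<longleftrightarrow> (\<exists>\<^sub>\<infinity>i. derived (runs wst (v i)) k \<noteq> {})"
    "derived (runs wst (st 0)) (Suc (Suc k)) = {}"
    using derived_runs_branch[of wst st v k, OF step ne] ex by blast+
  moreover have "st 0 = (Guess 5 # pcall cp # ?K, n1)" by (simp add: st_def)
  ultimately show ?case using derived_runs_leads[OF l, of "Suc k"] derived_runs_leads[OF l, of "Suc (Suc k)"] ex
    unfolding inf_many.simps by (simp del: derived.simps)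
qed

text \<open>The derivatives die out for every start, not only for the intended ones; countability
  needs this for all widths of the seed.\<close>

lemma main_rank:
  assumes "0 < n"
  shows "derived (runs wst ([main_prog cf cp], n)) (Suc (reg n 4)) = {} \<and>
    (derived (runs wst ([main_prog cf cp], n)) (reg n 4) \<noteq> {} \<longleftrightarrow>
      inf_many (\<lambda>y. \<forall>c. f [reg n 0, y, c] \<noteq> 0) (reg n 4) (reg n 1))"
proof -
  have r: "regs N n (reg n)" using assms by (simp add: regs_def)
  let ?n = "n * prime_nr N * (prime_nr 6 * prime_nr N) * prime_nr N"
  have l: "(forced wst)\<^sup>*\<^sup>* ([main_prog cf cp], n) ([gloop cp, vprog cf], ?n)"
    unfolding main_prog_def using forced_Seq forced_Inc by (meson rtranclp.rtrancl_refl rtranclp.rtrancl_into_rtrancl)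
  have "regs N ?n ((reg n)(6 := Suc (reg n 6)))" by (intro regs_grow regs_inc r)
  from guess_rank[OF this refl refl refl] show ?thesis
    using derived_runs_leads[OF l] by (simp del: derived.simps)
qed

end

section \<open>Translation of programs into rules\<close>

text \<open>One rule serves the divisible case, and one rule each remainder, as
  \<open>(d * q + r) * b = (b * d) * q + b * r\<close>. For a guess, where \<open>d = 1\<close>, the
  remainder 0 provides the second choice.\<close>

definition rulesof :: "nat \<Rightarrow> com list \<Rightarrow> com list rule set" where
  "rulesof P K = (case entry P K of (d, a, K1, b, K2, g) \<Rightarrow>
     insert (Rule K d 0 a 0 K1) ((\<lambda>r. Rule K d r (b * d) (b * r) K2) ` {r. r < d \<and> (0 < r \<or> g)}))"

definition mrules :: "nat \<Rightarrow> com \<Rightarrow> com list rule set" where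
  "mrules N c = (\<Union>K\<in>control_states c []. rulesof (prime_nr N) K)"

lemma src_rulesof: "r \<in> rulesof P K \<Longrightarrow> src r = K"
  by (auto simp: rulesof_def split: prod.splits)

lemma mrules_src: "r \<in> mrules N c \<Longrightarrow> src r = K \<Longrightarrow> r \<in> rulesof (prime_nr N) K \<and> K \<in> control_states c []"
  unfolding mrules_def using src_rulesof by blast

lemma mod_unique:
  fixes d q r :: nat
  assumes "d * q + r = d * q' + r'" "r < d" "r' < d"
  shows "q = q' \<and> r = r'"
  using assms by (metis div_mult_self4 mod_mult_self4 mod_less div_less add_cancel_left_right add.commute mult.commute not_less0)

text \<open>A \<open>Seq\<close> at the top gives the start state a single rule. For uniqueness,
  quotient and remainder by \<open>d\<close> are determined by the number, so only the two rules of
  a guess can compete, and these differ in the multiplier.\<close>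

lemma growing_mrules:
  assumes b: "regs_below (Seq x y) N"
  shows "growing_machine (mrules N (Seq x y)) (Rule [Seq x y] 1 0 (prime_nr N) 0 [x, y])"
proof
  let ?c = "Seq x y"
  have bounds: "\<exists>d a K1 b K2 g. entry (prime_nr N) K = (d, a, K1, b, K2, g) \<and> 0 < d \<and> d < a \<and> b = prime_nr N \<and> (g \<longrightarrow> d = 1 \<and> a \<noteq> b)"
    if K: "K \<in> control_states ?c []" for K
  proof -
    obtain d a K1 b' K2 g where e: "entry (prime_nr N) K = (d, a, K1, b', K2, g)" by (metis prod_cases6)
    have "K \<noteq> []" using K control_states_not_Nil by metis
    from entry_bounds[OF control_states_bnd[OF K b] this e] show ?thesis using e by blast
  qed
  have P: "1 < prime_nr N" by (rule prime_nr_gt1)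
  show "finite (mrules N ?c)"
    unfolding mrules_def rulesof_def by (auto simp: finite_control_states split: prod.splits)
  have r: "0 < dv r \<and> dv r < ml r \<and> rm r \<le> ad r" if "r \<in> mrules N ?c" for r
  proof -
    obtain K where K: "K \<in> control_states ?c []" "r \<in> rulesof (prime_nr N) K" using \<open>r \<in> _\<close> unfolding mrules_def by blast
    obtain d a K1 b K2 g where e: "entry (prime_nr N) K = (d, a, K1, b, K2, g)" "0 < d" "d < a" "b = prime_nr N"
      using bounds[OF K(1)] by metis
    show ?thesis using K(2) e P unfolding rulesof_def by auto
  qed
  show "0 < dv r" "dv r < ml r" "rm r \<le> ad r" if "r \<in> mrules N ?c" for r using r[OF that] by blast+
  have r0: "rulesof (prime_nr N) [?c] = {Rule [?c] 1 0 (prime_nr N) 0 [x, y]}" by (auto simp: rulesof_def)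
  show "Rule [?c] 1 0 (prime_nr N) 0 [x, y] \<in> mrules N ?c"
    unfolding mrules_def using control_states_self[of ?c "[]"] r0 by blast
  show "r = Rule [?c] 1 0 (prime_nr N) 0 [x, y]"
    if "r \<in> mrules N ?c" "src r = src (Rule [?c] 1 0 (prime_nr N) 0 [x, y])" for r
    using mrules_src[OF that(1), of "[?c]"] that(2) r0 by simp
  fix r r' q q'
  assume rr: "r \<in> mrules N ?c" "r' \<in> mrules N ?c" "src r = src r'" "tgt r = tgt r'" "1 \<le> q" "1 \<le> q'"
    "dv r * q + rm r = dv r' * q' + rm r'" "ml r * q + ad r = ml r' * q' + ad r'"
  define K where "K = src r"
  have K: "r \<in> rulesof (prime_nr N) K" "r' \<in> rulesof (prime_nr N) K" "K \<in> control_states ?c []"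
    using mrules_src[OF rr(1)] mrules_src[OF rr(2)] rr(3) K_def by auto
  obtain d a K1 b K2 g where e: "entry (prime_nr N) K = (d, a, K1, b, K2, g)" "0 < d" "d < a" "b = prime_nr N" "g \<longrightarrow> d = 1 \<and> a \<noteq> b"
    using bounds[OF K(3)] by metis
  have form: "s = Rule K d 0 a 0 K1 \<or> (\<exists>i<d. (0 < i \<or> g) \<and> s = Rule K d i (b * d) (b * i) K2)"
    if "s \<in> rulesof (prime_nr N) K" for s using that e(1) unfolding rulesof_def by auto
  have dv: "dv r = d" "dv r' = d" "rm r < d" "rm r' < d" using form[OF K(1)] form[OF K(2)] e(2) by auto
  have qr: "q = q'" "rm r = rm r'" using mod_unique[of d q "rm r" q' "rm r'"] rr(7) dv by auto
  show "r = r'"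
  proof (rule ccontr)
    assume ne: "r \<noteq> r'"
    then have "g" "{ml r, ml r'} = {a, b * d}" "ad r = 0" "ad r' = 0" "d = 1" using form[OF K(1)] form[OF K(2)] qr e(5) by auto
    then show False using rr(5,8) qr(1) e(5) by (auto simp: doubleton_eq_iff)
  qed
qed

text \<open>Rules require \<open>q \<ge> 1\<close>, so a number below the divisor would stop the
  machine but not the program. The invariant \<open>okc\<close> excludes this: after one step the
  number is at least \<open>prime_nr N\<close>, which exceeds all divisors, and the start state has
  divisor 1.\<close>

lemma runs_mrules:
  assumes b: "regs_below (Seq x y) N" and n: "0 < n"
  shows "runs (growing_machine.mstep (mrules N (Seq x y))) ([Seq x y], n) = runs (wstep (prime_nr N)) ([Seq x y], n)"
proof -
  let ?c = "Seq x y" and ?m = "growing_machine.mstep (mrules N (Seq x y))"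
  define okc where "okc u \<longleftrightarrow> fst u \<in> insert [] (control_states ?c []) \<and> 0 < snd u \<and> (prime_nr N \<le> snd u \<or> fst u = [?c])" for u
  note md = growing_machine.mstep_def[OF growing_mrules[OF b]]
  have eq: "?m u v \<longleftrightarrow> wstep (prime_nr N) u v" and pres: "wstep (prime_nr N) u v \<Longrightarrow> okc v" if u: "okc u" for u v
  proof -
    obtain K m where km: "u = (K, m)" by fastforce
    obtain d a K1 b' K2 g where e: "entry (prime_nr N) K = (d, a, K1, b', K2, g)" by (metis prod_cases6)
    have "(?m u v \<longleftrightarrow> wstep (prime_nr N) u v) \<and> (wstep (prime_nr N) u v \<longrightarrow> okc v)"
    proof (cases "K = []")
      case True
      have "\<not> ?m u v" unfolding md using mrules_src[of _ N ?c "[]"] control_states_not_Nil km True by auto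
      moreover have "\<not> wstep (prime_nr N) u v" using km True step_Nil by simp
      ultimately show ?thesis by blast
    next
      case False
      then have K: "K \<in> control_states ?c []" using u km by (auto simp: okc_def)
      note bd = entry_bounds[OF control_states_bnd[OF K b] False e]
      have dm: "d \<le> m"
      proof (cases "prime_nr N \<le> m")
        case False
        then have "K = [?c]" using u km by (auto simp: okc_def)
        then show ?thesis using e u km by (auto simp: okc_def)
      qed (use bd(3) in simp)
      have q: "1 \<le> m div d" using dm bd(1) by (simp add: div_greater_zero_iff Suc_le_eq)
      have m: "?m u v \<longleftrightarrow> (\<exists>r\<in>rulesof (prime_nr N) K. \<exists>q\<ge>1. tgt r = fst v \<and> m = dv r * q + rm r \<and> snd v = ml r * q + ad r)"
      proof
        assume "?m u v"
        then show "\<exists>r\<in>rulesof (prime_nr N) K. \<exists>q\<ge>1. tgt r = fst v \<and> m = dv r * q + rm r \<and> snd v = ml r * q + ad r"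
          unfolding md km using mrules_src by fastforce
      next
        assume "\<exists>r\<in>rulesof (prime_nr N) K. \<exists>q\<ge>1. tgt r = fst v \<and> m = dv r * q + rm r \<and> snd v = ml r * q + ad r"
        then obtain r q where rq: "r \<in> rulesof (prime_nr N) K" "q \<ge> 1" "tgt r = fst v" "m = dv r * q + rm r" "snd v = ml r * q + ad r"
          by blast
        have "r \<in> mrules N ?c" unfolding mrules_def using rq(1) K by blast
        then show "?m u v" unfolding md km using rq src_rulesof[OF rq(1)] by auto
      qed
      have w: "wstep (prime_nr N) u v \<longleftrightarrow> d dvd m \<and> v = (K1, m div d * a) \<or> (\<not> d dvd m \<or> g) \<and> v = (K2, m * b')"
        unfolding wstep_def using km False e by simp
      have "?m u v \<longleftrightarrow> wstep (prime_nr N) u v"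
      proof
        assume "?m u v"
        then obtain r q where rq: "r \<in> rulesof (prime_nr N) K" "q \<ge> 1" "tgt r = fst v" "m = dv r * q + rm r" "snd v = ml r * q + ad r"
          unfolding m by blast
        from rq(1) e consider "r = Rule K d 0 a 0 K1" | i where "i < d" "0 < i \<or> g" "r = Rule K d i (b' * d) (b' * i) K2"
          unfolding rulesof_def by auto
        then show "wstep (prime_nr N) u v"
        proof cases
          case 1
          then have "m = d * q" "v = (K1, q * a)" using rq by (auto simp: prod_eq_iff)
          then show ?thesis unfolding w using bd(1) by simp
        next
          case (2 i)
          then have mi: "m = d * q + i" "v = (K2, m * b')" using rq by (auto simp: prod_eq_iff algebra_simps)
          have "\<not> d dvd m \<or> g" using 2(1,2) mi(1) by (auto simp: dvd_add_right_iff nat_dvd_not_less)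
          then show ?thesis unfolding w using mi by simp
        qed
      next
        assume "wstep (prime_nr N) u v"
        then consider "d dvd m" "v = (K1, m div d * a)" | "\<not> d dvd m \<or> g" "v = (K2, m * b')" unfolding w by blast
        then show "?m u v"
        proof cases
          case 1
          have "Rule K d 0 a 0 K1 \<in> rulesof (prime_nr N) K" using e by (simp add: rulesof_def)
          then show ?thesis unfolding m using 1 q
            by (intro bexI[of _ "Rule K d 0 a 0 K1"] exI[of _ "m div d"]) auto
        next
          case 2
          have mm: "m mod d < d" "0 < m mod d \<or> g" using 2(1) bd(1) by (auto simp: dvd_eq_mod_eq_0)
          then have "Rule K d (m mod d) (b' * d) (b' * (m mod d)) K2 \<in> rulesof (prime_nr N) K"
            unfolding rulesof_def e prod.case by blast
          moreover have "m * b' = b' * d * (m div d) + b' * (m mod d)"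
            by (metis add_mult_distrib2 mult.assoc mult.commute mult_div_mod_eq)
          ultimately show ?thesis unfolding m using 2 q
            by (intro bexI[of _ "Rule K d (m mod d) (b' * d) (b' * (m mod d)) K2"] exI[of _ "m div d"]) auto
        qed
      qed
      moreover have "okc v" if wv: "wstep (prime_nr N) u v"
      proof -
        have "K1 \<in> insert [] (control_states ?c []) \<and> K2 \<in> insert [] (control_states ?c [])" by (rule control_states_ent[OF K e])
        moreover have "prime_nr N \<le> m div d * a"
          using bd(4) q by (metis le_trans mult_le_mono mult_1)
        moreover have "prime_nr N \<le> m * b'" using bd(5) dm bd(1) by simp
        ultimately have "fst v \<in> insert [] (control_states ?c []) \<and> prime_nr N \<le> snd v"
          using wv unfolding w by (elim disjE conjE) (simp_all del: control_states.simps)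
        then show ?thesis using prime_nr_gt1[of N] unfolding okc_def by linarith
      qed
      ultimately show ?thesis by blast
    qed
    then show "?m u v \<longleftrightarrow> wstep (prime_nr N) u v" "wstep (prime_nr N) u v \<Longrightarrow> okc v" by blast+
  qed
  have ok0: "okc ([?c], n)" using n control_states_self[of ?c "[]"] by (simp add: okc_def)
  have ok1: "\<forall>j. okc (w j) \<and> wstep (prime_nr N) (w j) (w (Suc j))" if w: "w 0 = ([?c], n)" "\<forall>j. ?m (w j) (w (Suc j))" for w
  proof
    fix j
    have "okc (w j)"
    proof (induction j)
      case (Suc j)
      show ?case by (rule pres[OF Suc]) (use eq[OF Suc] w(2) in blast)
    qed (simp add: w(1) ok0)
    then show "okc (w j) \<and> wstep (prime_nr N) (w j) (w (Suc j))" using eq w by blast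
  qed
  have ok2: "\<forall>j. okc (w j) \<and> ?m (w j) (w (Suc j))" if w: "w 0 = ([?c], n)" "\<forall>j. wstep (prime_nr N) (w j) (w (Suc j))" for w
  proof
    fix j
    have "okc (w j)"
    proof (induction j)
      case (Suc j)
      show ?case by (rule pres[OF Suc]) (use w(2) in blast)
    qed (simp add: w(1) ok0)
    then show "okc (w j) \<and> ?m (w j) (w (Suc j))" using eq w by blast
  qed
  show ?thesis unfolding runs_def using ok1 ok2 by auto
qed

theorem theorem12:
  shows "\<exists>(m::nat) (X::config set). is_SFT m X \<and> countable X \<and>
           (\<forall>k::nat. Pi0_complete (2 * k + 1) {n. occurs (decode_pattern n) (cb_deriv X k)})"
proof -
  define f where "f xs = universal (xs ! 0) (xs ! 1) (xs ! 2)" for xs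
  obtain cf where cf: "computes cf 7 3 f" using rec_nary_computes[OF rec_nary_universal] unfolding f_def by blast
  have "rec_nary 5 pairf" unfolding pairf_def by (intro rec_nary_pr rec_nary_proj; simp)
  then obtain cp where cp: "computes cp 7 5 pairf" using rec_nary_computes by blast
  obtain N0 where "regs_below (main_prog cf cp) N0" using regs_below_ex by blast
  then obtain N where N: "7 < N" "regs_below (main_prog cf cp) N" using regs_below_mono[of "main_prog cf cp" N0 "max 8 N0"]
    by (intro that[of "max 8 N0"]) auto
  obtain x y where main: "main_prog cf cp = Seq x y" by (simp add: main_prog_def)
  have b: "regs_below (Seq x y) N" using N main by simp
  let ?R = "mrules N (Seq x y)" and ?r = "Rule [Seq x y] 1 0 (prime_nr N) 0 [x, y]"
  have runs: "runs (growing_machine.mstep ?R) (src ?r, n) = runs (wstep (prime_nr N)) ([main_prog cf cp], n)" if "0 < n" for n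
    using runs_mrules[OF b that] main by simp
  have rank: "derived (runs (wstep (prime_nr N)) ([main_prog cf cp], n)) (Suc (reg n 4)) = {}"
    "derived (runs (wstep (prime_nr N)) ([main_prog cf cp], n)) (reg n 4) \<noteq> {} \<longleftrightarrow>
      inf_many (\<lambda>y. \<forall>c. f [reg n 0, y, c] \<noteq> 0) (reg n 4) (reg n 1)" if "0 < n" for n
    using main_rank[OF cf cp N that] by blast+
  have cnt: "countable (runs (growing_machine.mstep ?R) (src ?r, n))" if "0 < n" for n
    unfolding runs[OF that] using rank(1)[OF that] by (rule countable_if_derived_empty)
  obtain m X cL cC cR where X: "is_SFT m X" "countable X"
    "\<And>n k. 0 < n \<Longrightarrow> occurs (seed cL cC cR n) (cb_deriv X k) \<longleftrightarrow> derived (runs (growing_machine.mstep ?R) (src ?r, n)) k \<noteq> {}"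
    using growing_machine.machine_SFT[OF growing_mrules[OF b] cnt] by metis
  have "many_one_reducible A {n. occurs (decode_pattern n) (cb_deriv X k)}" if A: "A \<in> Pi0 (2 * k + 1)" for A k
  proof -
    have "arith_pred False (2 * k + 1) (\<lambda>x. x \<in> A)" using A by (simp add: arith_pred_def)
    then obtain Q where Q: "decidable Q" "\<And>x. x \<in> A \<longleftrightarrow> inf_many (\<lambda>y. \<forall>c. Q (pr y c)) k x"
      using Pi_normal_form by blast
    obtain e where e: "\<And>y. (\<forall>c. Q (pr y c)) \<longleftrightarrow> (\<forall>c. universal e y c \<noteq> 0)" using universal_complete[OF Q(1)] by blast
    \<comment> \<open>The width of the seed: its exponents load the registers 0, 4 and 1 with
      \<open>e\<close>, \<open>k\<close> and \<open>x\<close>.\<close>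
    define n0 where "n0 x = prime_nr 0 ^ e * prime_nr 4 ^ k * prime_nr 1 ^ x" for x
    \<comment> \<open>The codes \<open>1\<close> and \<open>2 * j\<close> stand for the integers -1
      and \<open>j\<close>; the entries are those of \<open>seed\<close>, in the same order.\<close>
    define h where "h x = lcons (pr (pr 1 0) cL) (lcons (pr (pr 0 0) cC)
      (lcons (pr (pr (2 * (n0 x - 1)) 0) cC) (lcons (pr (pr (2 * n0 x) 0) cR) 0)))" for x
    have "computable h" unfolding h_def n0_def by (intro computable_intros)
    moreover have "x \<in> A \<longleftrightarrow> occurs (decode_pattern (h x)) (cb_deriv X k)" for x
    proof -
      have pos: "0 < prime_nr r" for r using prime_nr_gt1[of r] by simp
      have n0: "0 < n0 x" using pos by (simp add: n0_def)
      have reg: "reg (n0 x) 0 = e" "reg (n0 x) 1 = x" "reg (n0 x) 4 = k"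
        using pos by (simp_all add: n0_def reg_mult reg_power)
      have c: "cellc (pr 1 0) = (-1, 0)" "cellc (pr (2 * j) 0) = (int j, 0)" for j
        by (simp_all add: cellc_def int_decode_if)
      have "decode_pattern (h x) = seed cL cC cR (n0 x)"
        using n0 c(1) c(2)[of 0] c(2)[of "n0 x - 1"] c(2)[of "n0 x"]
        by (simp add: h_def seed_def decode_pattern_eq of_nat_diff)
      then have "occurs (decode_pattern (h x)) (cb_deriv X k) \<longleftrightarrow>
          inf_many (\<lambda>y. \<forall>c. f [e, y, c] \<noteq> 0) k x"
        using X(3)[OF n0] runs[OF n0] rank(2)[OF n0] reg by simp
      then show ?thesis using Q(2) e by (simp add: f_def)
    qed
    ultimately show ?thesis unfolding many_one_reducible_def by blast
  qed
  then have "Pi0_complete (2 * k + 1) {n. occurs (decode_pattern n) (cb_deriv X k)}" for k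
    unfolding Pi0_complete_def using SFT_derivative_patterns_Pi[OF X(1)] by blast
  then show ?thesis using X(1,2) by blast
qed

end
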